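(* Let $K$ be a compact set in the complex plane such that $K\cap\sigma_c(\mathcal{H}_0)\neq\emptyset$. Then for $\varepsilon$ small enough each of the eigenvalues of $\mathcal{H}_\varepsilon$ not leaving $K$ for all $\varepsilon$ small enough (that is, remaining in $K$ for all sufficiently small $\varepsilon>0$) converges in the limit $\varepsilon\to0$ to one of the edges of a non-degenerate lacuna in the part of the spectrum of $\mathcal{H}_0$ lying inside $K$.
   Context: Let $p,q:\mathbb{R}\to\mathbb{R}$ be $1$-periodic, $p$ piecewise continuously differentiable (continuous with piecewise continuous derivative), $q$ piecewise continuous, $p(x)\geq p_0>0$ for all $x$, and $p(0)=1$. Let $\mathcal{H}_0:=-\frac{d}{dx}p\frac{d}{dx}+q$ be the self-adjoint operator in $L_2(\mathbb{R})$ with domain $W_2^2(\mathbb{R})$. Let $Q\subset\mathbb{R}$ be a fixed bounded open interval. For each small $\varepsilon>0$ let $\mathcal{L}_\varepsilon:W_2^2(Q)\to L_2(Q)$ be a linear operator (no self-adjointness is assumed), bounded uniformly in $\varepsilon$ (operator norms bounded by a constant independent of $\varepsilon$). Denote also by $\mathcal{L}_\varepsilon$ the operator $W_{2,loc}^2(\mathbb{R})\to L_2(\mathbb{R})$ that restricts a function to $Q$, applies $\mathcal{L}_\varepsilon$, and extends the result by zero outside $Q$. Set $\mathcal{H}_\varepsilon:=\mathcal{H}_0-\varepsilon\mathcal{L}_\varepsilon$, an operator in $L_2(\mathbb{R})$ with domain $W_2^2(\mathbb{R})$. Here $\sigma(\cdot)$ and $\sigma_c(\cdot)$ denote the spectrum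 and the continuous spectrum. It is known that $\sigma(\mathcal{H}_0)=\sigma_c(\mathcal{H}_0)=\bigcup_{n=0}^\infty[\mu_n^+,\mu_{n+1}^-]$, where $\mu_0^+<\mu_1^-\leq\mu_1^+<\mu_2^-\leq\mu_2^+<\dots$ are the eigenvalues (listed with multiplicity) of $\left(-\frac{d}{dx}p\frac{d}{dx}+q\right)\phi=\mu\phi$ on $(0,1)$ with boundary conditions $\phi(0)+(-1)^{n+1}\phi(1)=0$, $\phi'(0)+(-1)^{n+1}\phi'(1)=0$; $\mu_n^\pm$ corresponds to periodic conditions for even $n$ and antiperiodic ones for odd $n$. The lacunas are $(-\infty,\mu_0^+)$, whose only edge is $\mu_0^+$ and which is non-degenerate, and $(\mu_n^-,\mu_n^+)$, $n\geq1$, with edges $\mu_n^\pm$; the latter is non-degenerate if $\mu_n^-<\mu_n^+$.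
   Formalization: Convergence to one edge is stated for eigenvalue families whose jumps in ε tend to zero (automatic if convergent or continuous), since a selection may alternate between eigenvalues near two edges; an arbitrary family is shown to approach the set of such edges in K. *)

theory Defs
  imports "HOL-Analysis.Analysis" "HOL-Library.Function_Algebras"
begin

section \<open>Lebesgue and Sobolev spaces on the line\<close>

text \<open>Elements of the function spaces over an open set \<open>S\<close> are represented by functions
  \<open>real \<Rightarrow> complex\<close> of which only the values on \<open>S\<close> matter, and these only up to null sets.
  Accordingly equality of elements is always written out as equality almost everywhere on \<open>S\<close>.\<close>

definition L2_space :: "real set \<Rightarrow> (real \<Rightarrow> complex) set" where
  "L2_space S = {u. u \<in> borel_measurable (lebesgue_on S) \<and>
                    integrable (lebesgue_on S) (\<lambda>x. (norm (u x))\<^sup>2)}"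

definition L2_norm :: "real set \<Rightarrow> (real \<Rightarrow> complex) \<Rightarrow> real" where
  "L2_norm S u = sqrt (LINT x|lebesgue_on S. (norm (u x))\<^sup>2)"

definition locally_integrable :: "real set \<Rightarrow> (real \<Rightarrow> complex) \<Rightarrow> bool" where
  "locally_integrable S u \<longleftrightarrow> (\<forall>C. compact C \<and> C \<subseteq> S \<longrightarrow> u absolutely_integrable_on C)"

text \<open>Weak derivative. As in Brezis' textbook treatment of Sobolev spaces in one dimension, the
  test functions \<open>\<phi>\<close> are the continuously differentiable functions with compact support in \<open>S\<close>;
  \<open>\<phi>'\<close> is the classical derivative.\<close>

definition has_weak_deriv :: "real set \<Rightarrow> (real \<Rightarrow> complex) \<Rightarrow> (real \<Rightarrow> complex) \<Rightarrow> bool" where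
  "has_weak_deriv S u v \<longleftrightarrow> locally_integrable S u \<and> locally_integrable S v \<and>
     (\<forall>\<phi> \<phi>' :: real \<Rightarrow> real.
        (\<forall>x. (\<phi> has_real_derivative \<phi>' x) (at x)) \<and> continuous_on UNIV \<phi>' \<and>
        (\<exists>C. compact C \<and> C \<subseteq> S \<and> (\<forall>x. x \<notin> C \<longrightarrow> \<phi> x = 0)) \<longrightarrow>
        (LINT x|lebesgue_on S. \<phi>' x *\<^sub>R u x) = - (LINT x|lebesgue_on S. \<phi> x *\<^sub>R v x))"

text \<open>Weak derivatives are unique up to null sets; \<open>wderiv\<close> picks a representative.\<close>

definition wderiv :: "real set \<Rightarrow> (real \<Rightarrow> complex) \<Rightarrow> real \<Rightarrow> complex" where
  "wderiv S u = (SOME v. has_weak_deriv S u v)"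

definition W22_space :: "real set \<Rightarrow> (real \<Rightarrow> complex) set" where
  "W22_space S = {u \<in> L2_space S. \<exists>v \<in> L2_space S. \<exists>w \<in> L2_space S.
                    has_weak_deriv S u v \<and> has_weak_deriv S v w}"

definition W22_norm :: "real set \<Rightarrow> (real \<Rightarrow> complex) \<Rightarrow> real" where
  "W22_norm S u = sqrt ((L2_norm S u)\<^sup>2 + (L2_norm S (wderiv S u))\<^sup>2
                        + (L2_norm S (wderiv S (wderiv S u)))\<^sup>2)"


section \<open>Spectral notions for operators in \<open>L\<^sub>2(\<real>)\<close>\<close>

text \<open>An operator in \<open>L\<^sub>2(\<real>)\<close> is given by its domain \<open>D\<close> and its action \<open>A\<close> on representatives.\<close>

definition is_eigenvalue ::
  "(real \<Rightarrow> complex) set \<Rightarrow> ((real \<Rightarrow> complex) \<Rightarrow> real \<Rightarrow> complex) \<Rightarrow> complex \<Rightarrow> bool" where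
  "is_eigenvalue D A z \<longleftrightarrow>
     (\<exists>u\<in>D. \<not> (AE x in lebesgue. u x = 0) \<and> (AE x in lebesgue. A u x = z * u x))"

text \<open>In the resolvent set \<open>A - z\<close> is a bijection onto \<open>L\<^sub>2(\<real>)\<close> with bounded inverse; injectivity is
  contained in the norm estimate.\<close>

definition resolvent_set ::
  "(real \<Rightarrow> complex) set \<Rightarrow> ((real \<Rightarrow> complex) \<Rightarrow> real \<Rightarrow> complex) \<Rightarrow> complex set" where
  "resolvent_set D A = {z.
     (\<forall>f\<in>L2_space UNIV. \<exists>u\<in>D. AE x in lebesgue. A u x - z * u x = f x) \<and>
     (\<exists>C. \<forall>u\<in>D. L2_norm UNIV u \<le> C * L2_norm UNIV (\<lambda>x. A u x - z * u x))}"

definition spectrum ::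
  "(real \<Rightarrow> complex) set \<Rightarrow> ((real \<Rightarrow> complex) \<Rightarrow> real \<Rightarrow> complex) \<Rightarrow> complex set" where
  "spectrum D A = - resolvent_set D A"

definition continuous_spectrum ::
  "(real \<Rightarrow> complex) set \<Rightarrow> ((real \<Rightarrow> complex) \<Rightarrow> real \<Rightarrow> complex) \<Rightarrow> complex set" where
  "continuous_spectrum D A = {z \<in> spectrum D A. \<not> is_eigenvalue D A z \<and>
     (\<forall>f\<in>L2_space UNIV. \<forall>\<delta>>0. \<exists>u\<in>D. L2_norm UNIV (\<lambda>x. A u x - z * u x - f x) < \<delta>)}"


section \<open>The periodic operator and its perturbation\<close>

text \<open>Piecewise continuity: the exceptional points do not accumulate, and the one-sided limits are
  finite.\<close>

definition piecewise_continuous :: "(real \<Rightarrow> real) \<Rightarrow> bool" where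
  "piecewise_continuous g \<longleftrightarrow>
     (\<exists>S. (\<forall>a b. finite (S \<inter> {a..b})) \<and> (\<forall>x. x \<notin> S \<longrightarrow> isCont g x)) \<and>
     (\<forall>x. (\<exists>l. (g \<longlongrightarrow> l) (at_left x)) \<and> (\<exists>r. (g \<longlongrightarrow> r) (at_right x)))"

text \<open>The library's \<open>piecewise_C1_differentiable_on\<close> would allow an unbounded derivative.\<close>

definition piecewise_C1 :: "(real \<Rightarrow> real) \<Rightarrow> bool" where
  "piecewise_C1 g \<longleftrightarrow> continuous_on UNIV g \<and>
     (\<exists>g' S. piecewise_continuous g' \<and> (\<forall>a b. finite (S \<inter> {a..b})) \<and>
             (\<forall>x. x \<notin> S \<longrightarrow> (g has_real_derivative g' x) (at x)))"

definition periodic_coefficients :: "(real \<Rightarrow> real) \<Rightarrow> (real \<Rightarrow> real) \<Rightarrow> real \<Rightarrow> bool" where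
  "periodic_coefficients p q p0 \<longleftrightarrow>
     (\<forall>x. p (x + 1) = p x) \<and> (\<forall>x. q (x + 1) = q x) \<and>
     piecewise_C1 p \<and> piecewise_continuous q \<and> p0 > 0 \<and> (\<forall>x. p x \<ge> p0) \<and> p 0 = 1"

text \<open>The differential expression \<open>- (p u')' + q u\<close> on \<open>S\<close>; \<open>\<H>\<^sub>0\<close> is its realisation with
  \<open>S = UNIV\<close> and domain \<open>W22_space UNIV\<close>.\<close>

definition sturm_liouville ::
  "real set \<Rightarrow> (real \<Rightarrow> real) \<Rightarrow> (real \<Rightarrow> real) \<Rightarrow> (real \<Rightarrow> complex) \<Rightarrow> real \<Rightarrow> complex" where
  "sturm_liouville S p q u =
     (\<lambda>x. - wderiv S (\<lambda>y. of_real (p y) * wderiv S u y) x + of_real (q x) * u x)"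

abbreviation H0 ::
  "(real \<Rightarrow> real) \<Rightarrow> (real \<Rightarrow> real) \<Rightarrow> (real \<Rightarrow> complex) \<Rightarrow> real \<Rightarrow> complex" where
  "H0 p q \<equiv> sturm_liouville UNIV p q"

text \<open>\<open>A\<close> induces a linear operator from \<open>W\<^sub>2\<^sup>2(Q)\<close> to \<open>L\<^sub>2(Q)\<close> of norm at most \<open>C\<close>. The second conjunct
  says that \<open>A\<close> acts on equivalence classes.\<close>

definition bounded_operator_W22_L2 ::
  "real set \<Rightarrow> real \<Rightarrow> ((real \<Rightarrow> complex) \<Rightarrow> real \<Rightarrow> complex) \<Rightarrow> bool" where
  "bounded_operator_W22_L2 Q C A \<longleftrightarrow>
     (\<forall>u\<in>W22_space Q. A u \<in> L2_space Q) \<and>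
     (\<forall>u\<in>W22_space Q. \<forall>v\<in>W22_space Q.
        (AE x in lebesgue_on Q. u x = v x) \<longrightarrow> (AE x in lebesgue_on Q. A u x = A v x)) \<and>
     (\<forall>u\<in>W22_space Q. \<forall>v\<in>W22_space Q.
        AE x in lebesgue_on Q. A (\<lambda>y. u y + v y) x = A u x + A v x) \<and>
     (\<forall>u\<in>W22_space Q. \<forall>c. AE x in lebesgue_on Q. A (\<lambda>y. c * u y) x = c * A u x) \<and>
     (\<forall>u\<in>W22_space Q. L2_norm Q (A u) \<le> C * W22_norm Q u)"

text \<open>\<open>\<H>\<^sub>\<epsilon> = \<H>\<^sub>0 - \<epsilon> \<L>\<^sub>\<epsilon>\<close>, with \<open>\<L>\<^sub>\<epsilon> u\<close> extended by zero outside \<open>Q\<close>. No explicit restriction of \<open>u\<close>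
  to \<open>Q\<close> is needed because \<open>\<L>\<^sub>\<epsilon>\<close> only sees the values on \<open>Q\<close>.\<close>

definition H_pert ::
  "(real \<Rightarrow> real) \<Rightarrow> (real \<Rightarrow> real) \<Rightarrow> real set \<Rightarrow>
   (real \<Rightarrow> (real \<Rightarrow> complex) \<Rightarrow> real \<Rightarrow> complex) \<Rightarrow> real \<Rightarrow> (real \<Rightarrow> complex) \<Rightarrow> real \<Rightarrow> complex" where
  "H_pert p q Q L \<epsilon> u =
     (\<lambda>x. H0 p q u x - of_real \<epsilon> * (if x \<in> Q then L \<epsilon> u x else 0))"


section \<open>Lacunas\<close>

global_interpretation cfun: vector_space "\<lambda>(c::complex) (f :: real \<Rightarrow> complex) x. c * f x"
  by unfold_locales (auto simp: fun_eq_iff algebra_simps)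

text \<open>Solutions of the boundary value problem on \<open>(0,1)\<close>, periodic for even \<open>n\<close> and antiperiodic for
  odd \<open>n\<close>. A solution is represented by its continuously differentiable representative on
  \<open>[0,1]\<close>, so that the boundary values make sense, and set to zero outside \<open>[0,1]\<close>, so that the
  dimension is the one of the space of solutions on the interval.\<close>

definition bvp_solutions ::
  "(real \<Rightarrow> real) \<Rightarrow> (real \<Rightarrow> real) \<Rightarrow> nat \<Rightarrow> complex \<Rightarrow> (real \<Rightarrow> complex) set" where
  "bvp_solutions p q n z = {\<phi>.
     (\<forall>x. x \<notin> {0..1} \<longrightarrow> \<phi> x = 0) \<and>
     \<phi> \<in> W22_space {0<..<1} \<and>
     (AE x in lebesgue_on {0<..<1}. sturm_liouville {0<..<1} p q \<phi> x = z * \<phi> x) \<and>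
     (\<exists>\<phi>'. continuous_on {0..1} \<phi>' \<and>
           (\<forall>x\<in>{0..1}. (\<phi> has_vector_derivative \<phi>' x) (at x within {0..1})) \<and>
           \<phi> 0 + (-1) ^ (n + 1) * \<phi> 1 = 0 \<and> \<phi>' 0 + (-1) ^ (n + 1) * \<phi>' 1 = 0)}"

text \<open>\<open>\<mu>m n\<close> and \<open>\<mu>p n\<close> stand for \<open>\<mu>\<^sub>n\<^sup>-\<close> and \<open>\<mu>\<^sub>n\<^sup>+\<close>; the value \<open>\<mu>m 0\<close> plays no role. The last conjunct
  says that for either type of boundary condition every eigenvalue is listed according to its
  multiplicity and nothing else is listed. The sets are finite by the strict inequalities.\<close>

definition band_edges ::
  "(real \<Rightarrow> real) \<Rightarrow> (real \<Rightarrow> real) \<Rightarrow> (nat \<Rightarrow> real) \<Rightarrow> (nat \<Rightarrow> real) \<Rightarrow> bool" where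
  "band_edges p q \<mu>m \<mu>p \<longleftrightarrow>
     (\<forall>n. \<mu>p n < \<mu>m (Suc n) \<and> \<mu>m (Suc n) \<le> \<mu>p (Suc n)) \<and>
     (\<forall>n z. cfun.dim (bvp_solutions p q n z) =
              card {k. even k = even n \<and> of_real (\<mu>p k) = z} +
              card {k. k \<ge> 1 \<and> even k = even n \<and> of_real (\<mu>m k) = z})"

definition nondegenerate_lacuna_edges :: "(nat \<Rightarrow> real) \<Rightarrow> (nat \<Rightarrow> real) \<Rightarrow> real set" where
  "nondegenerate_lacuna_edges \<mu>m \<mu>p =
     {\<mu>p 0} \<union> (\<Union>n\<in>{n. n \<ge> 1 \<and> \<mu>m n < \<mu>p n}. {\<mu>m n, \<mu>p n})"


section \<open>Following one eigenvalue as \<open>\<epsilon> \<rightarrow> 0\<close>\<close>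

text \<open>As the operators \<open>\<L>\<^sub>\<epsilon>\<close> need not depend continuously on \<open>\<epsilon>\<close>, neither need the
  eigenvalues. What distinguishes a family following one eigenvalue from one that keeps switching
  between different eigenvalues is that its jumps tend to zero. Continuous families have this
  property, and a family without it cannot converge.\<close>

definition vanishing_jumps :: "(real \<Rightarrow> complex) \<Rightarrow> bool" where
  "vanishing_jumps ev \<longleftrightarrow>
     (\<forall>\<eta>>0. \<forall>\<^sub>F \<epsilon> in at_right 0. \<forall>\<^sub>F \<epsilon>' in at \<epsilon>. dist (ev \<epsilon>') (ev \<epsilon>) < \<eta>)"

lemma vanishing_jumps_if_continuous:
  assumes "r > 0" "continuous_on {0<..<r} ev"
  shows "vanishing_jumps ev"
  unfolding vanishing_jumps_def
proof (intro allI impI)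
  fix \<eta> :: real assume "\<eta> > 0"
  have "\<forall>\<^sub>F \<epsilon>' in at \<epsilon>. dist (ev \<epsilon>') (ev \<epsilon>) < \<eta>" if "\<epsilon> \<in> {0<..<r}" for \<epsilon>
  proof -
    have "isCont ev \<epsilon>"
      using assms(2) that by (simp add: continuous_on_eq_continuous_at)
    then show ?thesis
      using \<open>\<eta> > 0\<close> by (simp add: isCont_def tendstoD)
  qed
  moreover have "\<forall>\<^sub>F \<epsilon> in at_right 0. \<epsilon> \<in> {0<..<r}"
    using assms(1) by (rule eventually_at_right_real)
  ultimately show "\<forall>\<^sub>F \<epsilon> in at_right 0. \<forall>\<^sub>F \<epsilon>' in at \<epsilon>. dist (ev \<epsilon>') (ev \<epsilon>) < \<eta>"
    by (rule eventually_mono[rotated])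
qed

lemma vanishing_jumps_if_convergent:
  assumes "(ev \<longlongrightarrow> l) (at_right 0)"
  shows "vanishing_jumps ev"
  unfolding vanishing_jumps_def
proof (intro allI impI)
  fix \<eta> :: real assume "\<eta> > 0"
  then have "\<forall>\<^sub>F \<epsilon> in at_right 0. dist (ev \<epsilon>) l < \<eta> / 2"
    using assms by (intro tendstoD) auto
  then obtain r where r: "r > 0" "\<And>\<epsilon>. 0 < \<epsilon> \<Longrightarrow> \<epsilon> < r \<Longrightarrow> dist (ev \<epsilon>) l < \<eta> / 2"
    unfolding eventually_at_right_field by auto
  have "\<forall>\<^sub>F \<epsilon>' in at \<epsilon>. dist (ev \<epsilon>') (ev \<epsilon>) < \<eta>" if "\<epsilon> \<in> {0<..<r}" for \<epsilon>
  proof -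
    have "\<forall>\<^sub>F \<epsilon>' in at \<epsilon>. \<epsilon>' \<in> {0<..<r}"
      using that by (intro eventually_at_in_open') auto
    then show ?thesis
    proof eventually_elim
      case (elim \<epsilon>')
      have "dist (ev \<epsilon>') l < \<eta> / 2" "dist (ev \<epsilon>) l < \<eta> / 2"
        using r(2) elim that by auto
      then show ?case by (rule dist_triangle_half_l)
    qed
  qed
  moreover have "\<forall>\<^sub>F \<epsilon> in at_right 0. \<epsilon> \<in> {0<..<r}"
    using r(1) by (rule eventually_at_right_real)
  ultimately show "\<forall>\<^sub>F \<epsilon> in at_right 0. \<forall>\<^sub>F \<epsilon>' in at \<epsilon>. dist (ev \<epsilon>') (ev \<epsilon>) < \<eta>"
    by (rule eventually_mono[rotated])
qed

end

theory Submission
  imports Defs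
begin

text \<open>
  The proof compares eigenfunctions on the two sides of \<open>Q\<close>. Suppose \<open>z\<^sub>n\<close> is an eigenvalue of
  \<open>\<H>\<^bsub>\<epsilon>\<^sub>n\<^esub>\<close>, \<open>\<epsilon>\<^sub>n \<rightarrow> 0\<close> and \<open>z\<^sub>n \<rightarrow> \<zeta>\<close>. With the quasi-derivative \<open>v = p u'\<close> the eigenvalue equation becomes the
  first-order system \<open>u' = v / p\<close>, \<open>v' = (q - z\<^sub>n) u + h\<^sub>n\<close>, where \<open>h\<^sub>n = - \<epsilon>\<^sub>n \<L>\<^bsub>\<epsilon>\<^sub>n\<^esub> u\<close> lives on \<open>Q\<close>.
  Gronwall's inequality bounds \<open>u\<close> in \<open>W\<^sub>2\<^sup>2(Q)\<close> by the Cauchy data \<open>(u, v)\<close> at the left end of \<open>Q\<close>, up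
  to a term that is absorbed for small \<open>\<epsilon>\<^sub>n\<close> (\<open>eigenfunction_estimate\<close>). Hence, after normalising the
  Cauchy data, \<open>h\<^sub>n \<rightarrow> 0\<close> in \<open>L\<^sub>1\<close>, and along a subsequence the eigenfunctions converge locally to a
  nonzero solution \<open>w\<close> of the unperturbed equation at \<open>\<zeta>\<close> (\<open>solves_limit\<close>).

  Outside \<open>Q\<close> the eigenfunction solves the periodic equation and is square integrable. The Wronskian
  of such a solution and its unit translate is constant and integrable along the half-line, so it
  vanishes, and the solution is multiplied by a constant of modulus below \<open>1\<close> when one moves by one
  period away from \<open>Q\<close> (\<open>decaying_solution_multiplier\<close>). Another Wronskian shows that the multipliers \<open>\<rho>\<^sub>n\<close> on the right and
  on the left agree (\<open>left_right_multipliers_eq\<close>). In the limit \<open>w(x + 1) = \<rho> w(x)\<close> and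
  \<open>w(x - 1) = \<rho> w(x)\<close>, whence \<open>\<rho> = \<plusminus>1\<close>: \<open>w\<close> is periodic or antiperiodic and \<open>\<zeta>\<close> is one of the numbers
  \<open>\<mu>\<^sub>k\<^sup>\<plusminus>\<close> (\<open>limit_is_periodic\<close>).

  It remains to exclude the degenerate lacunas, where all solutions at \<open>\<zeta>\<close> are (anti)periodic. For an
  (anti)periodic solution \<open>\<theta>\<close> at \<open>\<zeta>\<close>, Green's formula over one period expresses \<open>(\<zeta> - z\<^sub>n) \<integral> \<theta> u\<close> by
  \<open>\<plusminus>\<rho>\<^sub>n - 1\<close> times a Wronskian, both for the part of \<open>u\<close> on the right of \<open>Q\<close> and for the one on the left,
  but with opposite signs. Both parts converge to the same \<open>w\<close>; if \<open>\<theta>\<close> and \<open>w\<close> are linearly independent,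
  elimination of \<open>\<rho>\<^sub>n\<close> gives \<open>\<integral> \<theta> w = 0\<close>. If there were one such \<open>\<theta>\<close>, it could be combined with the complex
  conjugate of \<open>w\<close>, and \<open>\<integral> \<bar>w\<bar>\<^sup>2 = 0\<close> would follow
  (\<open>no_transversal_quasi_periodic_solution\<close>). So the eigenvalue \<open>\<zeta>\<close> of the boundary value problem is
  simple, that is, an edge of a non-degenerate lacuna. The normalised eigenfunctions are approximate
  eigenfunctions of \<open>\<H>\<^sub>0\<close> and put \<open>\<zeta>\<close> into its spectrum (\<open>eigenvalue_cluster_point\<close>).

  Thus every cluster point of the eigenvalues is an edge in \<open>K\<close>, which by compactness is the first part of
  the theorem. For the second part, two different cluster points would be separated by a vertical line
  that avoids the countably many edges and from which the eigenvalues therefore stay away; with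
  vanishing jumps they cannot change sides.
\<close>

section \<open>Primitives of integrable functions\<close>

lemma is_interval_Icc_subset:
  fixes I :: "real set"
  assumes "is_interval I" "s \<in> I" "x \<in> I"
  shows "{s..x} \<subseteq> I"
  using assms unfolding is_interval_1 by (meson atLeastAtMost_iff subsetI)

text \<open>Absolute continuity of \<open>f\<close> on compact subintervals, with derivative \<open>g\<close>. In this integrated form \<open>g\<close>
  matters only up to null sets, as is appropriate for weak derivatives.\<close>

definition primitive_on :: "real set \<Rightarrow> (real \<Rightarrow> complex) \<Rightarrow> (real \<Rightarrow> complex) \<Rightarrow> bool" where
  "primitive_on I f g \<longleftrightarrow> (\<forall>s\<in>I. \<forall>x\<in>I. s \<le> x \<longrightarrow>
     g absolutely_integrable_on {s..x} \<and> (g has_integral (f x - f s)) {s..x})"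

lemma primitive_onD:
  assumes "primitive_on I f g" "s \<in> I" "x \<in> I" "s \<le> x"
  shows "g absolutely_integrable_on {s..x}" "(g has_integral (f x - f s)) {s..x}"
    "integral {s..x} g = f x - f s"
  using assms unfolding primitive_on_def by (auto intro: integral_unique)

lemma primitive_on_subset: "primitive_on I f g \<Longrightarrow> J \<subseteq> I \<Longrightarrow> primitive_on J f g"
  unfolding primitive_on_def by blast

lemma continuous_mult_absolutely_integrable:
  fixes f g :: "real \<Rightarrow> complex"
  assumes "continuous_on {s..x} f" "g absolutely_integrable_on {s..x}"
  shows "(\<lambda>t. f t * g t) absolutely_integrable_on {s..x}"
proof (rule absolutely_integrable_bounded_measurable_product[OF bilinear_times])
  show "f \<in> borel_measurable (lebesgue_on {s..x})"
    using assms(1) by (intro continuous_imp_measurable_on_sets_lebesgue) auto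
  show "bounded (f ` {s..x})"
    using assms(1) by (intro compact_imp_bounded compact_continuous_image) auto
qed (use assms in auto)

lemma AE_iff_negligible: "(AE x in lebesgue. P x) \<longleftrightarrow> negligible {x. \<not> P x}"
  by (simp add: negligible_iff_null_sets completion.AE_iff_null_sets)

lemma primitive_on_AE_cong:
  assumes "primitive_on I f g" "is_interval I" "AE x in lebesgue. x \<in> I \<longrightarrow> g' x = g x"
  shows "primitive_on I f g'"
  unfolding primitive_on_def
proof (intro ballI impI)
  fix s x assume sx: "s \<in> I" "x \<in> I" "s \<le> x"
  have sub: "{s..x} \<subseteq> I"
    by (rule is_interval_Icc_subset[OF assms(2) sx(1,2)])
  define N where "N = {x. \<not> (x \<in> I \<longrightarrow> g' x = g x)}"
  have N: "negligible N" using assms(3) by (simp add: AE_iff_negligible N_def)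
  have eq: "t \<in> {s..x} - N \<Longrightarrow> g' t = g t" for t
    using sub by (auto simp: N_def)
  show "g' absolutely_integrable_on {s..x} \<and> (g' has_integral (f x - f s)) {s..x}"
    using absolutely_integrable_spike[OF primitive_onD(1)[OF assms(1) sx] N eq]
      has_integral_spike[OF N eq primitive_onD(2)[OF assms(1) sx]] by simp
qed

text \<open>The definition gives continuity only on compact intervals with end points in \<open>I\<close>. For a
  convergent sequence in \<open>I\<close> the least and the greatest element among its terms and its limit are such
  end points.\<close>

lemma primitive_on_continuous:
  assumes "primitive_on I f g" "is_interval I"
  shows "continuous_on I f"
  unfolding continuous_on_sequentially
proof (intro allI ballI impI, elim conjE)
  fix X :: "nat \<Rightarrow> real" and t
  assume t: "t \<in> I" and X: "\<forall>n. X n \<in> I" "X \<longlonglongrightarrow> t"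
  define K where "K = insert t (range X)"
  have K: "compact K" "K \<noteq> {}" "K \<subseteq> I"
    using compact_sequence_with_limit[OF X(2)] X t by (auto simp: K_def)
  then obtain s where s: "s \<in> K" "\<forall>x\<in>K. s \<le> x" using compact_attains_inf by metis
  obtain e where e: "e \<in> K" "\<forall>x\<in>K. x \<le> e" using compact_attains_sup K by metis
  have se: "s \<in> I" "e \<in> I" "s \<le> e" "K \<subseteq> {s..e}"
    using s e K by auto
  have "{s..e} \<subseteq> I" 
    by (rule is_interval_Icc_subset[OF assms(2) se(1,2)])
  note P = primitive_onD[OF assms(1)]
  have "continuous_on {s..e} (\<lambda>x. f s + integral {s..x} g)"
    by (intro continuous_intros indefinite_integral_continuous_1)
       (use P(2)[OF se(1-3)] in blast)
  moreover have "f s + integral {s..x} g = f x" if "x \<in> {s..e}" for x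
    using P(3)[OF se(1), of x] that \<open>{s..e} \<subseteq> I\<close> by auto
  ultimately have "continuous_on {s..e} f"
    by (rule continuous_on_eq)
  moreover have "t \<in> {s..e}" "\<forall>n. X n \<in> {s..e}"
    using se(4) by (auto simp: K_def subset_eq)
  ultimately show "(f \<circ> X) \<longlonglongrightarrow> f t"
    using X(2) by (simp add: continuous_on_sequentially)
qed

lemma continuous_on_Icc_modulus:
  fixes f :: "real \<Rightarrow> complex"
  assumes "continuous_on {a..b} f" "e > 0"
  obtains d where "d > 0" "\<And>x t. x \<in> {a..b} \<Longrightarrow> t \<in> {a..b} \<Longrightarrow> \<bar>x - t\<bar> < d \<Longrightarrow> norm (f x - f t) < e"
proof -
  obtain d where "d > 0"
    "\<And>t x. t \<in> {a..b} \<Longrightarrow> x \<in> {a..b} \<Longrightarrow> dist x t < d \<Longrightarrow> dist (f x) (f t) < e"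
    using compact_uniformly_continuous[OF assms(1) compact_Icc] assms(2)
    unfolding uniformly_continuous_on_def by blast
  then show ?thesis by (intro that[of d]) (auto simp: dist_norm)
qed

text \<open>If the increments of \<open>\<phi>\<close> are locally at most \<open>e\<close> times those of \<open>G\<close>, the same holds between the
  end points by bisection; then \<open>e\<close> tends to zero.\<close>

lemma equal_ends_if_small_increments:
  fixes \<phi> :: "real \<Rightarrow> complex" and G :: "real \<Rightarrow> real"
  assumes "a \<le> b"
    and loc: "\<And>e. e > 0 \<Longrightarrow> \<exists>d>0. \<forall>t x. a \<le> t \<and> t \<le> x \<and> x \<le> b \<and> x - t < d \<longrightarrow>
                  norm (\<phi> x - \<phi> t) \<le> e * (G x - G t)"
  shows "\<phi> b = \<phi> a"
proof -
  have le: "norm (\<phi> b - \<phi> a) \<le> e * (G b - G a)" if e: "e > 0" for e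
  proof -
    obtain d where d: "d > 0" "\<And>t x. a \<le> t \<Longrightarrow> t \<le> x \<Longrightarrow> x \<le> b \<Longrightarrow> x - t < d \<Longrightarrow>
                  norm (\<phi> x - \<phi> t) \<le> e * (G x - G t)"
      using loc[OF e] by auto
    define P where "P t x \<longleftrightarrow> (a \<le> t \<and> x \<le> b \<longrightarrow> norm (\<phi> x - \<phi> t) \<le> e * (G x - G t))" for t x
    have "P a b"
    proof (rule Bolzano[OF assms(1)])
      fix r s t assume *: "P r s" "P s t" "r \<le> s" "s \<le> t"
      have "norm (\<phi> t - \<phi> r) \<le> norm (\<phi> t - \<phi> s) + norm (\<phi> s - \<phi> r)"
        using norm_triangle_ineq[of "\<phi> t - \<phi> s" "\<phi> s - \<phi> r"] by simp
      then show "P r t" using * unfolding P_def by (auto simp: algebra_simps)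
    qed (use d in \<open>auto simp: P_def\<close>)
    then show ?thesis by (simp add: P_def)
  qed
  show ?thesis
  proof (rule ccontr)
    assume "\<not> ?thesis"
    then have pos: "norm (\<phi> b - \<phi> a) > 0" by simp
    moreover have "norm (\<phi> b - \<phi> a) \<le> G b - G a" using le[of 1] by simp
    ultimately have "G b - G a > 0" by linarith
    with le[of "norm (\<phi> b - \<phi> a) / (2 * (G b - G a))"] pos show False
      by (simp add: field_simps)
  qed
qed

text \<open>The product rule for absolutely continuous functions: \<open>f g\<close> minus the integral of the claimed
  derivative has increments that are small compared with those of the integral of \<open>\<bar>f'\<bar> + \<bar>g'\<bar>\<close>, because \<open>f\<close> and \<open>g\<close> are uniformly continuous.\<close>

lemma primitive_on_mult:
  assumes f: "primitive_on I f f'" and g: "primitive_on I g g'" and I: "is_interval I"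
  shows "primitive_on I (\<lambda>x. f x * g x) (\<lambda>x. f' x * g x + f x * g' x)"
  unfolding primitive_on_def
proof (intro ballI impI conjI)
  fix s e assume se: "s \<in> I" "e \<in> I" "s \<le> e"
  have sub: "{s..e} \<subseteq> I"
    by (rule is_interval_Icc_subset[OF I se(1,2)])
  note F = primitive_onD[OF f] and G = primitive_onD[OF g]
  have cf: "continuous_on {s..e} f" and cg: "continuous_on {s..e} g"
    using primitive_on_continuous[OF f I] primitive_on_continuous[OF g I] sub
    by (auto intro: continuous_on_subset)
  let ?h = "\<lambda>x. f' x * g x + f x * g' x"
  have hab: "?h absolutely_integrable_on {t..x}" if "t \<in> {s..e}" "x \<in> {s..e}" "t \<le> x" for t x
  proof (rule set_integral_add)
    have "{t..x} \<subseteq> {s..e}" using that by auto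
    then have c: "continuous_on {t..x} f" "continuous_on {t..x} g"
      using cf cg by (auto intro: continuous_on_subset)
    have "t \<in> I" "x \<in> I" using that sub by auto
    then show "(\<lambda>x. f x * g' x) absolutely_integrable_on {t..x}"
      "(\<lambda>x. f' x * g x) absolutely_integrable_on {t..x}"
      using continuous_mult_absolutely_integrable[OF c(1) G(1)]
        continuous_mult_absolutely_integrable[OF c(2) F(1)] that
      by (auto simp: mult.commute)
  qed
  show "?h absolutely_integrable_on {s..e}" using hab se by auto
  define \<phi> where "\<phi> x = f x * g x - integral {s..x} ?h" for x
  define k where "k x = norm (f' x) + norm (g' x)" for x
  define K where "K x = integral {s..x} k" for x
  have kint: "k integrable_on {t..x}" if "t \<in> {s..e}" "x \<in> {s..e}" "t \<le> x" for t x
  proof -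
    have "t \<in> I" "x \<in> I" using that sub by auto
    then show ?thesis
      unfolding k_def using that F(1)[of t x] G(1)[of t x] unfolding absolutely_integrable_on_def
      by (intro integrable_add) auto
  qed
  have hi: "?h integrable_on {t..x}" if "t \<in> {s..e}" "x \<in> {s..e}" "t \<le> x" for t x
    using hab[OF that] absolutely_integrable_on_def by blast
  have "\<phi> e = \<phi> s"
  proof (rule equal_ends_if_small_increments[where G = K, OF se(3)])
    fix r :: real assume "r > 0"
    obtain d1 where d1: "d1 > 0" "\<And>x t. x \<in> {s..e} \<Longrightarrow> t \<in> {s..e} \<Longrightarrow> \<bar>x - t\<bar> < d1 \<Longrightarrow> norm (f x - f t) < r"
      using continuous_on_Icc_modulus[OF cf \<open>r > 0\<close>] by metis
    obtain d2 where d2: "d2 > 0" "\<And>x t. x \<in> {s..e} \<Longrightarrow> t \<in> {s..e} \<Longrightarrow> \<bar>x - t\<bar> < d2 \<Longrightarrow> norm (g x - g t) < r"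
      using continuous_on_Icc_modulus[OF cg \<open>r > 0\<close>] by metis
    have "norm (\<phi> x - \<phi> t) \<le> r * (K x - K t)"
      if tx: "s \<le> t" "t \<le> x" "x \<le> e" "x - t < min d1 d2" for t x
    proof -
      have tI: "t \<in> {s..e}" "x \<in> {s..e}" using tx by auto
      then have I': "t \<in> I" "x \<in> I" using sub by auto
      have Kd: "K x - K t = integral {t..x} k"
        using Henstock_Kurzweil_Integration.integral_combine[OF tx(1,2), of k] kint[of s x] tI tx
        by (auto simp: K_def algebra_simps)
      have hd: "integral {s..x} ?h - integral {s..t} ?h = integral {t..x} ?h"
        using Henstock_Kurzweil_Integration.integral_combine[OF tx(1,2), of ?h] hi[of s x] tI tx
        by (auto simp: algebra_simps)
      \<comment> \<open>The increment of \<open>f g\<close> is split so that each difference below is a difference of a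
        continuous function over a short interval, integrated against an integrable one.\<close>
      have "((\<lambda>u. f' u * g x + f t * g' u) has_integral ((f x - f t) * g x + f t * (g x - g t))) {t..x}"
        by (intro has_integral_add has_integral_mult_left has_integral_mult_right F(2) G(2) I' tx)
      then have "((\<lambda>u. (f' u * g x + f t * g' u) - ?h u) has_integral
          ((f x - f t) * g x + f t * (g x - g t)) - integral {t..x} ?h) {t..x}"
        by (intro has_integral_diff integrable_integral hi tI tx)
      moreover have "((f x - f t) * g x + f t * (g x - g t)) - integral {t..x} ?h = \<phi> x - \<phi> t"
        unfolding \<phi>_def hd[symmetric] by (simp add: algebra_simps)
      ultimately have hp: "((\<lambda>u. (f' u * g x + f t * g' u) - ?h u) has_integral (\<phi> x - \<phi> t)) {t..x}"
        by simp
      have "norm (integral {t..x} (\<lambda>u. (f' u * g x + f t * g' u) - ?h u)) \<le> integral {t..x} (\<lambda>u. r * k u)"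
      proof (rule integral_norm_bound_integral)
        show "(\<lambda>u. r * k u) integrable_on {t..x}" 
          using integrable_on_cmult_left[OF kint[OF tI tx(2)]] by simp
        fix u assume u: "u \<in> {t..x}"
        have "(f' u * g x + f t * g' u) - ?h u = f' u * (g x - g u) + (f t - f u) * g' u"
          by (simp add: algebra_simps)
        also have "norm \<dots> \<le> norm (f' u) * r + r * norm (g' u)"
        proof (rule norm_triangle_le, rule add_mono)
          show "norm (f' u * (g x - g u)) \<le> norm (f' u) * r"
            using d2(2)[of x u] u tx unfolding norm_mult by (intro mult_left_mono) auto
          show "norm ((f t - f u) * g' u) \<le> r * norm (g' u)"
            using d1(2)[of t u] u tx unfolding norm_mult by (intro mult_right_mono) auto
        qed
        finally show "norm ((f' u * g x + f t * g' u) - ?h u) \<le> r * k u"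
          by (simp add: k_def algebra_simps)
      qed (use hp in blast)
      then show ?thesis
        using hp by (simp add: integral_unique Kd)
    qed
    then show "\<exists>d>0. \<forall>t x. s \<le> t \<and> t \<le> x \<and> x \<le> e \<and> x - t < d \<longrightarrow> norm (\<phi> x - \<phi> t) \<le> r * (K x - K t)"
      using d1(1) d2(1) by (intro exI[of _ "min d1 d2"]) auto
  qed
  then have "integral {s..e} ?h = f e * g e - f s * g s"
    by (simp add: \<phi>_def algebra_simps)
  then show "(?h has_integral (f e * g e - f s * g s)) {s..e}"
    using integrable_integral[OF hi[of s e]] se by auto
qed

lemma primitive_on_add:
  assumes "primitive_on I f f'" "primitive_on I g g'"
  shows "primitive_on I (\<lambda>x. f x + g x) (\<lambda>x. f' x + g' x)"
  unfolding primitive_on_def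
proof (intro ballI impI)
  fix s e assume se: "s \<in> I" "e \<in> I" "s \<le> e"
  note F = primitive_onD[OF assms(1) se] and G = primitive_onD[OF assms(2) se]
  show "(\<lambda>x. f' x + g' x) absolutely_integrable_on {s..e} \<and>
    ((\<lambda>x. f' x + g' x) has_integral (f e + g e - (f s + g s))) {s..e}"
    using set_integral_add(1)[OF F(1) G(1)] has_integral_add[OF F(2) G(2)]
    by (simp add: algebra_simps)
qed

lemma primitive_on_cmult:
  assumes "primitive_on I f f'"
  shows "primitive_on I (\<lambda>x. c * f x) (\<lambda>x. c * f' x)"
  unfolding primitive_on_def
proof (intro ballI impI)
  fix s e assume se: "s \<in> I" "e \<in> I" "s \<le> e"
  note F = primitive_onD[OF assms(1) se]
  show "(\<lambda>x. c * f' x) absolutely_integrable_on {s..e} \<and>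
    ((\<lambda>x. c * f' x) has_integral (c * f e - c * f s)) {s..e}"
    using continuous_mult_absolutely_integrable[OF continuous_on_const F(1)]
      has_integral_mult_right[OF F(2), of c] by (simp add: algebra_simps)
qed

lemma primitive_on_diff:
  assumes "primitive_on I f f'" "primitive_on I g g'"
  shows "primitive_on I (\<lambda>x. f x - g x) (\<lambda>x. f' x - g' x)"
  using primitive_on_add[OF assms(1) primitive_on_cmult[OF assms(2), of "-1"]] by simp

lemma primitive_on_cnj:
  assumes "primitive_on I f f'"
  shows "primitive_on I (\<lambda>x. cnj (f x)) (\<lambda>x. cnj (f' x))"
  unfolding primitive_on_def
proof (intro ballI impI)
  fix s e assume se: "s \<in> I" "e \<in> I" "s \<le> e"
  note F = primitive_onD[OF assms(1) se]
  show "(\<lambda>x. cnj (f' x)) absolutely_integrable_on {s..e} \<and>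
    ((\<lambda>x. cnj (f' x)) has_integral (cnj (f e) - cnj (f s))) {s..e}"
    using absolutely_integrable_linear[OF F(1) bounded_linear_cnj]
      has_integral_linear[OF F(2) bounded_linear_cnj] by (simp add: o_def)
qed

lemma primitive_on_shift:
  assumes "primitive_on I f f'"
  shows "primitive_on {x. x + c \<in> I} (\<lambda>x. f (x + c)) (\<lambda>x. f' (x + c))"
  unfolding primitive_on_def
proof (intro ballI impI)
  fix s e assume se: "s \<in> {x. x + c \<in> I}" "e \<in> {x. x + c \<in> I}" "s \<le> e"
  then have se': "s + c \<in> I" "e + c \<in> I" "s + c \<le> e + c" by auto
  note F = primitive_onD[OF assms(1) se']
  have *: "((\<lambda>x. g (x + c)) has_integral y) {s..e} \<longleftrightarrow> (g has_integral y) {s + c..e + c}"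
    for g :: "real \<Rightarrow> 'a::euclidean_space" and y
    using has_integral_shift_Icc_real[of g c y s e] by (simp add: o_def add.commute)
  have "(\<lambda>x. norm (f' x)) integrable_on {s + c..e + c}"
    using F(1) unfolding absolutely_integrable_on_def by auto
  then have "(\<lambda>x. norm (f' (x + c))) integrable_on {s..e}"
    unfolding integrable_on_def using *[of "\<lambda>x. norm (f' x)"] by blast
  then show "(\<lambda>x. f' (x + c)) absolutely_integrable_on {s..e} \<and>
    ((\<lambda>x. f' (x + c)) has_integral (f (e + c) - f (s + c))) {s..e}"
    using F(2) *[of f'] unfolding absolutely_integrable_on_def by auto
qed

text \<open>The exceptional set \<open>S\<close> accommodates piecewise continuously differentiable coefficients.\<close>

lemma primitive_on_classical:
  assumes S: "\<And>a b. finite (S \<inter> {a..b})"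
    and d: "\<And>x. x \<in> I \<Longrightarrow> x \<notin> S \<Longrightarrow> (f has_vector_derivative g x) (at x within I)"
    and c: "continuous_on I f" and I: "is_interval I"
    and g: "\<And>s x. s \<in> I \<Longrightarrow> x \<in> I \<Longrightarrow> s \<le> x \<Longrightarrow> g absolutely_integrable_on {s..x}"
  shows "primitive_on I f g"
  unfolding primitive_on_def
proof (intro ballI impI conjI g)
  fix s x assume sx: "s \<in> I" "x \<in> I" "s \<le> x"
  have sub: "{s..x} \<subseteq> I"
    by (rule is_interval_Icc_subset[OF I sx(1,2)])
  show "(g has_integral (f x - f s)) {s..x}"
  proof (rule fundamental_theorem_of_calculus_interior_strong[OF S[of s x] sx(3)])
    fix t assume t: "t \<in> {s<..<x} - S \<inter> {s..x}"
    moreover have "t \<in> I" using t sub by auto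
    ultimately have "(f has_vector_derivative g t) (at t within {s<..<x})"
      using d[of t] sub
      by (intro has_vector_derivative_within_subset[of f "g t" t I "{s<..<x}"]) auto
    then show "(f has_vector_derivative g t) (at t)"
      using t by (subst (asm) at_within_open) auto
  qed (use c sub in \<open>auto intro: continuous_on_subset\<close>)
qed

lemma primitive_on_has_vector_derivative:
  assumes "primitive_on I f g" "is_interval I" "open I" "x \<in> I" "isCont g x"
  shows "(f has_vector_derivative g x) (at x)"
proof -
  obtain d where d: "d > 0" "cball x d \<subseteq> I"
    using assms(3,4) open_contains_cball by blast
  define s e where "s = x - d" and "e = x + d"
  have se: "{s..e} \<subseteq> I" "x \<in> {s<..<e}" using d by (auto simp: s_def e_def cball_eq_atLeastAtMost)
  have sI: "s \<in> I" "e \<in> I" using se d(1) by (auto simp: s_def e_def)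
  note P = primitive_onD[OF assms(1) sI(1)]
  have "((\<lambda>u. integral {s..u} g) has_vector_derivative g x) (at x within ({s..e} - {}))"
    by (rule integral_has_vector_derivative_continuous_at)
       (use P(2)[OF sI(2)] se assms(5) in \<open>auto intro: continuous_at_imp_continuous_within\<close>)
  then have "((\<lambda>u. f s + integral {s..u} g) has_vector_derivative g x) (at x within {s<..<e})"
    by (auto intro!: derivative_eq_intros intro: has_vector_derivative_within_subset)
  then have "(f has_vector_derivative g x) (at x within {s<..<e})"
    by (rule has_vector_derivative_transform[rotated 2]) (use se P(3) in \<open>auto simp: subset_eq\<close>)
  then show ?thesis using se by (subst (asm) at_within_open) auto
qed

text \<open>Compact intervals generate the Borel sets and are closed under intersection. So the integral vanishes
  over every Borel set, hence over every Lebesgue measurable one.\<close>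

lemma zero_on_intervals_imp_zero_AE:
  fixes g :: "real \<Rightarrow> complex"
  assumes "g absolutely_integrable_on {a..b}"
    and 0: "\<And>s x. a \<le> s \<Longrightarrow> s \<le> x \<Longrightarrow> x \<le> b \<Longrightarrow> (g has_integral 0) {s..x}"
  shows "AE x in lebesgue. x \<in> {a..b} \<longrightarrow> g x = 0"
proof -
  define h where "h x = indicat_real {a..b} x *\<^sub>R g x" for x
  have h: "integrable lebesgue h"
    using assms(1) by (simp add: set_integrable_def h_def[abs_def])
  have hA: "set_integrable lebesgue A h" if "A \<in> sets lebesgue" for A
    unfolding set_integrable_def using h that by (rule integrable_mult_indicator[rotated])
  have hIcc: "set_lebesgue_integral lebesgue {s..x} h = 0" for s x
  proof -
    have hi: "(h has_integral set_lebesgue_integral lebesgue {s..x} h) {s..x}"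
      using set_lebesgue_integral_eq_integral[OF hA[of "{s..x}"]] by (simp add: has_integral_iff)
    have "(g has_integral 0) {max a s..min b x}"
      using 0[of "max a s" "min b x"] by (cases "max a s \<le> min b x") auto
    then have "((\<lambda>t. if t \<in> {max a s..min b x} then g t else 0) has_integral 0) {s..x}"
      by (subst has_integral_restrict) auto
    then have "(h has_integral 0) {s..x}"
      by (rule has_integral_eq[rotated]) (auto simp: h_def indicator_def)
    with hi show ?thesis by (rule has_integral_unique)
  qed
  have borel: "set_lebesgue_integral lebesgue A h = 0" if "A \<in> sets borel" for A
  proof -
    have int_stable: "Int_stable (range (\<lambda>(s, x). {s..x::real}))"
      by (auto simp: Int_stable_def)
    have gen: "sets borel = sigma_sets UNIV (range (\<lambda>(s, x). {s..x::real}))"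
      using borel_eq_atLeastAtMost[where 'a = real] by (metis sets_measure_of_conv subset_UNIV Pow_UNIV)
    have UN: "set_lebesgue_integral lebesgue (\<Union>i. B i) h = (\<Sum>i. set_lebesgue_integral lebesgue (B i) h)"
      if "disjoint_family B" "\<And>i. B i \<in> sets borel" for B :: "nat \<Rightarrow> real set"
      by (rule lebesgue_integral_countable_add)
         (use that in \<open>auto intro!: hA sets.countable_UN' simp: disjoint_family_on_def\<close>)
    have top: "set_lebesgue_integral lebesgue UNIV h = 0"
    proof -
      have "set_lebesgue_integral lebesgue UNIV h = set_lebesgue_integral lebesgue {a..b} h"
        unfolding set_lebesgue_integral_def
        by (rule Bochner_Integration.integral_cong) (auto simp: h_def indicator_def)
      then show ?thesis using hIcc by simp
    qed
    show ?thesis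
    proof (rule sigma_sets_induct_disjoint[OF int_stable _ that[unfolded gen]], goal_cases)
      case 1 then show ?case by simp
    next
      case (2 A) then show ?case using hIcc by auto
    next
      case 3 then show ?case by (simp add: set_lebesgue_integral_def)
    next
      case (4 A)
      then have A: "A \<in> sets borel" by (simp add: gen)
      have "set_lebesgue_integral lebesgue (A \<union> (UNIV - A)) h =
          set_lebesgue_integral lebesgue A h + set_lebesgue_integral lebesgue (UNIV - A) h"
        by (rule set_integral_Un) (use A in \<open>auto intro!: hA\<close>)
      moreover have "A \<union> (UNIV - A) = UNIV" by auto
      ultimately show ?case using 4 top by simp
    next
      case (5 B)
      have "B i \<in> sets borel" for i using 5(2) gen by auto
      with 5 UN[of B] show ?case by simp
    qed
  qed
  have "AE x in lebesgue. h x = 0"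
  proof (rule sigma_finite_measure.density_zero[OF _ h])
    show "sigma_finite_measure (lebesgue :: real measure)"
    proof
      obtain F :: "real set set" where F: "countable F" "F \<subseteq> sets lborel" "\<Union>F = space lborel"
          "\<forall>a\<in>F. emeasure lborel a \<noteq> \<infinity>"
        using sigma_finite_measure.sigma_finite_countable[OF sigma_finite_lborel] by blast
      then show "\<exists>F. countable F \<and> F \<subseteq> sets lebesgue \<and> \<Union>F = space (lebesgue :: real measure) \<and>
          (\<forall>a\<in>F. emeasure lebesgue a \<noteq> \<infinity>)"
        by (intro exI[of _ F]) (auto simp: subset_eq)
    qed
  next
    fix A :: "real set" assume "A \<in> sets lebesgue"
    then obtain S N N' where A: "A = S \<union> N" "N \<subseteq> N'" "N' \<in> null_sets lborel" "S \<in> sets borel"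
      by (auto elim: sets_completionE)
    have "AE x in lebesgue. x \<notin> N'"
      using A(3) by (intro AE_not_in) (simp add: null_sets_completionI)
    then have "AE x in lebesgue. x \<in> A \<longleftrightarrow> x \<in> S"
      by eventually_elim (use A in auto)
    then have "set_lebesgue_integral lebesgue A h = set_lebesgue_integral lebesgue S h"
      using hA[of A] hA[of S] A(4) \<open>A \<in> sets lebesgue\<close>
      by (intro set_integral_cong_set) (auto simp: set_integrable_def set_borel_measurable_def)
    then show "set_lebesgue_integral lebesgue A h = 0" using borel[OF A(4)] by simp
  qed
  then show ?thesis by eventually_elim (auto simp: h_def)
qed

text \<open>Countably many compact intervals, those with rational end points, exhaust an open interval.\<close>

lemma AE_on_open_interval:
  fixes I :: "real set"
  assumes I: "open I" "is_interval I"
    and sub: "\<And>s x. s \<in> I \<Longrightarrow> x \<in> I \<Longrightarrow> s \<le> x \<Longrightarrow> AE t in lebesgue. t \<in> {s..x} \<longrightarrow> P t"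
  shows "AE t in lebesgue. t \<in> I \<longrightarrow> P t"
proof -
  define N where "N = {t \<in> I. \<not> P t}"
  have neg: "negligible (N \<inter> {s..x})" if "s \<in> I" "x \<in> I" for s x
  proof (cases "s \<le> x")
    case True
    have "N \<inter> {s..x} \<subseteq> {t. \<not> (t \<in> {s..x} \<longrightarrow> P t)}" by (auto simp: N_def)
    with sub[OF that True] show ?thesis
      unfolding AE_iff_negligible by (rule negligible_subset)
  qed auto
  define D where "D = I \<inter> \<rat>"
  have "N \<subseteq> (\<Union>(s, e)\<in>D \<times> D. N \<inter> {s..e})"
  proof
    fix t assume t: "t \<in> N"
    then obtain d where d: "d > 0" "cball t d \<subseteq> I"
      using I(1) open_contains_cball unfolding N_def by blast
    obtain s e where "t - d < s" "s < t" "s \<in> \<rat>" "t < e" "e < t + d" "e \<in> \<rat>"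
      using Rats_dense_in_real[of "t - d" t] Rats_dense_in_real[of t "t + d"] d(1) by auto
    then have "s \<in> D" "e \<in> D" "t \<in> N \<inter> {s..e}"
      using d t by (auto simp: D_def subset_eq dist_real_def)
    then show "t \<in> (\<Union>(s, e)\<in>D \<times> D. N \<inter> {s..e})" by blast
  qed
  moreover have "negligible (\<Union>(s, e)\<in>D \<times> D. N \<inter> {s..e})"
    by (intro negligible_countable_Union countable_image countable_SIGMA)
       (auto simp: D_def countable_rat intro!: neg)
  ultimately have "negligible N" by (rule negligible_subset[rotated])
  then show ?thesis by (simp add: AE_iff_negligible N_def)
qed

lemma primitive_on_unique_AE:
  assumes "primitive_on I f g" "primitive_on I f' g'" "open I" "is_interval I"
    and "\<And>x. x \<in> I \<Longrightarrow> f x = f' x"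
  shows "AE x in lebesgue. x \<in> I \<longrightarrow> g x = g' x"
proof -
  note P = primitive_on_diff[OF assms(1,2)]
  have "AE t in lebesgue. t \<in> I \<longrightarrow> g t - g' t = 0"
  proof (rule AE_on_open_interval[OF assms(3,4)])
    fix s x assume sx: "s \<in> I" "x \<in> I" "s \<le> x"
    have sub: "{s..x} \<subseteq> I" by (rule is_interval_Icc_subset[OF assms(4) sx(1,2)])
    show "AE t in lebesgue. t \<in> {s..x} \<longrightarrow> g t - g' t = 0"
    proof (rule zero_on_intervals_imp_zero_AE[OF primitive_onD(1)[OF P sx]])
      fix s' x' assume "s \<le> s'" "s' \<le> x'" "x' \<le> x"
      then have "s' \<in> I" "x' \<in> I" using sub by auto
      from primitive_onD(2)[OF P this \<open>s' \<le> x'\<close>] show "((\<lambda>t. g t - g' t) has_integral 0) {s'..x'}"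
        using assms(5) \<open>s' \<in> I\<close> \<open>x' \<in> I\<close> by simp
    qed
  qed
  then show ?thesis by simp
qed

lemma primitive_on_cong:
  assumes "primitive_on I f g" "\<And>x. x \<in> I \<Longrightarrow> f' x = f x"
  shows "primitive_on I f' g"
  using assms unfolding primitive_on_def by simp

text \<open>The difference of \<open>f\<close> and the indefinite integral of \<open>g\<close> is constant inside and continuous up to the
  end points.\<close>

lemma primitive_on_closed_interval:
  assumes P: "primitive_on {a<..<b} f g" and c: "continuous_on {a..b} f"
    and g: "g absolutely_integrable_on {a..b}" and ab: "a < b"
  shows "primitive_on {a..b} f g"
proof -
  have gi: "g integrable_on {s..x}" if "a \<le> s" "x \<le> b" for s x
    using g integrable_on_subinterval[of g "{a..b}" s x] that unfolding absolutely_integrable_on_def by auto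
  have comb: "integral {a..s} g + integral {s..x} g = integral {a..x} g" if "a \<le> s" "s \<le> x" "x \<le> b" for s x
    using that by (intro Henstock_Kurzweil_Integration.integral_combine gi) auto
  define F where "F x = f x - integral {a..x} g" for x
  have Fc: "continuous_on (closure {a<..<b}) F"
    unfolding F_def using ab gi[of a b] by (auto intro!: continuous_intros c indefinite_integral_continuous_1)
  define m where "m = (a + b) / 2"
  have m: "m \<in> {a<..<b}" using ab by (auto simp: m_def)
  have Fd: "F x = F s" if "s \<in> {a<..<b}" "x \<in> {a<..<b}" "s \<le> x" for s x
  proof -
    have "f x = f s + integral {s..x} g" "integral {a..x} g = integral {a..s} g + integral {s..x} g"
      using primitive_onD(3)[OF P that] comb[of s x] that by simp_all
    then show ?thesis by (simp add: F_def)
  qed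
  have "F x = F m" if "x \<in> {a<..<b}" for x
    using Fd[OF that m] Fd[OF m that] by (cases "x \<le> m") auto
  then have F: "F x = F m" if "x \<in> {a..b}" for x
    using continuous_constant_on_closure[OF Fc, of "F m" x] that ab by auto
  show ?thesis
    unfolding primitive_on_def
  proof (intro ballI impI conjI)
    fix s x assume sx: "s \<in> {a..b}" "x \<in> {a..b}" "s \<le> x"
    show "g absolutely_integrable_on {s..x}"
      by (rule absolutely_integrable_on_subinterval[OF g]) (use sx in auto)
    have "f x - (integral {a..s} g + integral {s..x} g) = f s - integral {a..s} g"
      using F[OF sx(1)] F[OF sx(2)] comb[of s x] sx by (simp add: F_def)
    then have "f x - f s = integral {s..x} g" by (simp add: algebra_simps)
    then show "(g has_integral f x - f s) {s..x}"
      using integrable_integral[OF gi[of s x]] sx by simp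
  qed
qed

section \<open>Weak derivatives on open intervals\<close>

lemma compact_in_open_interval:
  fixes S :: "real set"
  assumes S: "open S" "is_interval S" "S \<noteq> {}" and C: "compact C" "C \<subseteq> S"
  obtains s e where "s \<in> S" "e \<in> S" "s < e" "C \<subseteq> {s<..<e}"
proof -
  obtain c where "c \<in> S" using S by auto
  define K where "K = insert c C"
  have K: "compact K" "K \<noteq> {}" "K \<subseteq> S" using C \<open>c \<in> S\<close> by (auto simp: K_def)
  obtain m where m: "m \<in> K" "\<forall>x\<in>K. m \<le> x" using compact_attains_inf K by metis
  obtain M where M: "M \<in> K" "\<forall>x\<in>K. x \<le> M" using compact_attains_sup K by metis
  obtain d where d: "d > 0" "cball m d \<subseteq> S" using S(1) m K open_contains_cball by blast
  obtain d' where d': "d' > 0" "cball M d' \<subseteq> S" using S(1) M K open_contains_cball by blast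
  show ?thesis
  proof (rule that[of "m - d" "M + d'"])
    show "m - d \<in> S" "M + d' \<in> S"
      using d d' by (auto simp: subset_eq dist_real_def)
    show "m - d < M + d'" using m M d d' by (smt (verit) bspec)
    show "C \<subseteq> {m - d<..<M + d'}"
      using m M d d' unfolding K_def by (smt (verit) greaterThanLessThan_iff insertI2 subsetI)
  qed
qed

lemma absolutely_integrable_on_compact_subset:
  fixes g :: "real \<Rightarrow> complex"
  assumes "g absolutely_integrable_on {s..e}" "compact C" "C \<subseteq> {s..e}"
  shows "g absolutely_integrable_on C"
  by (rule set_integrable_subset[OF assms(1)]) (use assms in \<open>auto dest: compact_imp_closed\<close>)

lemma integral_lebesgue_on_Icc:
  fixes h :: "real \<Rightarrow> complex"
  assumes "S \<in> sets lebesgue" "{s..e} \<subseteq> S" "h absolutely_integrable_on {s..e}"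
    and "\<And>x. x \<in> S \<Longrightarrow> x \<notin> {s..e} \<Longrightarrow> h x = 0"
  shows "integral\<^sup>L (lebesgue_on S) h = integral {s..e} h"
proof -
  have "integral\<^sup>L (lebesgue_on S) h = integral\<^sup>L lebesgue (\<lambda>x. indicat_real S x *\<^sub>R h x)"
    using assms(1) by (intro integral_restrict_space) auto
  also have "\<dots> = set_lebesgue_integral lebesgue {s..e} h"
    unfolding set_lebesgue_integral_def
    by (rule Bochner_Integration.integral_cong) (use assms in \<open>auto simp: indicator_def\<close>)
  also have "\<dots> = integral {s..e} h"
    by (rule set_lebesgue_integral_eq_integral[OF assms(3)])
  finally show ?thesis .
qed

lemma AE_lebesgue_on_iff:
  assumes "S \<in> sets lebesgue"
  shows "(AE x in lebesgue_on S. P x) \<longleftrightarrow> (AE x in lebesgue. x \<in> S \<longrightarrow> P x)"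
  using assms by (intro AE_restrict_space_iff) auto

lemma absolutely_integrable_AE_cong:
  fixes f g :: "real \<Rightarrow> complex"
  assumes "f absolutely_integrable_on C" "AE x in lebesgue. x \<in> C \<longrightarrow> g x = f x"
  shows "g absolutely_integrable_on C"
  by (rule absolutely_integrable_spike[OF assms(1), of "{x. \<not> (x \<in> C \<longrightarrow> g x = f x)}"])
     (use assms(2) in \<open>auto simp: AE_iff_negligible\<close>)

lemma primitive_on_real_C1:
  assumes "\<And>x. (\<phi> has_real_derivative \<phi>' x) (at x)" "continuous_on UNIV \<phi>'"
  shows "primitive_on UNIV (\<lambda>x. of_real (\<phi> x)) (\<lambda>x. of_real (\<phi>' x))"
proof (rule primitive_on_classical[where S = "{}"])
  have "((\<lambda>x. complex_of_real (\<phi> x)) has_vector_derivative complex_of_real (\<phi>' x)) (at x)" for x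
    using has_vector_derivative_of_real[OF assms(1)[of x]]
    by simp
  then show "((\<lambda>x. complex_of_real (\<phi> x)) has_vector_derivative complex_of_real (\<phi>' x)) (at x within UNIV)" for x
    by simp
  then show "continuous_on UNIV (\<lambda>x. complex_of_real (\<phi> x))"
    by (intro continuous_on_vector_derivative) auto
  fix s x
  have "continuous_on {s..x} \<phi>'" using assms(2) continuous_on_subset by blast
  then show "(\<lambda>x. complex_of_real (\<phi>' x)) absolutely_integrable_on {s..x}"
    by (intro absolutely_integrable_continuous_real continuous_intros)
qed auto

lemma derivative_zero_outside_support:
  fixes \<phi> :: "real \<Rightarrow> real"
  assumes "\<And>x. (\<phi> has_real_derivative \<phi>' x) (at x)" "closed C" "\<And>x. x \<notin> C \<Longrightarrow> \<phi> x = 0" "x \<notin> C"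
  shows "\<phi>' x = 0"
proof -
  have "\<forall>\<^sub>F y in nhds x. y \<in> - C"
    using assms(2,4) by (intro eventually_nhds_in_open) auto
  then have "\<forall>\<^sub>F y in nhds x. \<phi> y = 0" by eventually_elim (use assms(3) in auto)
  then have "(\<phi> has_real_derivative 0) (at x)"
    using DERIV_cong_ev[of x x \<phi> "\<lambda>_. 0" 0 0] by auto
  with assms(1) show ?thesis using DERIV_unique by blast
qed

text \<open>Integration by parts against a test function, which vanishes at the ends of a slightly larger interval.\<close>

lemma has_weak_deriv_primitive_on:
  assumes S: "open S" "is_interval S" and P: "primitive_on S f g"
    and u: "AE x in lebesgue. x \<in> S \<longrightarrow> u x = f x" and v: "AE x in lebesgue. x \<in> S \<longrightarrow> v x = g x"
  shows "has_weak_deriv S u v"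
proof (cases "S = {}")
  case True
  have "integral\<^sup>L (lebesgue_on {}) h = 0" for h :: "real \<Rightarrow> complex"
    by (subst integral_restrict_space) auto
  then show ?thesis using True unfolding has_weak_deriv_def locally_integrable_def
    by (auto simp: set_integrable_def)
next
  case False
  have Sl: "S \<in> sets lebesgue" using S(1) by auto
  have v': "primitive_on S f v" by (rule primitive_on_AE_cong[OF P S(2) v])
  have cf: "continuous_on S f" by (rule primitive_on_continuous[OF P S(2)])
  have loc: "f absolutely_integrable_on {s..e}" "v absolutely_integrable_on {s..e}"
      "u absolutely_integrable_on {s..e}"
    if "s \<in> S" "e \<in> S" "s \<le> e" for s e
  proof -
    have sub: "{s..e} \<subseteq> S" by (rule is_interval_Icc_subset[OF S(2) that(1,2)])
    show f: "f absolutely_integrable_on {s..e}"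
      by (intro absolutely_integrable_continuous_real continuous_on_subset[OF cf sub])
    show "v absolutely_integrable_on {s..e}"
      by (rule primitive_onD(1)[OF v' that])
    show "u absolutely_integrable_on {s..e}"
      by (rule absolutely_integrable_AE_cong[OF f]) (use u in eventually_elim, use sub in auto)
  qed
  show ?thesis
    unfolding has_weak_deriv_def locally_integrable_def
  proof (intro conjI allI impI)
    fix C :: "real set" assume C: "compact C \<and> C \<subseteq> S"
    then obtain s e where se: "s \<in> S" "e \<in> S" "s < e" "C \<subseteq> {s<..<e}"
      using compact_in_open_interval[OF S False] by metis
    then have "C \<subseteq> {s..e}" by auto
    then show "u absolutely_integrable_on C" "v absolutely_integrable_on C"
      using loc[of s e] se C by (auto intro: absolutely_integrable_on_compact_subset)
  next
    fix \<phi> \<phi>' :: "real \<Rightarrow> real"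
    assume test: "(\<forall>x. (\<phi> has_real_derivative \<phi>' x) (at x)) \<and> continuous_on UNIV \<phi>' \<and>
       (\<exists>C. compact C \<and> C \<subseteq> S \<and> (\<forall>x. x \<notin> C \<longrightarrow> \<phi> x = 0))"
    then obtain C where C: "compact C" "C \<subseteq> S" "\<And>x. x \<notin> C \<Longrightarrow> \<phi> x = 0" by blast
    then obtain s e where se: "s \<in> S" "e \<in> S" "s < e" "C \<subseteq> {s<..<e}"
      using compact_in_open_interval[OF S False] by metis
    have sub: "{s..e} \<subseteq> S" by (rule is_interval_Icc_subset[OF S(2) se(1,2)])
    have \<phi>0: "\<phi> x = 0" if "x \<notin> {s<..<e}" for x using C(3) se(4) that by blast
    have \<phi>'0: "\<phi>' x = 0" if "x \<notin> {s..e}" for x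
      by (rule derivative_zero_outside_support[of \<phi> \<phi>' "{s..e}"]) (use test \<phi>0 that in auto)
    have P\<phi>: "primitive_on S (\<lambda>x. of_real (\<phi> x)) (\<lambda>x. of_real (\<phi>' x))"
      using primitive_on_subset[OF primitive_on_real_C1[of \<phi> \<phi>']] test by auto
    have "primitive_on S (\<lambda>x. of_real (\<phi> x) * f x) (\<lambda>x. of_real (\<phi>' x) * f x + of_real (\<phi> x) * v x)"
      by (rule primitive_on_mult[OF P\<phi> v' S(2)])
    from primitive_onD(2)[OF this se(1,2)] have
      sum0: "((\<lambda>x. of_real (\<phi>' x) * f x + of_real (\<phi> x) * v x) has_integral 0) {s..e}"
      using se(3) \<phi>0[of s] \<phi>0[of e] by simp
    have c: "continuous_on {s..e} (\<lambda>x. complex_of_real (\<phi> x))" "continuous_on {s..e} (\<lambda>x. complex_of_real (\<phi>' x))"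
      using primitive_on_continuous[OF P\<phi> S(2)] sub test
      by (auto intro!: continuous_intros intro: continuous_on_subset)
    have a: "(\<lambda>x. of_real (\<phi>' x) * u x) absolutely_integrable_on {s..e}"
      "(\<lambda>x. of_real (\<phi>' x) * f x) absolutely_integrable_on {s..e}"
      "(\<lambda>x. of_real (\<phi> x) * v x) absolutely_integrable_on {s..e}"
      using loc[OF se(1,2)] se(3) c by (auto intro: continuous_mult_absolutely_integrable)
    have "integral {s..e} (\<lambda>x. of_real (\<phi>' x) * f x) + integral {s..e} (\<lambda>x. of_real (\<phi> x) * v x) = 0"
      using Henstock_Kurzweil_Integration.integral_add[of "\<lambda>x. of_real (\<phi>' x) * f x" "{s..e}" "\<lambda>x. of_real (\<phi> x) * v x"] a sum0
      by (auto simp: absolutely_integrable_on_def integral_unique)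
    moreover have "integral {s..e} (\<lambda>x. of_real (\<phi>' x) * u x) = integral {s..e} (\<lambda>x. of_real (\<phi>' x) * f x)"
      by (rule integral_spike[of "{x. \<not> (x \<in> S \<longrightarrow> u x = f x)}"])
         (use u sub in \<open>auto simp: AE_iff_negligible\<close>)
    moreover have "(LINT x|lebesgue_on S. \<phi>' x *\<^sub>R u x) = integral {s..e} (\<lambda>x. of_real (\<phi>' x) * u x)"
      using integral_lebesgue_on_Icc[OF Sl sub a(1)] \<phi>'0 by (simp add: scaleR_conv_of_real)
    moreover have "(LINT x|lebesgue_on S. \<phi> x *\<^sub>R v x) = integral {s..e} (\<lambda>x. of_real (\<phi> x) * v x)"
      using integral_lebesgue_on_Icc[OF Sl sub a(3)] \<phi>0 by (force simp: scaleR_conv_of_real)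
    ultimately show "(LINT x|lebesgue_on S. \<phi>' x *\<^sub>R u x) = - (LINT x|lebesgue_on S. \<phi> x *\<^sub>R v x)"
      by (simp add: add_eq_0_iff2)
  qed
qed

lemma primitive_on_exists:
  assumes I: "is_interval I"
    and g: "\<And>s x. s \<in> I \<Longrightarrow> x \<in> I \<Longrightarrow> s \<le> x \<Longrightarrow> g absolutely_integrable_on {s..x}"
  obtains f where "primitive_on I f g"
proof (cases "I = {}")
  case True then show ?thesis using that by (auto simp: primitive_on_def)
next
  case False
  then obtain c where c: "c \<in> I" by auto
  define f where "f x = (if c \<le> x then integral {c..x} g else - integral {x..c} g)" for x
  have gi: "g integrable_on {s..x}" if "s \<in> I" "x \<in> I" for s x
    using g[OF that] by (cases "s \<le> x") (auto simp: absolutely_integrable_on_def)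
  have comb: "integral {r..s} g + integral {s..t} g = integral {r..t} g"
    if "r \<in> I" "t \<in> I" "r \<le> s" "s \<le> t" for r s t
    using Henstock_Kurzweil_Integration.integral_combine[OF that(3,4) gi[OF that(1,2)]] .
  have "primitive_on I f g"
    unfolding primitive_on_def
  proof (intro ballI impI conjI g)
    fix s x assume sx: "s \<in> I" "x \<in> I" "s \<le> x"
    have "f x - f s = integral {s..x} g"
    proof -
      consider "c \<le> s" | "s < c" "c \<le> x" | "x < c" by linarith
      then show ?thesis
      proof cases
        case 1 then show ?thesis using comb[of c x s] c sx by (simp add: f_def algebra_simps)
      next
        case 2 then show ?thesis using comb[of s x c] c sx by (simp add: f_def algebra_simps)
      next
        case 3 then show ?thesis using comb[of s c x] c sx by (simp add: f_def algebra_simps)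
      qed
    qed
    then show "(g has_integral (f x - f s)) {s..x}"
      using integrable_integral[OF gi[OF sx(1,2)]] by simp
  qed
  then show ?thesis by (rule that)
qed

lemma compactly_supported_antiderivative:
  fixes \<eta> :: "real \<Rightarrow> real"
  assumes c: "continuous_on UNIV \<eta>" and supp: "\<And>x. x \<notin> {s..e} \<Longrightarrow> \<eta> x = 0" and "s \<le> e"
    and 0: "integral {s..e} \<eta> = 0"
  obtains \<phi> where "\<And>x. (\<phi> has_real_derivative \<eta> x) (at x)" "\<And>x. x \<notin> {s..e} \<Longrightarrow> \<phi> x = 0"
proof -
  have "\<exists>F. \<forall>x::real. -\<infinity> < ereal x \<longrightarrow> ereal x < \<infinity> \<longrightarrow> (F has_vector_derivative \<eta> x) (at x)"
    by (rule einterval_antiderivative) (use c in \<open>auto simp: continuous_on_eq_continuous_at\<close>)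
  then obtain F where F: "\<And>x. (F has_vector_derivative \<eta> x) (at x)" by auto
  have FTC: "(\<eta> has_integral (F x - F r)) {r..x}" if "r \<le> x" for r x
    by (rule fundamental_theorem_of_calculus[OF that]) (use F has_vector_derivative_at_within in blast)
  have const: "F x = F r" if "r \<le> x" "\<And>t. t \<in> {r<..<x} \<Longrightarrow> \<eta> t = 0" for r x
  proof -
    have "(\<eta> has_integral 0) {r..x}"
      by (rule has_integral_spike_finite[of "{r, x}" _ _ "\<lambda>_. 0"]) (use that in auto)
    from has_integral_unique[OF this FTC[OF that(1)]] show ?thesis by simp
  qed
  have "F e = F s" using FTC[OF \<open>s \<le> e\<close>] 0 by (simp add: has_integral_iff)
  then have "F x - F s = 0" if "x \<notin> {s..e}" for x
    using that const[of x s] const[of e x] supp by (cases "x < s") auto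
  moreover have "((\<lambda>x. F x - F s) has_real_derivative \<eta> x) (at x)" for x
    using F[of x] by (auto simp: has_real_derivative_iff_has_vector_derivative intro!: derivative_eq_intros)
  ultimately show ?thesis using that[of "\<lambda>x. F x - F s"] by blast
qed

text \<open>A continuous function positive exactly on the open interval between \<open>r\<close> and \<open>x\<close>. It serves as a
  reference function of nonzero mean and, scaled and truncated at \<open>1\<close>, as an approximation of the
  indicator function of the interval.\<close>

definition tent :: "real \<Rightarrow> real \<Rightarrow> real \<Rightarrow> real" where
  "tent r x t = max 0 (min (t - r) (x - t))"

lemma tent_props:
  shows "continuous_on A (tent r x)" "t \<notin> {r<..<x} \<Longrightarrow> tent r x t = 0" "tent r x t \<ge> 0"
    "t \<in> {r<..<x} \<Longrightarrow> tent r x t > 0"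
  by (auto simp: tent_def[abs_def] intro!: continuous_intros)

lemma zero_against_cutoffs_imp_zero_integral:
  fixes h :: "real \<Rightarrow> complex"
  assumes h: "h absolutely_integrable_on {r..x}"
    and 0: "\<And>n::nat. integral {r..x} (\<lambda>t. of_real (min 1 (real n * tent r x t)) * h t) = 0"
  shows "(h has_integral 0) {r..x}"
proof -
  have int: "(\<lambda>t. of_real (min 1 (real n * tent r x t)) * h t) integrable_on {r..x}" for n
  proof -
    have "(\<lambda>t. of_real (min 1 (real n * tent r x t)) * h t) absolutely_integrable_on {r..x}"
      by (intro continuous_mult_absolutely_integrable h continuous_intros tent_props)
    then show ?thesis using absolutely_integrable_on_def by blast
  qed
  have bound: "norm (of_real (min 1 (real n * tent r x t)) * h t) \<le> norm (h t)" for n t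
  proof -
    have "\<bar>min 1 (real n * tent r x t)\<bar> \<le> 1"
      using tent_props(3)[of r x t] by (auto simp: min_def)
    then show ?thesis
      unfolding norm_mult norm_of_real by (rule mult_left_le_one_le[rotated 2]) auto
  qed
  have lim: "(\<lambda>n. of_real (min 1 (real n * tent r x t)) * h t) \<longlonglongrightarrow> (if t \<in> {r<..<x} then h t else 0)" for t
  proof (cases "t \<in> {r<..<x}")
    case True
    then have pos: "tent r x t > 0" by (rule tent_props)
    have "\<forall>\<^sub>F n in sequentially. real n \<ge> 1 / tent r x t"
      using filterlim_real_sequentially by (simp add: filterlim_at_top)
    then have "\<forall>\<^sub>F n in sequentially. of_real (min 1 (real n * tent r x t)) * h t = h t"
      by eventually_elim (use pos in \<open>simp add: field_simps min_def\<close>)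
    then have "(\<lambda>n. of_real (min 1 (real n * tent r x t)) * h t) \<longlonglongrightarrow> h t"
      by (rule tendsto_eventually)
    then show ?thesis using True by simp
  next
    case False
    then have "tent r x t = 0" by (rule tent_props(2))
    then show ?thesis using False by auto
  qed
  have hn: "(\<lambda>t. norm (h t)) integrable_on {r..x}"
    using h absolutely_integrable_on_def by blast
  note conv = dominated_convergence[of "\<lambda>n t. of_real (min 1 (real n * tent r x t)) * h t" "{r..x}"
      "\<lambda>t. norm (h t)" "\<lambda>t. if t \<in> {r<..<x} then h t else 0", OF int hn bound lim]
  have "integral {r..x} (\<lambda>t. if t \<in> {r<..<x} then h t else 0) = 0"
    using LIMSEQ_unique[OF conv(2)] 0 by simp
  with conv(1) have "((\<lambda>t. if t \<in> {r<..<x} then h t else 0) has_integral 0) {r..x}"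
    by (metis has_integral_iff)
  then show ?thesis
    by (rule has_integral_spike_finite[of "{r, x}", rotated 2]) auto
qed

lemma integral_zero_outside:
  fixes h :: "real \<Rightarrow> 'a::banach"
  assumes "A \<subseteq> T" "\<And>t. t \<in> T - A \<Longrightarrow> h t = 0"
  shows "integral T h = integral A h"
proof -
  have "integral T h = integral T (\<lambda>t. if t \<in> A then h t else 0)"
    by (rule integral_cong) (use assms(2) in auto)
  also have "\<dots> = integral A h"
    using assms(1) by (simp add: integral_restrict_Int Int_absorb2)
  finally show ?thesis .
qed

text \<open>Every continuous function with compact support and mean zero is the derivative of a test function. So
  \<open>\<integral> \<psi> g\<close> depends on the cutoff \<open>\<psi>\<close> only through its mean, the factor \<open>k\<close> being
  determined by one fixed tent function. Hence \<open>g - k\<close> is orthogonal to all cutoffs, which forces its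
  integrals over intervals to vanish.\<close>

lemma du_Bois_Reymond:
  fixes g :: "real \<Rightarrow> complex"
  assumes S: "open S" "is_interval S"
    and g: "\<And>s x. s \<in> S \<Longrightarrow> x \<in> S \<Longrightarrow> s \<le> x \<Longrightarrow> g absolutely_integrable_on {s..x}"
    and test: "\<And>\<phi> \<phi>'. (\<And>x. (\<phi> has_real_derivative \<phi>' x) (at x)) \<Longrightarrow> continuous_on UNIV \<phi>' \<Longrightarrow>
        (\<exists>C. compact C \<and> C \<subseteq> S \<and> (\<forall>x. x \<notin> C \<longrightarrow> \<phi> x = 0)) \<Longrightarrow>
        (LINT x|lebesgue_on S. \<phi>' x *\<^sub>R g x) = 0"
  obtains k where "AE x in lebesgue. x \<in> S \<longrightarrow> g x = k"
proof (cases "S = {}")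
  case True then show ?thesis using that by simp
next
  case False
  obtain c d where cd: "c \<in> S" "d \<in> S" "c < d"
    using compact_in_open_interval[OF S False compact_empty] by auto
  have Sl: "S \<in> sets lebesgue" using S(1) by auto
  define M where "M = integral {c..d} (tent c d)"
  have M: "M > 0"
  proof -
    have "M \<noteq> 0"
    proof
      assume "M = 0"
      then have "\<forall>x\<in>{c..d}. tent c d x = 0"
        unfolding M_def using integral_eq_0_iff[of c d "tent c d"] cd(3) tent_props by auto
      then have "tent c d ((c + d) / 2) = 0" using cd by auto
      then show False using tent_props(4)[of "(c + d) / 2" c d] cd by auto
    qed
    moreover have "M \<ge> 0" unfolding M_def by (rule integral_nonneg)
        (auto intro!: integrable_continuous_interval tent_props)
    ultimately show ?thesis by simp
  qed
  define k where "k = integral {c..d} (\<lambda>t. of_real (tent c d t) * g t) / of_real M"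
  have "AE t in lebesgue. t \<in> S \<longrightarrow> g t - k = 0"
  proof (rule AE_on_open_interval[OF S])
    fix s e assume se: "s \<in> S" "e \<in> S" "s \<le> e"
    have gk: "(\<lambda>t. g t - k) absolutely_integrable_on {s..e}" if "s \<in> S" "e \<in> S" "s \<le> e" for s e
      by (intro set_integral_diff g that absolutely_integrable_continuous_real continuous_intros)
    show "AE t in lebesgue. t \<in> {s..e} \<longrightarrow> g t - k = 0"
    proof (rule zero_on_intervals_imp_zero_AE[OF gk[OF se]])
      fix r x assume "s \<le> r" "r \<le> x" "x \<le> e"
      then have rx: "r \<in> S" "x \<in> S" "r \<le> x" using is_interval_Icc_subset[OF S(2) se(1,2)] by auto
      define m where "m = min c r"
      define M' where "M' = max d x"
      have mM: "m \<in> S" "M' \<in> S" "m \<le> M'" "{r..x} \<subseteq> {m..M'}" "{c..d} \<subseteq> {m..M'}"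
        using rx cd by (auto simp: m_def M'_def min_def max_def)
      have sub: "{m..M'} \<subseteq> S" by (rule is_interval_Icc_subset[OF S(2) mM(1,2)])
      show "((\<lambda>t. g t - k) has_integral 0) {r..x}"
      proof (rule zero_against_cutoffs_imp_zero_integral[OF gk[OF rx]])
        fix n
        define \<psi> where "\<psi> t = min 1 (real n * tent r x t)" for t
        have \<psi>: "continuous_on A \<psi>" for A
          unfolding \<psi>_def by (intro continuous_intros tent_props)
        have \<psi>0: "\<psi> t = 0" if "t \<notin> {r..x}" for t
          using that tent_props(2)[of t r x] by (auto simp: \<psi>_def)
        define J where "J = integral {r..x} \<psi>"
        have ext: "integral {m..M'} (\<lambda>t. of_real (w t) * y t) = integral A (\<lambda>t. of_real (w t) * y t)"
          if "A \<subseteq> {m..M'}" "\<And>t. t \<notin> A \<Longrightarrow> w t = 0" for w :: "real \<Rightarrow> real" and A and y :: "real \<Rightarrow> complex"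
          by (rule integral_zero_outside) (use that in auto)
        have ext1: "integral {m..M'} w = integral A w"
          if "A \<subseteq> {m..M'}" "\<And>t. t \<notin> A \<Longrightarrow> w t = 0" for w :: "real \<Rightarrow> real" and A
          by (rule integral_zero_outside) (use that in auto)
        define \<eta> where "\<eta> t = \<psi> t - J / M * tent c d t" for t
        have \<eta>: "continuous_on A \<eta>" for A
          unfolding \<eta>_def by (intro continuous_intros tent_props \<psi>)
        have t0: "tent c d t = 0" if "t \<notin> {c..d}" for t using tent_props(2)[of t c d] that by auto
        have "integral {m..M'} \<eta> = integral {m..M'} \<psi> - J / M * integral {m..M'} (tent c d)"
        proof -
          have "\<psi> integrable_on {m..M'}" "(\<lambda>t. J / M * tent c d t) integrable_on {m..M'}"
            by (intro integrable_continuous_interval continuous_intros \<psi> tent_props)+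
          then show ?thesis unfolding \<eta>_def by (simp add: Henstock_Kurzweil_Integration.integral_diff del: times_divide_eq_left)
        qed
        also have "\<dots> = 0"
          using M ext1[OF mM(4), of \<psi>] ext1[OF mM(5), of "tent c d"] \<psi>0 t0 by (simp add: J_def M_def)
        finally have "integral {m..M'} \<eta> = 0" .
        moreover have \<eta>0: "\<eta> t = 0" if "t \<notin> {m..M'}" for t
          using \<psi>0[of t] t0[of t] that mM(4,5) by (auto simp: \<eta>_def)
        ultimately obtain \<phi> where \<phi>: "\<And>x. (\<phi> has_real_derivative \<eta> x) (at x)" "\<And>x. x \<notin> {m..M'} \<Longrightarrow> \<phi> x = 0"
          using compactly_supported_antiderivative[OF \<eta> _ mM(3)] by metis
        have gm: "g absolutely_integrable_on {m..M'}" by (rule g[OF mM(1-3)])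
        have ai: "(\<lambda>t. of_real (w t) * g t) absolutely_integrable_on {m..M'}" if "continuous_on {m..M'} w"
          for w :: "real \<Rightarrow> real"
          by (intro continuous_mult_absolutely_integrable gm continuous_intros that)
        have hi: "(\<lambda>t. of_real (w t) * g t) integrable_on {m..M'}" if "continuous_on {m..M'} w"
          for w :: "real \<Rightarrow> real" using ai[OF that] absolutely_integrable_on_def by blast
        have "(LINT x|lebesgue_on S. \<eta> x *\<^sub>R g x) = 0"
          by (rule test[OF \<phi>(1) \<eta>]) (use \<phi>(2) sub in blast)
        also have "(LINT x|lebesgue_on S. \<eta> x *\<^sub>R g x) = integral {m..M'} (\<lambda>t. of_real (\<eta> t) * g t)"
          using integral_lebesgue_on_Icc[OF Sl sub ai[OF \<eta>]] \<eta>0 by (simp add: scaleR_conv_of_real)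
        also have "(\<lambda>t. of_real (\<eta> t) * g t) =
            (\<lambda>t. of_real (\<psi> t) * g t - of_real (J / M) * (of_real (tent c d t) * g t))"
          by (auto simp: \<eta>_def algebra_simps)
        also have "integral {m..M'} \<dots> = integral {m..M'} (\<lambda>t. of_real (\<psi> t) * g t)
            - of_real (J / M) * integral {m..M'} (\<lambda>t. of_real (tent c d t) * g t)"
          using Henstock_Kurzweil_Integration.integral_diff[OF hi[OF \<psi>] integrable_on_mult_right[OF hi[OF tent_props(1)], of "of_real (J / M)" c d]]
          by (simp only: integral_mult_right)
        also have "integral {m..M'} (\<lambda>t. of_real (\<psi> t) * g t) = integral {r..x} (\<lambda>t. of_real (\<psi> t) * g t)"
          by (rule ext[OF mM(4) \<psi>0])
        also have "integral {m..M'} (\<lambda>t. of_real (tent c d t) * g t) = integral {c..d} (\<lambda>t. of_real (tent c d t) * g t)"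
          by (rule ext[OF mM(5) t0])
        also have "of_real (J / M) * integral {c..d} (\<lambda>t. of_real (tent c d t) * g t) = of_real J * k"
          using M by (simp add: k_def)
        finally have 1: "integral {r..x} (\<lambda>t. of_real (\<psi> t) * g t) = of_real J * k" by simp
        have J: "integral {r..x} (\<lambda>t. of_real (\<psi> t) * k) = of_real J * k"
        proof -
          have "(\<psi> has_integral J) {r..x}"
            unfolding J_def by (intro integrable_integral integrable_continuous_interval \<psi>)
          from integral_unique[OF has_integral_mult_left[OF has_integral_of_real[OF this]]] show ?thesis .
        qed
        have "integral {r..x} (\<lambda>t. of_real (\<psi> t) * (g t - k)) =
            integral {r..x} (\<lambda>t. of_real (\<psi> t) * g t) - integral {r..x} (\<lambda>t. of_real (\<psi> t) * k)"
          unfolding right_diff_distrib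
        proof (rule Henstock_Kurzweil_Integration.integral_diff)
          show "(\<lambda>t. of_real (\<psi> t) * g t) integrable_on {r..x}"
            using continuous_mult_absolutely_integrable[OF _ g[OF rx], of "\<lambda>t. of_real (\<psi> t)"] \<psi>
            unfolding absolutely_integrable_on_def by (auto intro!: continuous_intros)
        qed (auto intro!: integrable_continuous_interval continuous_intros \<psi>)
        then have "integral {r..x} (\<lambda>t. of_real (\<psi> t) * (g t - k)) = 0"
          unfolding 1 J by simp
        then show "integral {r..x} (\<lambda>t. of_real (min 1 (real n * tent r x t)) * (g t - k)) = 0"
          unfolding \<psi>_def .
      qed
    qed
  qed
  then show ?thesis by (intro that[of k]) simp
qed

lemma has_weak_deriv_absolutely_integrable:
  assumes "has_weak_deriv S u v" "compact C" "C \<subseteq> S"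
  shows "u absolutely_integrable_on C" "v absolutely_integrable_on C"
  using assms unfolding has_weak_deriv_def locally_integrable_def by simp_all

text \<open>A primitive \<open>V\<close> of the weak derivative has the same weak derivative as \<open>u\<close>; so \<open>u - V\<close> is
  orthogonal to the derivatives of all test functions and is therefore constant.\<close>

lemma has_weak_deriv_imp_primitive_on:
  assumes S: "open S" "is_interval S" and u: "has_weak_deriv S u v"
  obtains f where "primitive_on S f v" "AE x in lebesgue. x \<in> S \<longrightarrow> u x = f x"
proof -
  have loc: "u absolutely_integrable_on {s..x}" "v absolutely_integrable_on {s..x}"
    if "s \<in> S" "x \<in> S" for s x
    using has_weak_deriv_absolutely_integrable[OF u compact_Icc is_interval_Icc_subset[OF S(2) that]]
    by simp_all
  obtain V where V: "primitive_on S V v"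
    using primitive_on_exists[OF S(2), of v] loc(2) by blast
  have cV: "continuous_on S V" by (rule primitive_on_continuous[OF V S(2)])
  have wV: "has_weak_deriv S V v" by (rule has_weak_deriv_primitive_on[OF S V]) auto
  obtain k where k: "AE x in lebesgue. x \<in> S \<longrightarrow> u x - V x = k"
  proof (rule du_Bois_Reymond[OF S, of "\<lambda>x. u x - V x"])
    fix s x assume sx: "s \<in> S" "x \<in> S" "s \<le> x"
    show "(\<lambda>x. u x - V x) absolutely_integrable_on {s..x}"
      by (intro set_integral_diff loc sx absolutely_integrable_continuous_real
          continuous_on_subset[OF cV is_interval_Icc_subset[OF S(2)]])
  next
    fix \<phi> \<phi>' :: "real \<Rightarrow> real"
    assume t: "\<And>x. (\<phi> has_real_derivative \<phi>' x) (at x)" "continuous_on UNIV \<phi>'"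
        "\<exists>C. compact C \<and> C \<subseteq> S \<and> (\<forall>x. x \<notin> C \<longrightarrow> \<phi> x = 0)"
    then obtain C where C: "compact C" "C \<subseteq> S" "\<And>x. x \<notin> C \<Longrightarrow> \<phi> x = 0" by blast
    have \<phi>': "\<phi>' x = 0" if "x \<notin> C" for x
      by (rule derivative_zero_outside_support[of \<phi> \<phi>' C, OF t(1) compact_imp_closed[OF C(1)] C(3) that])
    have int: "integrable (lebesgue_on S) (\<lambda>x. \<phi>' x *\<^sub>R y x)" if y: "y absolutely_integrable_on C" for y :: "real \<Rightarrow> complex"
    proof -
      have "(\<lambda>x. of_real (\<phi>' x) * y x) absolutely_integrable_on C"
      proof (rule absolutely_integrable_bounded_measurable_product[OF bilinear_times _ _ _ y])
        have c: "continuous_on C (\<lambda>x. complex_of_real (\<phi>' x))"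
          by (intro continuous_on_of_real continuous_on_subset[OF t(2)]) auto
        show "C \<in> sets lebesgue" using borel_compact[OF C(1)] by simp
        then show "(\<lambda>x. complex_of_real (\<phi>' x)) \<in> borel_measurable (lebesgue_on C)"
          using c by (intro continuous_imp_measurable_on_sets_lebesgue)
        show "bounded ((\<lambda>x. complex_of_real (\<phi>' x)) ` C)"
          using c C(1) by (intro compact_imp_bounded compact_continuous_image)
      qed
      moreover have "indicat_real S x *\<^sub>R (\<phi>' x *\<^sub>R y x) = indicat_real C x *\<^sub>R (of_real (\<phi>' x) * y x)" for x
        using \<phi>'[of x] C(2) by (auto simp: indicator_def scaleR_conv_of_real)
      ultimately show ?thesis
        using S(1) by (subst integrable_restrict_space) (auto simp: set_integrable_def)
    qed
    have "u absolutely_integrable_on C" "V absolutely_integrable_on C"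
      using has_weak_deriv_absolutely_integrable[OF u C(1,2)]
        has_weak_deriv_absolutely_integrable[OF wV C(1,2)] by simp_all
    then have "(LINT x|lebesgue_on S. \<phi>' x *\<^sub>R (u x - V x)) =
        (LINT x|lebesgue_on S. \<phi>' x *\<^sub>R u x) - (LINT x|lebesgue_on S. \<phi>' x *\<^sub>R V x)"
      using Bochner_Integration.integral_diff[OF int int] by (simp add: scaleR_diff_right)
    also have "(LINT x|lebesgue_on S. \<phi>' x *\<^sub>R u x) = - (LINT x|lebesgue_on S. \<phi> x *\<^sub>R v x)"
      using u t unfolding has_weak_deriv_def by blast
    also have "(LINT x|lebesgue_on S. \<phi>' x *\<^sub>R V x) = - (LINT x|lebesgue_on S. \<phi> x *\<^sub>R v x)"
      using wV t unfolding has_weak_deriv_def by blast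
    finally show "(LINT x|lebesgue_on S. \<phi>' x *\<^sub>R (u x - V x)) = 0" by simp
  qed blast
  show ?thesis
  proof (rule that)
    show "primitive_on S (\<lambda>x. V x + k) v"
      using V unfolding primitive_on_def by simp
    show "AE x in lebesgue. x \<in> S \<longrightarrow> u x = V x + k"
      using k by eventually_elim (auto simp: algebra_simps)
  qed
qed

lemma continuous_AE_eq_imp_eq:
  fixes f g :: "real \<Rightarrow> complex"
  assumes "open S" "continuous_on S f" "continuous_on S g" "AE x in lebesgue. x \<in> S \<longrightarrow> f x = g x" "x \<in> S"
  shows "f x = g x"
proof (rule ccontr)
  assume ne: "f x \<noteq> g x"
  have "open {x \<in> S. f x - g x \<in> - {0}}"
  proof -
    have "continuous_on S (\<lambda>x. f x - g x)" using assms by (intro continuous_intros)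
    from continuous_open_preimage[OF this assms(1), of "- {0}"] show ?thesis
      by (simp add: vimage_def Int_def open_Compl)
  qed
  moreover have "{x \<in> S. f x - g x \<in> - {0}} \<subseteq> {x. \<not> (x \<in> S \<longrightarrow> f x = g x)}" by auto
  then have "negligible {x \<in> S. f x - g x \<in> - {0}}"
    using assms(4) negligible_subset unfolding AE_iff_negligible by blast
  ultimately have "{x \<in> S. f x - g x \<in> - {0}} = {}" using open_not_negligible by blast
  then show False using ne assms(5) by auto
qed

text \<open>This determines the representative chosen by \<open>wderiv\<close> almost everywhere, and thereby the differential
  expression, its quasi-derivative and the Sobolev norm.\<close>

lemma wderiv_primitive_on:
  assumes S: "open S" "is_interval S" and P: "primitive_on S f g"
    and u: "AE x in lebesgue. x \<in> S \<longrightarrow> u x = f x"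
  shows "AE x in lebesgue. x \<in> S \<longrightarrow> wderiv S u x = g x"
proof -
  have "has_weak_deriv S u g" by (rule has_weak_deriv_primitive_on[OF S P u]) auto
  then have "has_weak_deriv S u (wderiv S u)" unfolding wderiv_def by (rule someI[of "has_weak_deriv S u"])
  then obtain f' where f': "primitive_on S f' (wderiv S u)" "AE x in lebesgue. x \<in> S \<longrightarrow> u x = f' x"
    using has_weak_deriv_imp_primitive_on[OF S] by blast
  have "AE x in lebesgue. x \<in> S \<longrightarrow> f' x = f x"
    using u f'(2) by eventually_elim auto
  from continuous_AE_eq_imp_eq[OF S(1) primitive_on_continuous[OF f'(1) S(2)]
      primitive_on_continuous[OF P S(2)] this]
  have "f' x = f x" if "x \<in> S" for x using that by simp
  then show ?thesis by (rule primitive_on_unique_AE[OF f'(1) P S])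
qed

section \<open>Periodic coefficients\<close>

lemma piecewise_continuous_borel_measurable:
  assumes "piecewise_continuous g"
  shows "g \<in> borel_measurable borel"
proof -
  obtain S where S: "\<And>a b. finite (S \<inter> {a..b::real})" "\<And>x. x \<notin> S \<Longrightarrow> isCont g x"
    using assms unfolding piecewise_continuous_def by blast
  have "S = (\<Union>n::nat. S \<inter> {- real n..real n})"
  proof -
    have "x \<in> (\<Union>n::nat. S \<inter> {- real n..real n})" if "x \<in> S" for x
    proof -
      obtain n :: nat where "\<bar>x\<bar> \<le> real n" using real_arch_simple by blast
      then have "x \<in> S \<inter> {- real n..real n}" using that by (auto simp: abs_le_iff)
      then show ?thesis by (rule UN_I[OF UNIV_I])
    qed
    moreover have "(\<Union>n::nat. S \<inter> {- real n..real n}) \<subseteq> S" by (intro UN_least Int_lower1)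
    ultimately show ?thesis by blast
  qed
  moreover have "countable (\<Union>n::nat. S \<inter> {- real n..real n})"
    using S(1) by (intro countable_UN) (auto intro: countable_finite)
  ultimately have "countable S" by simp
  moreover have "continuous_on (- S) g"
    using S(2) by (auto intro!: continuous_at_imp_continuous_on)
  ultimately show ?thesis
    by (rule borel_measurable_continuous_countable_exceptions)
qed

text \<open>One-sided limits bound the function near each point; bisection makes the bound global.\<close>

lemma piecewise_continuous_bounded:
  assumes "piecewise_continuous g"
  shows "bounded (g ` {a..b})"
proof (cases "a \<le> b")
  case True
  then show ?thesis
  proof (induction rule: Bolzano)
    case (trans a b c)
    then have "{a..c} = {a..b} \<union> {b..c}" by auto
    with trans show ?case by (simp add: image_Un)
  next
    case (local x)
    obtain l r where lr: "(g \<longlongrightarrow> l) (at_left x)" "(g \<longlongrightarrow> r) (at_right x)"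
      using assms unfolding piecewise_continuous_def by blast
    have "\<forall>\<^sub>F t in at_left x. dist (g t) l < 1" "\<forall>\<^sub>F t in at_right x. dist (g t) r < 1"
      using tendstoD[OF lr(1), of 1] tendstoD[OF lr(2), of 1] by simp_all
    then obtain d1 d2 where d: "d1 < x" "\<And>t. d1 < t \<Longrightarrow> t < x \<Longrightarrow> dist (g t) l < 1"
        "d2 > x" "\<And>t. x < t \<Longrightarrow> t < d2 \<Longrightarrow> dist (g t) r < 1"
      unfolding eventually_at_left_field eventually_at_right_field by blast
    define M where "M = \<bar>l\<bar> + \<bar>r\<bar> + \<bar>g x\<bar> + 1"
    have M: "\<bar>g t\<bar> \<le> M" if "d1 < t" "t < d2" for t
      using d(2)[of t] d(4)[of t] that unfolding M_def dist_real_def by (cases t x rule: linorder_cases) auto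
    have "bounded (g ` {s..e})" if "s \<le> x" "x \<le> e" "e - s < min (x - d1) (d2 - x)" for s e
      unfolding bounded_iff by (intro exI[of _ M]) (use M that in auto)
    then show ?case using d by (intro exI[of _ "min (x - d1) (d2 - x)"]) auto
  qed
qed auto

text \<open>The reciprocal is needed to differentiate \<open>u' = v / p\<close> once more when \<open>v\<close> is the known quantity.\<close>

lemma piecewise_C1_primitives:
  assumes p: "piecewise_C1 p" and pos: "\<And>x. p x \<ge> p0" "p0 > 0"
  obtains p' where "p' \<in> borel_measurable borel" "\<And>a b. bounded (p' ` {a..b})"
    "primitive_on UNIV (\<lambda>x. of_real (p x)) (\<lambda>x. of_real (p' x))"
    "primitive_on UNIV (\<lambda>x. of_real (1 / p x)) (\<lambda>x. of_real (- p' x / (p x)\<^sup>2))"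
proof -
  obtain p' S where p': "piecewise_continuous p'" "\<And>a b. finite (S \<inter> {a..b::real})"
      "\<And>x. x \<notin> S \<Longrightarrow> (p has_real_derivative p' x) (at x)" and c: "continuous_on UNIV p"
    using p unfolding piecewise_C1_def by blast
  have m: "p' \<in> borel_measurable borel" by (rule piecewise_continuous_borel_measurable[OF p'(1)])
  have b: "bounded (p' ` {s..x})" for s x by (rule piecewise_continuous_bounded[OF p'(1)])
  have mp: "p \<in> borel_measurable borel" using c by (rule borel_measurable_continuous_onI)
  have nz: "p x > 0" for x using pos(1)[of x] pos(2) by linarith
  have ai: "(\<lambda>t. complex_of_real (w t)) absolutely_integrable_on {s..x}"
    if w: "w \<in> borel_measurable borel" "bounded (w ` {s..x})" for w :: "real \<Rightarrow> real" and s x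
  proof -
    obtain B where B: "\<And>t. t \<in> {s..x} \<Longrightarrow> \<bar>w t\<bar> \<le> B" using w(2) unfolding bounded_iff by (metis imageI real_norm_def)
    show ?thesis
    proof (rule measurable_bounded_by_integrable_imp_absolutely_integrable[where g = "\<lambda>_. B"])
      show "(\<lambda>t. complex_of_real (w t)) \<in> borel_measurable (lebesgue_on {s..x})"
        using w(1) by (intro measurable_restrict_space1) (auto intro: borel_measurable_of_real measurable_completion)
    qed (use B in auto)
  qed
  have P1: "primitive_on UNIV (\<lambda>x. of_real (p x)) (\<lambda>x. of_real (p' x))"
  proof (rule primitive_on_classical[OF p'(2)])
    show "((\<lambda>x. complex_of_real (p x)) has_vector_derivative complex_of_real (p' x)) (at x within UNIV)"
      if "x \<notin> S" for x
      using has_vector_derivative_of_real[OF p'(3)[OF that]] by simp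
    show "continuous_on UNIV (\<lambda>x. complex_of_real (p x))" by (intro continuous_intros c)
  qed (auto intro: ai m b)
  have P2: "primitive_on UNIV (\<lambda>x. of_real (1 / p x)) (\<lambda>x. of_real (- p' x / (p x)\<^sup>2))"
  proof (rule primitive_on_classical[OF p'(2)])
    fix x assume "x \<notin> S"
    then have "((\<lambda>x. 1 / p x) has_real_derivative (- p' x / (p x)\<^sup>2)) (at x)"
      using p'(3)[of x] nz[of x]
      by (auto intro!: derivative_eq_intros simp: power2_eq_square)
    then show "((\<lambda>x. complex_of_real (1 / p x)) has_vector_derivative complex_of_real (- p' x / (p x)\<^sup>2)) (at x within UNIV)"
      by (rule has_vector_derivative_of_real)
  next
    show "continuous_on UNIV (\<lambda>x. complex_of_real (1 / p x))"
      using nz by (intro continuous_intros c) (metis less_irrefl)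
    fix s x :: real
    obtain B where B: "\<And>t. t \<in> {s..x} \<Longrightarrow> \<bar>p' t\<bar> \<le> B" using b[of s x] unfolding bounded_iff by (metis imageI real_norm_def)
    show "(\<lambda>x. complex_of_real (- p' x / (p x)\<^sup>2)) absolutely_integrable_on {s..x}"
    proof (rule ai)
      show "(\<lambda>x. - p' x / (p x)\<^sup>2) \<in> borel_measurable borel" using m mp by measurable
      have "\<bar>- p' t / (p t)\<^sup>2\<bar> \<le> B / p0\<^sup>2" if "t \<in> {s..x}" for t
      proof -
        have "\<bar>p' t\<bar> / (p t)\<^sup>2 \<le> B / p0\<^sup>2"
          using B[OF that] pos(1)[of t] pos(2) by (intro frac_le power_mono) auto
        then show ?thesis by (simp add: abs_divide)
      qed
      then show "bounded ((\<lambda>x. - p' x / (p x)\<^sup>2) ` {s..x})" unfolding bounded_iff by fastforce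
    qed
  qed auto
  show ?thesis by (rule that[OF m b P1 P2])
qed

lemma periodic_of_int:
  fixes g :: "real \<Rightarrow> 'a"
  assumes "\<And>x. g (x + 1) = g x"
  shows "g (x + of_int k) = g x"
proof -
  have nat: "g (x + real n) = g x" for x n
  proof (induction n)
    case (Suc n)
    then show ?case using assms[of "x + real n"] by (simp add: algebra_simps)
  qed simp
  show ?thesis
  proof (cases "k \<ge> 0")
    case True then show ?thesis using nat[of x "nat k"] by simp
  next
    case False then show ?thesis using nat[of "x + of_int k" "nat (- k)"] by simp
  qed
qed

lemma bounded_of_periodic:
  fixes g :: "real \<Rightarrow> real"
  assumes "\<And>x. g (x + 1) = g x" "bounded (g ` {0..1})"
  obtains M where "\<And>x. \<bar>g x\<bar> \<le> M"
proof -
  obtain M where M: "\<And>x. x \<in> {0..1} \<Longrightarrow> \<bar>g x\<bar> \<le> M"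
    using assms(2) unfolding bounded_iff by (metis imageI real_norm_def)
  have "\<bar>g x\<bar> \<le> M" for x
  proof -
    have "frac x \<in> {0..1}" using frac_ge_0[of x] frac_lt_1[of x] by simp
    then show ?thesis
      using periodic_of_int[of g, OF assms(1), of "frac x" "\<lfloor>x\<rfloor>"] M[of "frac x"] by (simp add: frac_def)
  qed
  then show ?thesis by (rule that)
qed

locale periodic_problem =
  fixes p q :: "real \<Rightarrow> real" and p0 :: real
  assumes coeffs: "periodic_coefficients p q p0"
begin

lemma p_periodic: "p (x + 1) = p x" and q_periodic: "q (x + 1) = q x"
  and p0_pos: "p0 > 0" and p_ge: "p x \<ge> p0" and p_0: "p 0 = 1"
  and p_C1: "piecewise_C1 p" and q_pc: "piecewise_continuous q"
  using coeffs unfolding periodic_coefficients_def by auto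

lemma p_pos: "p x > 0"
  using p_ge[of x] p0_pos by linarith

lemma p_continuous: "continuous_on A p"
  using p_C1 continuous_on_subset unfolding piecewise_C1_def by blast

lemma p_periodic_int: "p (x + of_int k) = p x" and q_periodic_int: "q (x + of_int k) = q x"
  using periodic_of_int[of p, OF p_periodic] periodic_of_int[of q, OF q_periodic] by simp_all

lemma q_measurable: "q \<in> borel_measurable borel"
  by (rule piecewise_continuous_borel_measurable[OF q_pc])

definition q_bound :: real where "q_bound = (SOME M. \<forall>x. \<bar>q x\<bar> \<le> M)"
definition p_bound :: real where "p_bound = (SOME M. \<forall>x. \<bar>p x\<bar> \<le> M)"

lemma q_bound: "\<bar>q x\<bar> \<le> q_bound"
proof -
  have "\<exists>M. \<forall>x. \<bar>q x\<bar> \<le> M"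
    using bounded_of_periodic[of q, OF q_periodic piecewise_continuous_bounded[OF q_pc]] by metis
  from someI_ex[OF this] show ?thesis unfolding q_bound_def by blast
qed

lemma p_bound: "p x \<le> p_bound"
proof -
  have "bounded (p ` {0..1})"
    by (intro compact_imp_bounded compact_continuous_image p_continuous) auto
  then have "\<exists>M. \<forall>x. \<bar>p x\<bar> \<le> M"
    using bounded_of_periodic[of p, OF p_periodic] by metis
  from someI_ex[OF this] have "\<bar>p x\<bar> \<le> p_bound" unfolding p_bound_def by blast
  then show ?thesis by simp
qed

lemma q_bound_nonneg: "q_bound \<ge> 0"
  using q_bound[of 0] by simp

lemma q_minus_z_mult_absolutely_integrable:
  fixes y :: "real \<Rightarrow> complex"
  assumes "continuous_on {s..x} y"
  shows "(\<lambda>t. (of_real (q t) - z) * y t) absolutely_integrable_on {s..x}"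
proof (rule absolutely_integrable_bounded_measurable_product[OF bilinear_times])
  show "(\<lambda>t. complex_of_real (q t) - z) \<in> borel_measurable (lebesgue_on {s..x})"
    using q_measurable
    by (intro measurable_restrict_space1 borel_measurable_diff borel_measurable_const)
       (auto intro: borel_measurable_of_real measurable_completion)
  have "norm (complex_of_real (q t) - z) \<le> q_bound + norm z" for t
    using norm_triangle_ineq4[of "complex_of_real (q t)" z] q_bound[of t] by simp
  then show "bounded ((\<lambda>t. complex_of_real (q t) - z) ` {s..x})"
    unfolding bounded_iff by blast
  show "y absolutely_integrable_on {s..x}"
    by (rule absolutely_integrable_continuous_real[OF assms])
qed auto

lemma divide_p_absolutely_integrable:
  fixes v :: "real \<Rightarrow> complex"
  assumes "continuous_on {s..x} v"
  shows "(\<lambda>t. v t / of_real (p t)) absolutely_integrable_on {s..x}"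
  using p_pos by (intro absolutely_integrable_continuous_real continuous_intros assms p_continuous)
    (metis less_irrefl of_real_eq_0_iff)

end

section \<open>The first-order system\<close>

text \<open>The derivative of \<open>exp (- K t) (A + K \<integral> g)\<close> is nonpositive.\<close>

lemma gronwall_forward:
  fixes g :: "real \<Rightarrow> real"
  assumes "s \<le> x" and c: "continuous_on {s..x} g" and "K \<ge> 0"
    and le: "\<And>t. t \<in> {s..x} \<Longrightarrow> g t \<le> A + K * integral {s..t} g"
  shows "g x \<le> A * exp (K * (x - s))"
proof -
  define G where "G t = exp (- (K * t)) * (A + K * integral {s..t} g)" for t
  have "G x \<le> G s"
  proof (rule DERIV_nonpos_imp_decreasing_open[OF \<open>s \<le> x\<close>])
    fix t assume t: "s < t" "t < x"
    have "((\<lambda>u. integral {s..u} g) has_vector_derivative g t) (at t within {s..x})"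
      by (rule integral_has_vector_derivative[OF c]) (use t in auto)
    then have "((\<lambda>u. integral {s..u} g) has_real_derivative g t) (at t)"
      using t by (simp add: has_real_derivative_iff_has_vector_derivative at_within_Icc_at)
    then have "(G has_real_derivative exp (- (K * t)) * (K * g t - K * (A + K * integral {s..t} g))) (at t)"
      unfolding G_def by (auto intro!: derivative_eq_intros simp: algebra_simps)
    moreover have "K * g t - K * (A + K * integral {s..t} g) \<le> 0"
      using mult_left_mono[OF le[of t] \<open>K \<ge> 0\<close>] t by simp
    ultimately show "\<exists>y. (G has_real_derivative y) (at t) \<and> y \<le> 0"
      by (meson exp_ge_zero mult_nonneg_nonpos)
  next
    show "continuous_on {s..x} G"
      unfolding G_def by (intro continuous_intros indefinite_integral_continuous_1 integrable_continuous_interval c)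
  qed
  then have "A + K * integral {s..x} g \<le> A * exp (K * (x - s))"
    by (simp add: G_def exp_minus exp_diff field_simps)
  then show ?thesis using le[of x] \<open>s \<le> x\<close> by simp
qed

lemma gronwall_backward:
  fixes g :: "real \<Rightarrow> real"
  assumes "x \<le> s" and c: "continuous_on {x..s} g" and "K \<ge> 0"
    and le: "\<And>t. t \<in> {x..s} \<Longrightarrow> g t \<le> A + K * integral {t..s} g"
  shows "g x \<le> A * exp (K * (s - x))"
proof -
  have "g (- (- x)) \<le> A * exp (K * (- x - - s))"
  proof (rule gronwall_forward[of "- s" "- x" "\<lambda>t. g (- t)"])
    show "continuous_on {- s..- x} (\<lambda>t. g (- t))"
      by (rule continuous_on_compose2[OF c]) (auto intro!: continuous_intros)
    fix t assume "t \<in> {- s..- x}"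
    then show "g (- t) \<le> A + K * integral {- s..t} (\<lambda>t. g (- t))"
      using le[of "- t"] Henstock_Kurzweil_Integration.integral_reflect_real[of s "- t" g] by simp
  qed (use assms in auto)
  then show ?thesis by simp
qed

context periodic_problem
begin

text \<open>The equation \<open>- (p y')' + q y - z y = - h\<close> as a system for \<open>y\<close> and its quasi-derivative \<open>v = p y'\<close>.
  Unlike \<open>y'\<close>, the quasi-derivative is differentiated without differentiating \<open>p\<close>.\<close>

definition solves :: "complex \<Rightarrow> (real \<Rightarrow> complex) \<Rightarrow> real set \<Rightarrow> (real \<Rightarrow> complex) \<Rightarrow> (real \<Rightarrow> complex) \<Rightarrow> bool" where
  "solves z h I y v \<longleftrightarrow> primitive_on I y (\<lambda>t. v t / of_real (p t)) \<and>
     primitive_on I v (\<lambda>t. (of_real (q t) - z) * y t + h t)"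

lemma solves_subset: "solves z h I y v \<Longrightarrow> J \<subseteq> I \<Longrightarrow> solves z h J y v"
  unfolding solves_def by (blast intro: primitive_on_subset)

lemma solves_continuous:
  assumes "solves z h I y v" "is_interval I"
  shows "continuous_on I y" "continuous_on I v"
  using assms unfolding solves_def by (auto intro: primitive_on_continuous)

lemma solves_add_cmult:
  assumes "solves z h I y v" "solves z h' I y' v'"
  shows "solves z (\<lambda>t. h t + c * h' t) I (\<lambda>t. y t + c * y' t) (\<lambda>t. v t + c * v' t)"
proof -
  have "primitive_on I (\<lambda>t. y t + c * y' t) (\<lambda>t. v t / of_real (p t) + c * (v' t / of_real (p t)))"
    using assms unfolding solves_def by (intro primitive_on_add primitive_on_cmult) auto
  moreover have "primitive_on I (\<lambda>t. v t + c * v' t)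
     (\<lambda>t. ((of_real (q t) - z) * y t + h t) + c * ((of_real (q t) - z) * y' t + h' t))"
    using assms unfolding solves_def by (intro primitive_on_add primitive_on_cmult) auto
  ultimately show ?thesis
    unfolding solves_def by (simp add: algebra_simps add_divide_distrib)
qed

lemma solves_zero: "solves z (\<lambda>_. 0) I (\<lambda>_. 0) (\<lambda>_. 0)"
  by (simp add: solves_def primitive_on_def)

text \<open>A change of the spectral parameter is an inhomogeneity; in this way solutions for different
  parameters are compared.\<close>

lemma solves_change_parameter:
  assumes "solves z h I y v"
  shows "solves z' (\<lambda>t. h t + (z' - z) * y t) I y v"
  using assms unfolding solves_def by (simp add: algebra_simps)

lemma solves_cong_inhom:
  assumes "solves z h I y v" "\<And>t. t \<in> I \<Longrightarrow> h' t = h t" "is_interval I"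
  shows "solves z h' I y v"
  using assms unfolding solves_def
  by (auto intro!: primitive_on_AE_cong[of I v "\<lambda>t. (of_real (q t) - z) * y t + h t"])

lemma solves_shift:
  assumes "solves z h I y v"
  shows "solves z (\<lambda>t. h (t + of_int m)) {x. x + of_int m \<in> I} (\<lambda>t. y (t + of_int m)) (\<lambda>t. v (t + of_int m))"
  using primitive_on_shift[of I y _ "of_int m"] primitive_on_shift[of I v _ "of_int m"] assms
  unfolding solves_def by (force simp: p_periodic_int q_periodic_int)

lemma solves_cnj:
  assumes "solves z (\<lambda>_. 0) I y v"
  shows "solves (cnj z) (\<lambda>_. 0) I (\<lambda>t. cnj (y t)) (\<lambda>t. cnj (v t))"
  using assms primitive_on_cnj[of I y] primitive_on_cnj[of I v] unfolding solves_def by force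

lemma solves_inhom_integrable:
  assumes "solves z h I y v" "is_interval I" "s \<in> I" "x \<in> I"
  shows "h absolutely_integrable_on {s..x}" "(\<lambda>t. norm (h t)) integrable_on {s..x}"
proof -
  have sub: "{s..x} \<subseteq> I" by (rule is_interval_Icc_subset[OF assms(2-4)])
  show h: "h absolutely_integrable_on {s..x}"
  proof (cases "s \<le> x")
    case True
    have "(\<lambda>t. (of_real (q t) - z) * y t + h t) absolutely_integrable_on {s..x}"
      using assms(1,3,4) True unfolding solves_def by (auto dest: primitive_onD)
    moreover have "(\<lambda>t. (of_real (q t) - z) * y t) absolutely_integrable_on {s..x}"
      using solves_continuous(1)[OF assms(1,2)] sub
      by (intro q_minus_z_mult_absolutely_integrable) (auto intro: continuous_on_subset)
    ultimately have "(\<lambda>t. ((of_real (q t) - z) * y t + h t) - (of_real (q t) - z) * y t)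
        absolutely_integrable_on {s..x}"
      by (rule set_integral_diff(1))
    then show ?thesis by simp
  qed auto
  then show "(\<lambda>t. norm (h t)) integrable_on {s..x}"
    unfolding absolutely_integrable_on_def by blast
qed

text \<open>The Gronwall constant of the system, for spectral parameters of modulus at most \<open>Z\<close>.\<close>

definition growth :: "real \<Rightarrow> real" where
  "growth Z = 1 / p0 + q_bound + Z"

lemma growth_nonneg: "Z \<ge> 0 \<Longrightarrow> growth Z \<ge> 0"
  using p0_pos q_bound_nonneg by (simp add: growth_def)

lemma solves_increment_bound:
  assumes sol: "solves z h I y v" and I: "is_interval I" and sx: "s \<in> I" "x \<in> I" "s \<le> x"
    and Z: "norm z \<le> Z"
  shows "norm (y x - y s) + norm (v x - v s) \<le>
    growth Z * integral {s..x} (\<lambda>t. norm (y t) + norm (v t)) + integral {s..x} (\<lambda>t. norm (h t))"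
proof -
  have sub: "{s..x} \<subseteq> I" by (rule is_interval_Icc_subset[OF I sx(1,2)])
  have c: "continuous_on {s..x} y" "continuous_on {s..x} v"
    using solves_continuous[OF sol I] sub continuous_on_subset by blast+
  note hi = solves_inhom_integrable[OF sol I sx(1,2)]
  have int: "(\<lambda>t. norm (y t)) integrable_on {s..x}" "(\<lambda>t. norm (v t)) integrable_on {s..x}"
    by (intro integrable_continuous_interval continuous_intros c)+
  have y: "norm (y x - y s) \<le> integral {s..x} (\<lambda>t. norm (v t) / p0)"
  proof -
    have "y x - y s = integral {s..x} (\<lambda>t. v t / of_real (p t))"
      using sol sx unfolding solves_def by (auto dest: primitive_onD(3))
    also have "norm \<dots> \<le> integral {s..x} (\<lambda>t. norm (v t) / p0)"
    proof (rule integral_norm_bound_integral)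
      show "(\<lambda>t. v t / of_real (p t)) integrable_on {s..x}"
        using divide_p_absolutely_integrable[OF c(2)] absolutely_integrable_on_def by blast
      show "norm (v t / of_real (p t)) \<le> norm (v t) / p0" for t
        using p_ge[of t] p0_pos p_pos[of t] by (simp add: norm_divide frac_le)
    qed (use int(2) in \<open>auto intro!: integrable_on_divide\<close>)
    finally show ?thesis .
  qed
  have v: "norm (v x - v s) \<le> integral {s..x} (\<lambda>t. (q_bound + Z) * norm (y t) + norm (h t))"
  proof -
    have "v x - v s = integral {s..x} (\<lambda>t. (of_real (q t) - z) * y t + h t)"
      using sol sx unfolding solves_def by (auto dest: primitive_onD(3))
    also have "norm \<dots> \<le> integral {s..x} (\<lambda>t. (q_bound + Z) * norm (y t) + norm (h t))"
    proof (rule integral_norm_bound_integral)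
      show "(\<lambda>t. (of_real (q t) - z) * y t + h t) integrable_on {s..x}"
        using sol sx unfolding solves_def by (auto dest!: primitive_onD(2)[of I v _ s x])
      show "(\<lambda>t. (q_bound + Z) * norm (y t) + norm (h t)) integrable_on {s..x}"
        by (intro integrable_add integrable_on_mult_right int hi)
      show "norm ((of_real (q t) - z) * y t + h t) \<le> (q_bound + Z) * norm (y t) + norm (h t)" for t
      proof (rule norm_triangle_mono)
        have "norm (of_real (q t) - z) \<le> q_bound + Z"
          using norm_triangle_ineq4[of "complex_of_real (q t)" z] q_bound[of t] Z by simp
        then show "norm ((of_real (q t) - z) * y t) \<le> (q_bound + Z) * norm (y t)"
          unfolding norm_mult by (rule mult_right_mono) simp
      qed simp
    qed
    finally show ?thesis .
  qed
  have Z0: "Z \<ge> 0" using Z norm_ge_zero order_trans by blast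
  have "norm (y x - y s) + norm (v x - v s) \<le>
      integral {s..x} (\<lambda>t. norm (v t) / p0) + integral {s..x} (\<lambda>t. (q_bound + Z) * norm (y t) + norm (h t))"
    using y v by linarith
  also have "\<dots> = integral {s..x} (\<lambda>t. norm (v t) / p0 + (q_bound + Z) * norm (y t)) + integral {s..x} (\<lambda>t. norm (h t))"
    using int hi(2) by (simp add: Henstock_Kurzweil_Integration.integral_add integrable_on_mult_right integrable_on_divide integrable_add)
  also have "integral {s..x} (\<lambda>t. norm (v t) / p0 + (q_bound + Z) * norm (y t)) \<le>
      integral {s..x} (\<lambda>t. growth Z * (norm (y t) + norm (v t)))"
  proof (rule integral_le)
    show "norm (v t) / p0 + (q_bound + Z) * norm (y t) \<le> growth Z * (norm (y t) + norm (v t))" for t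
    proof -
      have "0 \<le> (1 / p0) * norm (y t)" "0 \<le> (q_bound + Z) * norm (v t)"
        using p0_pos q_bound_nonneg Z0 by auto
      then show ?thesis by (simp add: growth_def algebra_simps)
    qed
  qed (use int in \<open>auto intro!: integrable_add integrable_on_mult_right integrable_on_divide\<close>)
  also have "\<dots> = growth Z * integral {s..x} (\<lambda>t. norm (y t) + norm (v t))"
    by simp
  finally show ?thesis by simp
qed

lemma solves_bound:
  assumes sol: "solves z h I y v" and I: "is_interval I" and sx: "s \<in> I" "x \<in> I"
    and Z: "norm z \<le> Z" and H: "integral {min s x..max s x} (\<lambda>t. norm (h t)) \<le> H"
  shows "norm (y x) + norm (v x) \<le> (norm (y s) + norm (v s) + H) * exp (growth Z * \<bar>x - s\<bar>)"
proof -
  define g where "g t = norm (y t) + norm (v t)" for t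
  have Z0: "Z \<ge> 0" using Z norm_ge_zero order_trans by blast
  have K: "growth Z \<ge> 0" by (rule growth_nonneg[OF Z0])
  have c: "continuous_on I g"
    unfolding g_def by (intro continuous_intros solves_continuous[OF sol I])
  have tri: "g t \<le> g r + (norm (y t - y r) + norm (v t - v r))" for t r
    unfolding g_def using norm_triangle_ineq2[of "y t" "y r"] norm_triangle_ineq2[of "v t" "v r"] by linarith
  have Hmono: "integral {a..b} (\<lambda>t. norm (h t)) \<le> H" if "a \<le> b" "{a..b} \<subseteq> {min s x..max s x}" for a b
  proof -
    have "{min s x..max s x} \<subseteq> I" using is_interval_Icc_subset[OF I] sx by (auto simp: min_def max_def)
    moreover have "a \<in> {min s x..max s x}" "b \<in> {min s x..max s x}" using that by auto
    ultimately have "integral {a..b} (\<lambda>t. norm (h t)) \<le> integral {min s x..max s x} (\<lambda>t. norm (h t))"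
      using sx by (intro integral_subset_le that solves_inhom_integrable[OF sol I]) (auto simp: min_def max_def)
    with H show ?thesis by simp
  qed
  show ?thesis
  proof (cases "s \<le> x")
    case True
    have sub: "{s..x} \<subseteq> I" by (rule is_interval_Icc_subset[OF I sx])
    have "g x \<le> (g s + H) * exp (growth Z * (x - s))"
    proof (rule gronwall_forward[OF True continuous_on_subset[OF c sub] K])
      fix t assume t: "t \<in> {s..x}"
      then have "t \<in> I" using sub by auto
      from solves_increment_bound[OF sol I sx(1) this _ Z] t
      have "norm (y t - y s) + norm (v t - v s) \<le> growth Z * integral {s..t} g + integral {s..t} (\<lambda>t. norm (h t))"
        unfolding g_def by simp
      then show "g t \<le> g s + H + growth Z * integral {s..t} g"
        using tri[of t s] Hmono[of s t] t True by (auto simp: min_def max_def)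
    qed
    then show ?thesis using True by (simp add: g_def)
  next
    case False
    then have le: "x \<le> s" by simp
    have sub: "{x..s} \<subseteq> I" by (rule is_interval_Icc_subset[OF I sx(2,1)])
    have "g x \<le> (g s + H) * exp (growth Z * (s - x))"
    proof (rule gronwall_backward[OF le continuous_on_subset[OF c sub] K])
      fix t assume t: "t \<in> {x..s}"
      then have "t \<in> I" using sub by auto
      from solves_increment_bound[OF sol I this sx(1) _ Z] t
      have "norm (y t - y s) + norm (v t - v s) \<le> growth Z * integral {t..s} g + integral {t..s} (\<lambda>t. norm (h t))"
        unfolding g_def by (simp add: norm_minus_commute)
      then show "g t \<le> g s + H + growth Z * integral {t..s} g"
        using tri[of t s] Hmono[of t s] t le by (auto simp: min_absorb2 max_absorb1)
    qed
    then show ?thesis using le by (simp add: g_def)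
  qed
qed

lemma solves_unique_zero:
  assumes "solves z (\<lambda>_. 0) I y v" "is_interval I" "s \<in> I" "x \<in> I" "y s = 0" "v s = 0"
  shows "y x = 0" "v x = 0"
proof -
  have "norm (y x) + norm (v x) \<le> (norm (y s) + norm (v s) + 0) * exp (growth (norm z) * \<bar>x - s\<bar>)"
    by (rule solves_bound[OF assms(1-4)]) auto
  then have "norm (y x) + norm (v x) \<le> 0" using assms(5,6) by simp
  then show "y x = 0" "v x = 0"
    using norm_ge_zero[of "y x"] norm_ge_zero[of "v x"] by (smt (verit) norm_eq_zero)+
qed

definition wronskian where
  "wronskian y1 v1 y2 v2 x = y1 x * v2 x - v1 x * (y2 x :: complex)" for x :: real

text \<open>Green's formula.\<close>

lemma wronskian_primitive:
  assumes "solves z1 (\<lambda>_. 0) I y1 v1" "solves z2 (\<lambda>_. 0) I y2 v2" "is_interval I"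
  shows "primitive_on I (wronskian y1 v1 y2 v2) (\<lambda>t. (z1 - z2) * (y1 t * y2 t))"
proof -
  have 1: "primitive_on I y1 (\<lambda>t. v1 t / of_real (p t))" "primitive_on I v1 (\<lambda>t. (of_real (q t) - z1) * y1 t)"
    "primitive_on I y2 (\<lambda>t. v2 t / of_real (p t))" "primitive_on I v2 (\<lambda>t. (of_real (q t) - z2) * y2 t)"
    using assms unfolding solves_def by auto
  have "primitive_on I (\<lambda>x. y1 x * v2 x - v1 x * y2 x)
    (\<lambda>t. (v1 t / of_real (p t) * v2 t + y1 t * ((of_real (q t) - z2) * y2 t)) -
         ((of_real (q t) - z1) * y1 t * y2 t + v1 t * (v2 t / of_real (p t))))"
    by (intro primitive_on_diff primitive_on_mult 1 assms(3))
  then show ?thesis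
    unfolding wronskian_def[abs_def] by (simp add: algebra_simps)
qed

lemma wronskian_constant:
  assumes "solves z (\<lambda>_. 0) I y1 v1" "solves z (\<lambda>_. 0) I y2 v2" "is_interval I" "s \<in> I" "x \<in> I"
  shows "wronskian y1 v1 y2 v2 x = wronskian y1 v1 y2 v2 s"
proof -
  note P = wronskian_primitive[OF assms(1-3)]
  show ?thesis
    using primitive_onD(3)[OF P assms(4,5)] primitive_onD(3)[OF P assms(5,4)] by (cases "s \<le> x") auto
qed

text \<open>The constant is chosen to match the Cauchy data at \<open>s\<close>; uniqueness does the rest.\<close>

lemma wronskian_zero_imp_proportional:
  assumes sol: "solves z (\<lambda>_. 0) I y1 v1" "solves z (\<lambda>_. 0) I y2 v2" and I: "is_interval I" "s \<in> I"
    and ne: "y1 s \<noteq> 0 \<or> v1 s \<noteq> 0" and W: "wronskian y1 v1 y2 v2 s = 0"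
  obtains c where "\<And>x. x \<in> I \<Longrightarrow> y2 x = c * y1 x" "\<And>x. x \<in> I \<Longrightarrow> v2 x = c * v1 x"
proof -
  define c where "c = (if y1 s \<noteq> 0 then y2 s / y1 s else v2 s / v1 s)"
  have c: "y2 s = c * y1 s" "v2 s = c * v1 s"
    using ne W by (auto simp: c_def wronskian_def field_simps)
  have d: "solves z (\<lambda>_. 0) I (\<lambda>t. y2 t + (- c) * y1 t) (\<lambda>t. v2 t + (- c) * v1 t)"
    using solves_add_cmult[OF sol(2,1), of "- c"] by simp
  show ?thesis
    using that[of c] solves_unique_zero[OF d I] c by simp
qed

lemma Cauchy_of_null_bound:
  fixes X :: "nat \<Rightarrow> complex"
  assumes "\<And>m n. norm (X n - X m) \<le> C * (\<delta> n + \<delta> m)" "\<delta> \<longlonglongrightarrow> 0"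
  shows "Cauchy X"
proof (rule metric_CauchyI)
  fix e :: real assume "e > 0"
  have "(\<lambda>n. \<bar>C\<bar> * \<bar>\<delta> n\<bar>) \<longlonglongrightarrow> \<bar>C\<bar> * \<bar>0\<bar>" by (intro tendsto_intros assms(2))
  then have "\<forall>\<^sub>F n in sequentially. \<bar>C\<bar> * \<bar>\<delta> n\<bar> < e / 2"
    using \<open>e > 0\<close> by (intro order_tendstoD(2)[of _ "\<bar>C\<bar> * \<bar>0\<bar>"]) auto
  then obtain M where M: "\<And>n. n \<ge> M \<Longrightarrow> \<bar>C\<bar> * \<bar>\<delta> n\<bar> < e / 2"
    unfolding eventually_sequentially by blast
  have "dist (X m) (X n) < e" if "m \<ge> M" "n \<ge> M" for m n
  proof -
    have "dist (X m) (X n) \<le> C * (\<delta> n + \<delta> m)"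
      using assms(1)[of n m] by (simp add: dist_norm norm_minus_commute)
    also have "\<dots> \<le> \<bar>C\<bar> * \<bar>\<delta> n\<bar> + \<bar>C\<bar> * \<bar>\<delta> m\<bar>"
      unfolding distrib_left using abs_ge_self[of "C * \<delta> n"] abs_ge_self[of "C * \<delta> m"]
      by (simp only: abs_mult)
    also have "\<dots> < e" using M[OF that(1)] M[OF that(2)] by linarith
    finally show ?thesis .
  qed
  then show "\<exists>M. \<forall>m\<ge>M. \<forall>n\<ge>M. dist (X m) (X n) < e" by blast
qed

text \<open>By Gronwall's inequality the difference of two members of the sequence is controlled by the
  differences of the initial data and of the parameters and by the inhomogeneities. So the sequence is
  a Cauchy sequence at every point, and the limit inherits the integrated equations by dominated
  convergence.\<close>

lemma solves_limit:
  fixes z :: "nat \<Rightarrow> complex" and y v h :: "nat \<Rightarrow> real \<Rightarrow> complex" and H :: "nat \<Rightarrow> real"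
  assumes sol: "\<And>n. solves (z n) (h n) UNIV (y n) (v n)"
    and z: "z \<longlonglongrightarrow> \<zeta>"
    and init: "(\<lambda>n. y n s) \<longlonglongrightarrow> \<alpha>" "(\<lambda>n. v n s) \<longlonglongrightarrow> \<beta>"
    and H: "\<And>n r x. integral {r..x} (\<lambda>t. norm (h n t)) \<le> H n" "H \<longlonglongrightarrow> 0"
  obtains y' v' where "solves \<zeta> (\<lambda>_. 0) UNIV y' v'"
    "\<And>x. (\<lambda>n. y n x) \<longlonglongrightarrow> y' x" "\<And>x. (\<lambda>n. v n x) \<longlonglongrightarrow> v' x"
    "\<And>r x. \<exists>B\<ge>0. \<forall>n. \<forall>t\<in>{r..x}. norm (y n t) + norm (v n t) \<le> B"
proof -
  obtain Z where Z: "\<And>n. norm (z n) \<le> Z"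
    using convergent_imp_bounded[OF z] by (auto simp: bounded_iff)
  have Z0: "Z \<ge> 0" using Z[of 0] norm_ge_zero order_trans by blast
  define d where "d n = norm (y n s) + norm (v n s) + H n" for n
  have "d \<longlonglongrightarrow> norm \<alpha> + norm \<beta> + 0"
    unfolding d_def by (intro tendsto_intros init H(2))
  then obtain D where D: "\<And>n. \<bar>d n\<bar> \<le> D"
    using convergent_imp_bounded[of d] by (auto simp: bounded_iff)
  have D0: "D \<ge> 0" using D[of 0] by simp
  have bound: "norm (y n t) + norm (v n t) \<le> D * exp (growth Z * \<bar>t - s\<bar>)" for n t
  proof -
    have "norm (y n t) + norm (v n t) \<le> d n * exp (growth Z * \<bar>t - s\<bar>)"
      unfolding d_def by (rule solves_bound[OF sol]) (auto intro: Z H)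
    also have "\<dots> \<le> D * exp (growth Z * \<bar>t - s\<bar>)"
      using D[of n] by (intro mult_right_mono) auto
    finally show ?thesis .
  qed
  have unif: "norm (y n t) + norm (v n t) \<le> D * exp (growth Z * (\<bar>r\<bar> + \<bar>x\<bar> + \<bar>s\<bar>))" if "t \<in> {r..x}" for n t r x
  proof -
    have "growth Z * \<bar>t - s\<bar> \<le> growth Z * (\<bar>r\<bar> + \<bar>x\<bar> + \<bar>s\<bar>)"
      by (intro mult_left_mono growth_nonneg Z0) (use that in auto)
    then show ?thesis
      using bound[of n t] mult_left_mono[OF _ D0, of "exp (growth Z * \<bar>t - s\<bar>)" "exp (growth Z * (\<bar>r\<bar> + \<bar>x\<bar> + \<bar>s\<bar>))"]
      by simp
  qed
  have cont: "continuous_on A (y n)" "continuous_on A (v n)" for n A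
    using solves_continuous[OF sol] continuous_on_subset by blast+
  have Cauchy: "Cauchy (\<lambda>n. y n x)" "Cauchy (\<lambda>n. v n x)" for x
  proof -
    define J where "J = {min s x..max s x}"
    define B where "B = D * exp (growth Z * (\<bar>min s x\<bar> + \<bar>max s x\<bar> + \<bar>s\<bar>))"
    define \<delta> where "\<delta> n = norm (y n s - \<alpha>) + norm (v n s - \<beta>) + (H n + norm (z n - \<zeta>) * (B * \<bar>x - s\<bar>))" for n
    have B0: "B \<ge> 0" unfolding B_def using D0 by simp
    have "\<delta> \<longlonglongrightarrow> norm (\<alpha> - \<alpha>) + norm (\<beta> - \<beta>) + (0 + norm (\<zeta> - \<zeta>) * (B * \<bar>x - s\<bar>))"
      unfolding \<delta>_def by (intro tendsto_intros init H(2) z)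
    then have \<delta>: "\<delta> \<longlonglongrightarrow> 0" by simp
    have diff: "norm (y n x - y m x) + norm (v n x - v m x) \<le> exp (growth Z * \<bar>x - s\<bar>) * (\<delta> n + \<delta> m)" for n m
    proof -
      define k where "k t = h n t + (-1) * (h m t + (z n - z m) * y m t)" for t
      have k: "solves (z n) k UNIV (\<lambda>t. y n t + (-1) * y m t) (\<lambda>t. v n t + (-1) * v m t)"
        unfolding k_def by (rule solves_add_cmult[OF sol solves_change_parameter[OF sol]])
      have hi: "(\<lambda>t. norm (h j t)) integrable_on {r..e}" for j r e
        by (rule solves_inhom_integrable(2)[OF sol]) auto
      have "integral J (\<lambda>t. norm (k t)) \<le>
          integral J (\<lambda>t. (norm (h n t) + norm (h m t)) + norm (z n - z m) * B)"
        unfolding J_def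
      proof (rule integral_le)
        show "(\<lambda>t. norm (k t)) integrable_on {min s x..max s x}"
          by (rule solves_inhom_integrable(2)[OF k]) auto
        show "(\<lambda>t. norm (h n t) + norm (h m t) + norm (z n - z m) * B) integrable_on {min s x..max s x}"
          by (intro integrable_add hi integrable_const_ivl)
        fix t assume t: "t \<in> {min s x..max s x}"
        have "norm (y m t) \<le> B"
          using unif[OF t, of m] norm_ge_zero[of "v m t"] unfolding B_def by linarith
        then have "norm ((z n - z m) * y m t) \<le> norm (z n - z m) * B"
          unfolding norm_mult by (rule mult_left_mono) simp
        moreover have "k t = h n t - (h m t + (z n - z m) * y m t)"
          by (simp add: k_def)
        then have "norm (k t) \<le> norm (h n t) + (norm (h m t) + norm ((z n - z m) * y m t))"
          using norm_triangle_ineq4[of "h n t" "h m t + (z n - z m) * y m t"]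
            norm_triangle_ineq[of "h m t" "(z n - z m) * y m t"] by simp
        ultimately show "norm (k t) \<le> norm (h n t) + norm (h m t) + norm (z n - z m) * B" by simp
      qed
      also have "\<dots> = integral J (\<lambda>t. norm (h n t)) + integral J (\<lambda>t. norm (h m t)) + norm (z n - z m) * B * \<bar>x - s\<bar>"
      proof -
        have "measure lborel J = \<bar>x - s\<bar>" unfolding J_def by (simp add: min_def max_def)
        then show ?thesis
          unfolding J_def
          by (simp add: Henstock_Kurzweil_Integration.integral_add integrable_add hi integrable_const_ivl mult.commute)
      qed
      also have "\<dots> \<le> H n + H m + (norm (z n - \<zeta>) + norm (z m - \<zeta>)) * (B * \<bar>x - s\<bar>)"
      proof -
        have "norm (z n - z m) \<le> norm (z n - \<zeta>) + norm (z m - \<zeta>)"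
          by (rule norm_triangle_ineq4[of "z n - \<zeta>" "z m - \<zeta>", simplified])
        then have "norm (z n - z m) * (B * \<bar>x - s\<bar>) \<le> (norm (z n - \<zeta>) + norm (z m - \<zeta>)) * (B * \<bar>x - s\<bar>)"
          using B0 by (intro mult_right_mono) auto
        then show ?thesis using H(1)[where n = n] H(1)[where n = m]
          unfolding J_def by (smt (verit) mult.assoc)
      qed
      finally have "norm (y n x + (-1) * y m x) + norm (v n x + (-1) * v m x) \<le>
        (norm (y n s + (-1) * y m s) + norm (v n s + (-1) * v m s) +
          (H n + H m + (norm (z n - \<zeta>) + norm (z m - \<zeta>)) * (B * \<bar>x - s\<bar>))) * exp (growth Z * \<bar>x - s\<bar>)"
        unfolding J_def by (intro solves_bound[OF k] Z) auto
      also have "\<dots> \<le> (\<delta> n + \<delta> m) * exp (growth Z * \<bar>x - s\<bar>)"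
      proof (rule mult_right_mono)
        have "norm (y n s - y m s) \<le> norm (y n s - \<alpha>) + norm (y m s - \<alpha>)"
          "norm (v n s - v m s) \<le> norm (v n s - \<beta>) + norm (v m s - \<beta>)"
          by (rule norm_triangle_ineq4[of "y n s - \<alpha>" "y m s - \<alpha>", simplified]
              norm_triangle_ineq4[of "v n s - \<beta>" "v m s - \<beta>", simplified])+
        then show "norm (y n s + (-1) * y m s) + norm (v n s + (-1) * v m s) +
          (H n + H m + (norm (z n - \<zeta>) + norm (z m - \<zeta>)) * (B * \<bar>x - s\<bar>)) \<le> \<delta> n + \<delta> m"
          unfolding \<delta>_def by (simp add: distrib_right)
      qed simp
      finally show ?thesis by (simp add: mult.commute)
    qed
    have d1: "norm (y n x - y m x) \<le> exp (growth Z * \<bar>x - s\<bar>) * (\<delta> n + \<delta> m)"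
      and d2: "norm (v n x - v m x) \<le> exp (growth Z * \<bar>x - s\<bar>) * (\<delta> n + \<delta> m)" for n m
      using diff[of n m] norm_ge_zero[of "y n x - y m x"] norm_ge_zero[of "v n x - v m x"] by linarith+
    show "Cauchy (\<lambda>n. y n x)" "Cauchy (\<lambda>n. v n x)"
      by (rule Cauchy_of_null_bound[OF d1 \<delta>], rule Cauchy_of_null_bound[OF d2 \<delta>])
  qed
  define y' where "y' x = lim (\<lambda>n. y n x)" for x
  define v' where "v' x = lim (\<lambda>n. v n x)" for x
  have y': "(\<lambda>n. y n x) \<longlonglongrightarrow> y' x" and v': "(\<lambda>n. v n x) \<longlonglongrightarrow> v' x" for x
    unfolding y'_def v'_def using Cauchy[of x]
    by (simp_all add: Cauchy_convergent convergent_LIMSEQ_iff[symmetric])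
  have p0: "complex_of_real (p t) \<noteq> 0" for t using p_pos[of t] by simp
  have "solves \<zeta> (\<lambda>_. 0) UNIV y' v'"
    unfolding solves_def primitive_on_def
  proof (intro conjI ballI impI)
    fix r x :: real assume "r \<le> x"
    define B where "B = D * exp (growth Z * (\<bar>r\<bar> + \<bar>x\<bar> + \<bar>s\<bar>))"
    have B: "norm (y n t) \<le> B" "norm (v n t) \<le> B" if "t \<in> {r..x}" for n t
      using unif[OF that, of n] norm_ge_zero[of "y n t"] norm_ge_zero[of "v n t"] unfolding B_def by linarith+
    have B': "norm (y' t) \<le> B" "norm (v' t) \<le> B" if "t \<in> {r..x}" for t
      using B[OF that] by (auto intro!: LIMSEQ_le_const2[OF tendsto_norm[OF y']] LIMSEQ_le_const2[OF tendsto_norm[OF v']])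
    have 1: "norm (w / of_real (p t)) \<le> B / p0" if "norm w \<le> B" for w :: complex and t
    proof -
      have "norm w / \<bar>p t\<bar> \<le> B / p0"
        using that p_ge[of t] p0_pos by (intro frac_le) (auto intro: order_trans[OF norm_ge_zero])
      then show ?thesis by (simp add: norm_divide)
    qed
    have 2: "norm ((of_real (q t) - c) * w) \<le> (q_bound + Z) * B" if "norm c \<le> Z" "norm w \<le> B" for w c :: complex and t
    proof -
      have "norm (of_real (q t) - c) \<le> q_bound + Z"
        using norm_triangle_ineq4[of "complex_of_real (q t)" c] q_bound[of t] that by simp
      then show ?thesis unfolding norm_mult using that q_bound_nonneg Z0 by (intro mult_mono) auto
    qed
    have \<zeta>: "norm \<zeta> \<le> Z" using Z by (auto intro!: LIMSEQ_le_const2[OF tendsto_norm[OF z]])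
    have i1: "(\<lambda>t. v n t / of_real (p t)) integrable_on {r..x}" for n
      using divide_p_absolutely_integrable[OF cont(2)] absolutely_integrable_on_def by blast
    have i2: "(\<lambda>t. (of_real (q t) - z n) * y n t) integrable_on {r..x}" for n
      using q_minus_z_mult_absolutely_integrable[OF cont(1)] absolutely_integrable_on_def by blast
    note c1 = dominated_convergence[of "\<lambda>n t. v n t / of_real (p t)" "{r..x}" "\<lambda>_. B / p0"
        "\<lambda>t. v' t / of_real (p t)", OF i1 integrable_const_ivl 1[OF B(2)] tendsto_divide[OF v' tendsto_const p0]]
    note c2 = dominated_convergence[of "\<lambda>n t. (of_real (q t) - z n) * y n t" "{r..x}" "\<lambda>_. (q_bound + Z) * B"
        "\<lambda>t. (of_real (q t) - \<zeta>) * y' t", OF i2 integrable_const_ivl 2[OF Z B(1)]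
        tendsto_mult[OF tendsto_diff[OF tendsto_const z] y']]
    show "(\<lambda>t. v' t / of_real (p t)) absolutely_integrable_on {r..x}"
      by (rule absolutely_integrable_integrable_bound[OF 1[OF B'(2)] c1(1) integrable_const_ivl])
    show "(\<lambda>t. (of_real (q t) - \<zeta>) * y' t + 0) absolutely_integrable_on {r..x}"
      using absolutely_integrable_integrable_bound[OF 2[OF \<zeta> B'(1)] c2(1) integrable_const_ivl] by simp
    have e1: "integral {r..x} (\<lambda>t. v n t / of_real (p t)) = y n x - y n r" for n
      using sol[of n] \<open>r \<le> x\<close> unfolding solves_def by (auto dest: primitive_onD(3))
    have "(\<lambda>n. y n x - y n r) \<longlonglongrightarrow> y' x - y' r" by (intro tendsto_intros y')
    then have "integral {r..x} (\<lambda>t. v' t / of_real (p t)) = y' x - y' r"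
      using c1(2) unfolding e1 by (blast intro: LIMSEQ_unique)
    with c1(1) show "((\<lambda>t. v' t / of_real (p t)) has_integral y' x - y' r) {r..x}"
      by (simp add: has_integral_iff)
    have e2: "integral {r..x} (\<lambda>t. (of_real (q t) - z n) * y n t) = (v n x - v n r) - integral {r..x} (h n)" for n
    proof -
      have "h n integrable_on {r..x}"
        using solves_inhom_integrable(1)[OF sol, of r x n] absolutely_integrable_on_def by auto
      moreover have "integral {r..x} (\<lambda>t. (of_real (q t) - z n) * y n t + h n t) = v n x - v n r"
        using sol[of n] \<open>r \<le> x\<close> unfolding solves_def by (auto dest: primitive_onD(3))
      ultimately show ?thesis
        using Henstock_Kurzweil_Integration.integral_add[OF i2, of "h n" n] by (simp add: algebra_simps)
    qed
    have "(\<lambda>n. integral {r..x} (h n)) \<longlonglongrightarrow> 0"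
    proof (rule Lim_null_comparison[OF _ H(2)], rule always_eventually, rule allI)
      fix n
      have "h n integrable_on {r..x}" "(\<lambda>t. norm (h n t)) integrable_on {r..x}"
        using solves_inhom_integrable[OF sol, of r x n] absolutely_integrable_on_def by auto
      then have "norm (integral {r..x} (h n)) \<le> integral {r..x} (\<lambda>t. norm (h n t))"
        by (intro integral_norm_bound_integral) auto
      then show "norm (integral {r..x} (h n)) \<le> H n" using H(1)[of r x n] by linarith
    qed
    then have "(\<lambda>n. (v n x - v n r) - integral {r..x} (h n)) \<longlonglongrightarrow> (v' x - v' r) - 0"
      by (intro tendsto_intros v')
    then have "integral {r..x} (\<lambda>t. (of_real (q t) - \<zeta>) * y' t) = v' x - v' r"
      using c2(2) unfolding e2 by (auto intro: LIMSEQ_unique)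
    with c2(1) show "((\<lambda>t. (of_real (q t) - \<zeta>) * y' t + 0) has_integral v' x - v' r) {r..x}"
      by (simp add: has_integral_iff)
  qed
  then show ?thesis
  proof (rule that[OF _ y' v'])
    show "\<exists>B\<ge>0. \<forall>n. \<forall>t\<in>{r..x}. norm (y n t) + norm (v n t) \<le> B" for r x
      using unif D0 by (intro exI[of _ "D * exp (growth Z * (\<bar>r\<bar> + \<bar>x\<bar> + \<bar>s\<bar>))"]) auto
  qed
qed

text \<open>The translation \<open>\<tau>\<close> is \<open>1\<close> on a right half-line and \<open>- 1\<close> on a left one. The constant Wronskian \<open>w\<close>
  of the solution and its translate is bounded on each period by the local \<open>L\<^sub>2\<close> norms of the
  solution, which tend to zero; so \<open>w = 0\<close> and translation multiplies the solution by some \<open>\<rho>\<close>. The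
  local norms then form a geometric sequence with ratio \<open>\<bar>\<rho>\<bar>\<^sup>2\<close>, which tends to zero only if
  \<open>\<bar>\<rho>\<bar> < 1\<close>.\<close>

lemma decaying_solution_multiplier:
  assumes sol: "solves z (\<lambda>_. 0) I y v" and I: "is_interval I"
    and \<tau>: "\<And>x. x \<in> I \<Longrightarrow> x + of_int \<tau> \<in> I" and c: "{c..c + 1} \<subseteq> I"
    and ne: "y c \<noteq> 0 \<or> v c \<noteq> 0"
    and decay: "(\<lambda>k. integral {c..c + 1} (\<lambda>x. (norm (y (x + of_int (\<tau> * int k))))\<^sup>2 +
        (norm (v (x + of_int (\<tau> * int k))))\<^sup>2)) \<longlonglongrightarrow> 0"
  obtains \<rho> where "norm \<rho> < 1" "\<And>x. x \<in> I \<Longrightarrow> y (x + of_int \<tau>) = \<rho> * y x"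
    "\<And>x. x \<in> I \<Longrightarrow> v (x + of_int \<tau>) = \<rho> * v x"
proof -
  have \<tau>k: "x + of_int (\<tau> * int k) \<in> I" if "x \<in> I" for x k
  proof (induction k)
    case (Suc k)
    then show ?case using \<tau>[of "x + of_int (\<tau> * int k)"] by (simp add: algebra_simps)
  qed (use that in simp)
  have cI: "c \<in> I" using c by auto
  define N where "N x = (norm (y x))\<^sup>2 + (norm (v x))\<^sup>2" for x
  define E where "E k = integral {c..c + 1} (\<lambda>x. N (x + of_int (\<tau> * int k)))" for k
  have E: "E \<longlonglongrightarrow> 0" using decay unfolding E_def[abs_def] N_def .
  have Nc: "continuous_on I N"
    unfolding N_def by (intro continuous_intros solves_continuous[OF sol I])
  have Ni: "(\<lambda>x. N (x + of_int (\<tau> * int k))) integrable_on {c..c + 1}" for k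
  proof (rule integrable_continuous_interval, rule continuous_on_compose2[OF Nc])
    show "(\<lambda>x. x + of_int (\<tau> * int k)) ` {c..c + 1} \<subseteq> I"
      using c by (intro image_subsetI \<tau>k) auto
  qed (intro continuous_intros)
  have sol': "solves z (\<lambda>_. 0) I (\<lambda>x. y (x + of_int \<tau>)) (\<lambda>x. v (x + of_int \<tau>))"
    by (rule solves_subset[OF solves_shift[OF sol]]) (use \<tau> in auto)
  define w where "w = wronskian y v (\<lambda>x. y (x + of_int \<tau>)) (\<lambda>x. v (x + of_int \<tau>)) c"
  have w: "norm w \<le> N x + N (x + of_int \<tau>)" if "x \<in> I" for x
  proof -
    have "w = y x * v (x + of_int \<tau>) - v x * y (x + of_int \<tau>)"
      using wronskian_constant[OF sol sol' I cI that] unfolding w_def by (simp add: wronskian_def)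
    then have "norm w \<le> norm (y x) * norm (v (x + of_int \<tau>)) + norm (v x) * norm (y (x + of_int \<tau>))"
      using norm_triangle_ineq4 by (metis norm_mult)
    moreover have "a * b \<le> a\<^sup>2 + b\<^sup>2" for a b :: real
      using sum_squares_bound[of a b] zero_le_power2[of a] zero_le_power2[of b] by linarith
    from add_mono[OF this this] have "norm (y x) * norm (v (x + of_int \<tau>)) + norm (v x) * norm (y (x + of_int \<tau>))
       \<le> ((norm (y x))\<^sup>2 + (norm (v (x + of_int \<tau>)))\<^sup>2) + ((norm (v x))\<^sup>2 + (norm (y (x + of_int \<tau>)))\<^sup>2)" .
    ultimately show ?thesis unfolding N_def by linarith
  qed
  have wE: "norm w \<le> E k + E (Suc k)" for k
  proof -
    have "norm w = integral {c..c + 1} (\<lambda>_. norm w)" by simp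
    also have "\<dots> \<le> integral {c..c + 1} (\<lambda>x. N (x + of_int (\<tau> * int k)) + N (x + of_int (\<tau> * int (Suc k))))"
    proof (rule integral_le)
      fix x assume "x \<in> {c..c + 1}"
      then have "x + of_int (\<tau> * int k) \<in> I" using c \<tau>k by auto
      from w[OF this] show "norm w \<le> N (x + of_int (\<tau> * int k)) + N (x + of_int (\<tau> * int (Suc k)))"
        by (simp add: algebra_simps)
    qed (intro integrable_const_ivl integrable_add Ni)+
    also have "\<dots> = E k + E (Suc k)"
      unfolding E_def by (intro Henstock_Kurzweil_Integration.integral_add Ni)
    finally show ?thesis .
  qed
  have "(\<lambda>k. E k + E (Suc k)) \<longlonglongrightarrow> 0 + 0"
    by (intro tendsto_add E LIMSEQ_Suc)
  then have "norm w \<le> 0 + 0"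
    by (rule LIMSEQ_le_const) (use wE in auto)
  then have w0: "wronskian y v (\<lambda>x. y (x + of_int \<tau>)) (\<lambda>x. v (x + of_int \<tau>)) c = 0"
    by (simp add: w_def)
  obtain \<rho> where \<rho>: "\<And>x. x \<in> I \<Longrightarrow> y (x + of_int \<tau>) = \<rho> * y x" "\<And>x. x \<in> I \<Longrightarrow> v (x + of_int \<tau>) = \<rho> * v x"
    using wronskian_zero_imp_proportional[OF sol sol' I cI ne w0] by blast
  have N\<rho>: "N (x + of_int (\<tau> * int k)) = ((norm \<rho>)\<^sup>2) ^ k * N x" if "x \<in> I" for x k
  proof (induction k)
    case (Suc k)
    have "N (x + of_int (\<tau> * int (Suc k))) = N (x + of_int (\<tau> * int k) + of_int \<tau>)"
      by (simp add: algebra_simps)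
    also have "\<dots> = (norm \<rho>)\<^sup>2 * N (x + of_int (\<tau> * int k))"
      unfolding N_def \<rho>[OF \<tau>k[OF that]] by (simp add: norm_mult power_mult_distrib algebra_simps)
    finally show ?case using Suc by simp
  qed simp
  have E\<rho>: "E k = ((norm \<rho>)\<^sup>2) ^ k * E 0" for k
  proof -
    have "E k = integral {c..c + 1} (\<lambda>x. ((norm \<rho>)\<^sup>2) ^ k * N x)"
      unfolding E_def by (rule integral_cong) (use N\<rho> c in auto)
    then show ?thesis by (simp add: E_def)
  qed
  have E0: "E 0 > 0"
  proof -
    have "E 0 \<ge> 0" unfolding E_def using Ni[of 0] by (intro integral_nonneg) (auto simp: N_def)
    moreover have "E 0 \<noteq> 0"
    proof
      assume "E 0 = 0"
      then have 0: "integral {c..c + 1} N = 0" by (simp add: E_def)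
      have "integral {c..c + 1} N = 0 \<longleftrightarrow> (\<forall>x\<in>{c..c + 1}. N x = 0)"
        by (rule integral_eq_0_iff[OF continuous_on_subset[OF Nc c]]) (auto simp: N_def)
      with 0 have "N c = 0" by auto
      then show False using ne by (auto simp: N_def add_nonneg_eq_0_iff)
    qed
    ultimately show ?thesis by simp
  qed
  have "norm \<rho> < 1"
  proof (rule ccontr)
    assume "\<not> norm \<rho> < 1"
    then have "((norm \<rho>)\<^sup>2) ^ k \<ge> 1" for k by (intro one_le_power) simp
    then have "E 0 \<le> E k" for k using E\<rho>[of k] E0 mult_right_mono[of 1 "((norm \<rho>)\<^sup>2) ^ k" "E 0"] by simp
    then have "E 0 \<le> 0" by (intro LIMSEQ_le_const[OF E]) auto
    then show False using E0 by simp
  qed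
  then show ?thesis using \<rho> by (rule that)
qed

end

section \<open>Eigenfunctions as solutions of the first-order system\<close>

lemma L2_space_restrict:
  assumes "u \<in> L2_space UNIV" "S \<in> sets lebesgue"
  shows "u \<in> L2_space S"
proof -
  have "u \<in> borel_measurable lebesgue" "integrable lebesgue (\<lambda>x. (norm (u x))\<^sup>2)"
    using assms(1) by (simp_all add: L2_space_def lebesgue_on_UNIV_eq)
  then show ?thesis
    using assms(2) integrable_mult_indicator[of S lebesgue "\<lambda>x. (norm (u x))\<^sup>2"] unfolding L2_space_def
    by (auto intro: measurable_restrict_space1 simp: integrable_restrict_space)
qed

lemma L2_space_AE_cong:
  assumes "u \<in> L2_space S" "AE x in lebesgue. x \<in> S \<longrightarrow> u x = y x" "y \<in> borel_measurable (lebesgue_on S)"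
    "S \<in> sets lebesgue"
  shows "y \<in> L2_space S"
proof -
  have "AE x in lebesgue_on S. (norm (u x))\<^sup>2 = (norm (y x))\<^sup>2"
    using assms(2) AE_lebesgue_on_iff[OF assms(4)] by auto
  then show ?thesis
    using assms(1,3) integrable_cong_AE[of "\<lambda>x. (norm (u x))\<^sup>2" "lebesgue_on S" "\<lambda>x. (norm (y x))\<^sup>2"]
    unfolding L2_space_def by auto
qed

lemma L2_norm_nonneg: "L2_norm S u \<ge> 0"
  unfolding L2_norm_def by simp

lemma L2_norm_square: "(L2_norm S u)\<^sup>2 = (LINT x|lebesgue_on S. (norm (u x))\<^sup>2)"
  unfolding L2_norm_def by simp

lemma L2_norm_le_AE:
  assumes "u \<in> borel_measurable (lebesgue_on S)" "integrable (lebesgue_on S) g" "S \<in> sets lebesgue"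
    and "AE x in lebesgue. x \<in> S \<longrightarrow> (norm (u x))\<^sup>2 \<le> g x"
  shows "(L2_norm S u)\<^sup>2 \<le> integral\<^sup>L (lebesgue_on S) g"
proof -
  have ae: "AE x in lebesgue_on S. (norm (u x))\<^sup>2 \<le> g x"
    using assms(4) AE_lebesgue_on_iff[OF assms(3)] by auto
  then have "integrable (lebesgue_on S) (\<lambda>x. (norm (u x))\<^sup>2)"
    using assms(1) by (intro Bochner_Integration.integrable_bound[OF assms(2)]) auto
  then show ?thesis unfolding L2_norm_square by (rule integral_mono_AE[OF _ assms(2) ae])
qed

lemma L2_norm_cong_AE:
  assumes "AE x in lebesgue. x \<in> S \<longrightarrow> u x = v x" "S \<in> sets lebesgue"
    "u \<in> borel_measurable (lebesgue_on S)" "v \<in> borel_measurable (lebesgue_on S)"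
  shows "L2_norm S u = L2_norm S v"
  unfolding L2_norm_def using assms AE_lebesgue_on_iff[OF assms(2)]
  by (intro arg_cong[where f = sqrt] integral_cong_AE) auto

lemma borel_measurable_lebesgue_on_AE:
  fixes f g :: "real \<Rightarrow> complex"
  assumes "f \<in> borel_measurable (lebesgue_on S)" "AE x in lebesgue. x \<in> S \<longrightarrow> f x = g x" "S \<in> sets lebesgue"
  shows "g \<in> borel_measurable (lebesgue_on S)"
proof -
  have "(\<lambda>x. if x \<in> S then f x else 0) \<in> borel_measurable lebesgue"
    using assms(1,3) borel_measurable_if by blast
  moreover have "AE x in lebesgue. (if x \<in> S then f x else 0) = (if x \<in> S then g x else 0)"
    using assms(2) by eventually_elim auto
  ultimately have "(\<lambda>x. if x \<in> S then g x else 0) \<in> borel_measurable lebesgue"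
    by (rule borel_measurable_AE)
  then show ?thesis by (rule borel_measurable_if_D)
qed

lemma W22_spaceI:
  assumes S: "open S" "is_interval S" and u: "u \<in> L2_space S" "AE x in lebesgue. x \<in> S \<longrightarrow> u x = y x"
    and P: "primitive_on S y y1" "primitive_on S y1 w" and L2: "y1 \<in> L2_space S" "w \<in> L2_space S"
  shows "u \<in> W22_space S"
  unfolding W22_space_def using u L2 has_weak_deriv_primitive_on[OF S P(1) u(2), of y1]
    has_weak_deriv_primitive_on[OF S P(2), of y1 w] by auto

lemma W22_norm_square:
  assumes S: "open S" "is_interval S" and u: "u \<in> L2_space S" "AE x in lebesgue. x \<in> S \<longrightarrow> u x = y x"
    and P: "primitive_on S y y1" "primitive_on S y1 w" and L2: "y1 \<in> L2_space S" "w \<in> L2_space S"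
  shows "(W22_norm S u)\<^sup>2 = (L2_norm S y)\<^sup>2 + (L2_norm S y1)\<^sup>2 + (L2_norm S w)\<^sup>2"
proof -
  have Sl: "S \<in> sets lebesgue" using S(1) by auto
  have d1: "AE x in lebesgue. x \<in> S \<longrightarrow> wderiv S u x = y1 x"
    by (rule wderiv_primitive_on[OF S P(1) u(2)])
  have d2: "AE x in lebesgue. x \<in> S \<longrightarrow> wderiv S (wderiv S u) x = w x"
    by (rule wderiv_primitive_on[OF S P(2) d1])
  have *: "L2_norm S f = L2_norm S g" if "AE x in lebesgue. x \<in> S \<longrightarrow> f x = g x" "g \<in> borel_measurable (lebesgue_on S)"
    for f g
  proof (rule L2_norm_cong_AE[OF that(1) Sl _ that(2)])
    show "f \<in> borel_measurable (lebesgue_on S)"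
      by (rule borel_measurable_lebesgue_on_AE[OF that(2) _ Sl]) (use that(1) in eventually_elim, auto)
  qed
  have "y \<in> borel_measurable (lebesgue_on S)"
    by (rule borel_measurable_lebesgue_on_AE[OF _ u(2) Sl]) (use u(1) in \<open>simp add: L2_space_def\<close>)
  then show ?thesis
    using *[OF u(2)] *[OF d1] *[OF d2] L2 unfolding W22_norm_def L2_space_def by simp
qed

text \<open>The Cauchy--Schwarz inequality, in the form that the variance of \<open>\<bar>u\<bar>\<close> is nonnegative.\<close>

lemma integral_norm_le_L2_norm:
  assumes u: "u \<in> L2_space {a<..<b}" and "a < b"
  shows "integrable (lebesgue_on {a<..<b}) (\<lambda>x. norm (u x))"
    "(LINT x|lebesgue_on {a<..<b}. norm (u x)) \<le> sqrt (b - a) * L2_norm {a<..<b} u"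
proof -
  let ?M = "lebesgue_on {a<..<b}"
  have meas: "u \<in> borel_measurable ?M" and sq: "integrable ?M (\<lambda>x. (norm (u x))\<^sup>2)"
    using u by (simp_all add: L2_space_def)
  have const: "integrable ?M (\<lambda>x. c)" "integral\<^sup>L ?M (\<lambda>x. c) = c * (b - a)" for c :: real
  proof -
    have "emeasure ?M (space ?M) = ennreal (b - a)"
      using \<open>a < b\<close> by (simp add: emeasure_restrict_space)
    then show "integrable ?M (\<lambda>x. c)" by (intro finite_measure.integrable_const finite_measureI) auto
    show "integral\<^sup>L ?M (\<lambda>x. c) = c * (b - a)"
      using \<open>a < b\<close> by (simp add: measure_restrict_space)
  qed
  show int: "integrable ?M (\<lambda>x. norm (u x))"
  proof (rule Bochner_Integration.integrable_bound[OF Bochner_Integration.integrable_add[OF sq const(1)[of 1]]])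
    have "t \<le> t\<^sup>2 + 1" for t :: real
    proof -
      have "0 \<le> (t - 1 / 2) * (t - 1 / 2)" by simp
      then show ?thesis by (simp add: power2_eq_square algebra_simps)
    qed
    then show "AE x in ?M. norm (norm (u x)) \<le> norm ((norm (u x))\<^sup>2 + 1)" by simp
  qed (use meas in auto)
  define m where "m = (LINT x|?M. norm (u x))"
  define l where "l = b - a"
  have l: "l > 0" using \<open>a < b\<close> by (simp add: l_def)
  have m0: "m \<ge> 0" unfolding m_def by simp
  have "0 \<le> (LINT x|?M. (norm (u x) - m / l)\<^sup>2)" by simp
  also have "(\<lambda>x. (norm (u x) - m / l)\<^sup>2) = (\<lambda>x. ((norm (u x))\<^sup>2 - (2 * m / l) * norm (u x)) + (m / l)\<^sup>2)"
    by (auto simp: power2_diff algebra_simps)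
  also have "(LINT x|?M. ((norm (u x))\<^sup>2 - (2 * m / l) * norm (u x)) + (m / l)\<^sup>2) =
      (L2_norm {a<..<b} u)\<^sup>2 - (2 * m / l) * m + (m / l)\<^sup>2 * l"
    using sq int const unfolding L2_norm_square m_def l_def
    by (subst Bochner_Integration.integral_add) auto
  finally have "m\<^sup>2 \<le> l * (L2_norm {a<..<b} u)\<^sup>2"
    using l by (simp add: field_simps power2_eq_square)
  then have "m\<^sup>2 \<le> (sqrt l * L2_norm {a<..<b} u)\<^sup>2"
    using l by (simp add: power_mult_distrib)
  then show "m \<le> sqrt (b - a) * L2_norm {a<..<b} u"
    unfolding l_def by (rule power2_le_imp_le) (use \<open>a < b\<close> L2_norm_nonneg in auto)
qed

context periodic_problem
begin

definition dp :: "real \<Rightarrow> real" where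
  "dp = (SOME p'. p' \<in> borel_measurable borel \<and> (\<forall>a b. bounded (p' ` {a..b})) \<and>
    primitive_on UNIV (\<lambda>x. of_real (p x)) (\<lambda>x. of_real (p' x)) \<and>
    primitive_on UNIV (\<lambda>x. of_real (1 / p x)) (\<lambda>x. of_real (- p' x / (p x)\<^sup>2)))"

lemma dp: "dp \<in> borel_measurable borel" "bounded (dp ` {a..b})"
    "primitive_on UNIV (\<lambda>x. of_real (p x)) (\<lambda>x. of_real (dp x))"
    "primitive_on UNIV (\<lambda>x. of_real (1 / p x)) (\<lambda>x. of_real (- dp x / (p x)\<^sup>2))"
proof -
  have "\<exists>p'. p' \<in> borel_measurable borel \<and> (\<forall>a b. bounded (p' ` {a..b})) \<and>
    primitive_on UNIV (\<lambda>x. of_real (p x)) (\<lambda>x. of_real (p' x)) \<and>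
    primitive_on UNIV (\<lambda>x. of_real (1 / p x)) (\<lambda>x. of_real (- p' x / (p x)\<^sup>2))"
  proof (rule piecewise_C1_primitives[OF p_C1 p_ge p0_pos])
    fix p' assume "p' \<in> borel_measurable borel" "\<And>a b. bounded (p' ` {a..b})"
      "primitive_on UNIV (\<lambda>x. of_real (p x)) (\<lambda>x. of_real (p' x))"
      "primitive_on UNIV (\<lambda>x. of_real (1 / p x)) (\<lambda>x. of_real (- p' x / (p x)\<^sup>2))"
    then show ?thesis by blast
  qed
  from someI_ex[OF this] show "dp \<in> borel_measurable borel" "bounded (dp ` {a..b})"
    "primitive_on UNIV (\<lambda>x. of_real (p x)) (\<lambda>x. of_real (dp x))"
    "primitive_on UNIV (\<lambda>x. of_real (1 / p x)) (\<lambda>x. of_real (- dp x / (p x)\<^sup>2))"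
    unfolding dp_def by blast+
qed

text \<open>The function \<open>y\<close> is the continuously differentiable representative of \<open>u\<close>, \<open>y1\<close> its derivative
  and \<open>w\<close> the second weak derivative. The last statement recovers \<open>w\<close> from the
  equation.\<close>

lemma W22_quasi_derivative:
  assumes S: "open S" "is_interval S" and u: "u \<in> W22_space S"
  obtains y y1 w where
    "AE x in lebesgue. x \<in> S \<longrightarrow> u x = y x"
    "primitive_on S y y1" "primitive_on S y1 w" "y1 \<in> L2_space S" "w \<in> L2_space S"
    "primitive_on S (\<lambda>t. of_real (p t) * y1 t) (\<lambda>t. of_real (q t) * y t - sturm_liouville S p q u t)"
    "AE x in lebesgue. x \<in> S \<longrightarrow>
       of_real (q x) * y x - sturm_liouville S p q u x = of_real (dp x) * y1 x + of_real (p x) * w x"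
proof -
  have Sl: "S \<in> sets lebesgue" using S(1) by auto
  obtain u1 w where u1: "u1 \<in> L2_space S" "has_weak_deriv S u u1" and w: "w \<in> L2_space S" "has_weak_deriv S u1 w"
    using u unfolding W22_space_def by blast
  obtain y where y: "primitive_on S y u1" "AE x in lebesgue. x \<in> S \<longrightarrow> u x = y x"
    by (rule has_weak_deriv_imp_primitive_on[OF S u1(2)])
  obtain y1 where y1: "primitive_on S y1 w" "AE x in lebesgue. x \<in> S \<longrightarrow> u1 x = y1 x"
    by (rule has_weak_deriv_imp_primitive_on[OF S w(2)])
  have yy1: "primitive_on S y y1"
    by (rule primitive_on_AE_cong[OF y(1) S(2)]) (use y1(2) in eventually_elim, auto)
  have "y1 \<in> borel_measurable (lebesgue_on S)"
    by (rule borel_measurable_lebesgue_on_AE[OF _ y1(2) Sl]) (use u1(1) in \<open>simp add: L2_space_def\<close>)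
  then have y1L: "y1 \<in> L2_space S"
    by (rule L2_space_AE_cong[OF u1(1) y1(2) _ Sl])
  have v: "primitive_on S (\<lambda>t. of_real (p t) * y1 t) (\<lambda>t. of_real (dp t) * y1 t + of_real (p t) * w t)"
    by (rule primitive_on_mult[OF primitive_on_subset[OF dp(3)] y1(1) S(2)]) simp
  have wd: "AE x in lebesgue. x \<in> S \<longrightarrow> wderiv S u x = y1 x"
    by (rule wderiv_primitive_on[OF S yy1 y(2)])
  have "AE x in lebesgue. x \<in> S \<longrightarrow> wderiv S (\<lambda>t. of_real (p t) * wderiv S u t) x =
      of_real (dp x) * y1 x + of_real (p x) * w x"
    by (rule wderiv_primitive_on[OF S v]) (use wd in eventually_elim, auto)
  with y(2) have ae: "AE x in lebesgue. x \<in> S \<longrightarrow>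
       of_real (q x) * y x - sturm_liouville S p q u x = of_real (dp x) * y1 x + of_real (p x) * w x"
    unfolding sturm_liouville_def by eventually_elim auto
  have "primitive_on S (\<lambda>t. of_real (p t) * y1 t) (\<lambda>t. of_real (q t) * y t - sturm_liouville S p q u t)"
    by (rule primitive_on_AE_cong[OF v S(2) ae])
  with y(2) yy1 y1(1) y1L w(1) show ?thesis using ae by (rule that)
qed

lemma eigenfunction_solves:
  assumes u: "u \<in> W22_space UNIV"
    and eq: "AE x in lebesgue. H0 p q u x + h x = z * u x"
  obtains y v w where "AE x in lebesgue. u x = y x" "solves z h UNIV y v"
    "primitive_on UNIV (\<lambda>t. v t / of_real (p t)) w"
    "y \<in> L2_space UNIV" "v \<in> L2_space UNIV" "(\<lambda>t. v t / of_real (p t)) \<in> L2_space UNIV" "w \<in> L2_space UNIV"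
    "AE x in lebesgue. (of_real (q x) - z) * y x + h x = of_real (dp x) * (v x / of_real (p x)) + of_real (p x) * w x"
proof -
  obtain y y1 w where Y: "AE x in lebesgue. x \<in> UNIV \<longrightarrow> u x = y x"
    "primitive_on UNIV y y1" "primitive_on UNIV y1 w" "y1 \<in> L2_space UNIV" "w \<in> L2_space UNIV"
    "primitive_on UNIV (\<lambda>t. of_real (p t) * y1 t) (\<lambda>t. of_real (q t) * y t - H0 p q u t)"
    "AE x in lebesgue. x \<in> UNIV \<longrightarrow>
       of_real (q x) * y x - H0 p q u x = of_real (dp x) * y1 x + of_real (p x) * w x"
    by (rule W22_quasi_derivative[OF open_UNIV is_interval_univ u])
  define v where "v t = of_real (p t) * y1 t" for t
  have y1: "v t / of_real (p t) = y1 t" for t using p_pos[of t] by (simp add: v_def)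
  have uy: "AE x in lebesgue. u x = y x" using Y(1) by simp
  have ae: "AE x in lebesgue. (of_real (q x) - z) * y x + h x = of_real (q x) * y x - H0 p q u x"
    using uy eq by eventually_elim (simp add: algebra_simps add_eq_0_iff flip: eq_diff_eq; metis add.commute add_diff_cancel_right')
  have "primitive_on UNIV v (\<lambda>t. (of_real (q t) - z) * y t + h t)"
    unfolding v_def using Y(6) by (rule primitive_on_AE_cong) (use ae in auto)
  then have sol: "solves z h UNIV y v"
    unfolding solves_def using Y(2) by (simp add: y1)
  have yL: "y \<in> L2_space UNIV"
  proof (rule L2_space_AE_cong[OF _ Y(1)])
    show "y \<in> borel_measurable (lebesgue_on UNIV)"
      using primitive_on_continuous[OF Y(2)] by (intro continuous_imp_measurable_on_sets_lebesgue) auto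
  qed (use u in \<open>auto simp: W22_space_def\<close>)
  have vL: "v \<in> L2_space UNIV"
  proof -
    have "v \<in> borel_measurable lebesgue"
      using continuous_imp_measurable_on_sets_lebesgue[OF solves_continuous(2)[OF sol]]
      by (simp add: lebesgue_on_UNIV_eq)
    moreover have "integrable lebesgue (\<lambda>x. (norm (v x))\<^sup>2)"
    proof (rule Bochner_Integration.integrable_bound[of _ "\<lambda>x. p_bound\<^sup>2 * (norm (y1 x))\<^sup>2"])
      show "integrable lebesgue (\<lambda>x. p_bound\<^sup>2 * (norm (y1 x))\<^sup>2)"
        using Y(4) by (simp add: L2_space_def lebesgue_on_UNIV_eq)
      have "(norm (v x))\<^sup>2 \<le> p_bound\<^sup>2 * (norm (y1 x))\<^sup>2" for x
        using p_bound[of x] p_pos[of x] unfolding v_def norm_mult power_mult_distrib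
        by (intro mult_right_mono power_mono) auto
      then show "AE x in lebesgue. norm ((norm (v x))\<^sup>2) \<le> norm (p_bound\<^sup>2 * (norm (y1 x))\<^sup>2)" by simp
    qed (use calculation in measurable)
    ultimately show ?thesis by (simp add: L2_space_def lebesgue_on_UNIV_eq)
  qed
  have ae': "AE x in lebesgue. (of_real (q x) - z) * y x + h x = of_real (dp x) * y1 x + of_real (p x) * w x"
    using ae Y(7) by eventually_elim simp
  show ?thesis
    by (rule that[OF uy sol _ yL vL]) (use Y ae' in \<open>simp_all add: y1\<close>)
qed

text \<open>Let \<open>N\<close> be the size of the Cauchy data at \<open>a\<close> and \<open>G = \<parallel>A u\<parallel>\<close>. Gronwall's inequality bounds \<open>y\<close> and
  \<open>v\<close> on the interval by a multiple of \<open>N + \<epsilon> G\<close>, and the equation itself then bounds the second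
  derivative. So \<open>G \<le> C \<parallel>u\<parallel> \<le> const (N + \<epsilon> G)\<close>, and for small \<open>\<epsilon>\<close> the term with \<open>G\<close> is absorbed on the left. Both
  constants depend on the operator \<open>A\<close> only through its bound \<open>C\<close>.\<close>

lemma eigenfunction_estimate:
  assumes ab: "a < b" and C: "C \<ge> 0" and Z: "Z \<ge> 0"
  shows "\<exists>M \<epsilon>0. M \<ge> 0 \<and> \<epsilon>0 > 0 \<and>
    (\<forall>\<epsilon> z A u h. 0 < \<epsilon> \<longrightarrow> \<epsilon> < \<epsilon>0 \<longrightarrow> norm z \<le> Z \<longrightarrow> bounded_operator_W22_L2 {a<..<b} C A \<longrightarrow>
       u \<in> W22_space UNIV \<longrightarrow> h = (\<lambda>x. - (of_real \<epsilon> * (if x \<in> {a<..<b} then A u x else 0))) \<longrightarrow>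
       (AE x in lebesgue. H0 p q u x + h x = z * u x) \<longrightarrow>
     (\<exists>y v. (AE x in lebesgue. u x = y x) \<and> solves z h UNIV y v \<and> y \<in> L2_space UNIV \<and> v \<in> L2_space UNIV \<and>
       A u \<in> L2_space {a<..<b} \<and> L2_norm {a<..<b} (A u) \<le> M * (norm (y a) + norm (v a)) \<and>
       (\<forall>r x. integral {r..x} (\<lambda>t. norm (h t)) \<le> \<epsilon> * M * (norm (y a) + norm (v a)))))"
proof -
  define l where "l = b - a"
  have l: "l > 0" using ab by (simp add: l_def)
  obtain P' where P': "\<And>x. x \<in> {a..b} \<Longrightarrow> \<bar>dp x\<bar> \<le> P'"
    using dp(2)[of a b] unfolding bounded_iff by (metis imageI real_norm_def)
  have P'0: "P' \<ge> 0" using P'[of a] ab by simp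
  \<comment> \<open>\<open>E\<close> is the Gronwall factor, \<open>c1\<close> bounds the second derivative in terms of the solution, and \<open>C1\<close>, \<open>C2\<close> enter the bound of the Sobolev norm.\<close>
  define E where "E = exp (growth Z * l)"
  have E: "E \<ge> 1" unfolding E_def using l growth_nonneg[OF Z] by simp
  define c1 where "c1 = (q_bound + Z + P' / p0) / p0"
  have c1: "c1 \<ge> 0" unfolding c1_def using q_bound_nonneg Z P'0 p0_pos by simp
  define C1 where "C1 = sqrt (l * (1 + (1 / p0)\<^sup>2 + 2 * c1\<^sup>2))"
  define C2 where "C2 = sqrt (2 / p0\<^sup>2)"
  have C12: "C1 \<ge> 0" "C2 \<ge> 0" unfolding C1_def C2_def using l by simp_all
  \<comment> \<open>The threshold \<open>\<epsilon>0\<close> makes the coefficient \<open>\<epsilon> k\<close> of the absorbed term at most \<open>1 / 2\<close>.\<close>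
  define k where "k = C * (C1 * E * sqrt l + C2)"
  have k: "k \<ge> 0" unfolding k_def using C C12 E l by simp
  define \<epsilon>0 where "\<epsilon>0 = 1 / (2 * (k + 1))"
  define M0 where "M0 = 2 * C * C1 * E"
  define M where "M = (1 + sqrt l) * M0"
  have M0: "M0 \<ge> 0" unfolding M0_def using C C12 E by simp
  have MM: "M \<ge> M0" "M \<ge> sqrt l * M0" "M \<ge> 0"
    unfolding M_def using M0 l by (simp_all add: distrib_right)
  have \<epsilon>0: "\<epsilon>0 > 0" unfolding \<epsilon>0_def using k by simp
  show ?thesis
  proof (rule exI[of _ M], rule exI[of _ \<epsilon>0], intro conjI MM(3) \<epsilon>0, intro allI impI)
    fix \<epsilon> z A u h
    assume \<epsilon>: "0 < \<epsilon>" "\<epsilon> < \<epsilon>0" and z: "norm z \<le> Z" and A: "bounded_operator_W22_L2 {a<..<b} C A"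
      and u: "u \<in> W22_space UNIV" and h: "h = (\<lambda>x. - (of_real \<epsilon> * (if x \<in> {a<..<b} then A u x else 0)))"
      and eq: "AE x in lebesgue. H0 p q u x + h x = z * u x"
    let ?Q = "{a<..<b}"
    obtain y v w where y: "AE x in lebesgue. u x = y x" "solves z h UNIV y v"
      "primitive_on UNIV (\<lambda>t. v t / of_real (p t)) w"
      "y \<in> L2_space UNIV" "v \<in> L2_space UNIV" "(\<lambda>t. v t / of_real (p t)) \<in> L2_space UNIV" "w \<in> L2_space UNIV"
      "AE x in lebesgue. (of_real (q x) - z) * y x + h x = of_real (dp x) * (v x / of_real (p x)) + of_real (p x) * w x"
      by (rule eigenfunction_solves[OF u eq])
    define N where "N = norm (y a) + norm (v a)"
    define G where "G = L2_norm ?Q (A u)"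
    have Q: "open ?Q" "is_interval ?Q" "?Q \<in> sets lebesgue" by (auto simp: is_interval_oo)
    have L2Q: "y \<in> L2_space ?Q" "(\<lambda>t. v t / of_real (p t)) \<in> L2_space ?Q" "w \<in> L2_space ?Q"
      "u \<in> L2_space ?Q"
      using L2_space_restrict[OF _ Q(3)] y u by (auto simp: W22_space_def)
    have uy: "AE x in lebesgue. x \<in> ?Q \<longrightarrow> u x = y x" using y(1) by eventually_elim simp
    have prQ: "primitive_on ?Q y (\<lambda>t. v t / of_real (p t))" "primitive_on ?Q (\<lambda>t. v t / of_real (p t)) w"
      using y(2,3) primitive_on_subset unfolding solves_def by blast+
    have uW: "u \<in> W22_space ?Q"
      by (rule W22_spaceI[OF Q(1,2) L2Q(4) uy prQ L2Q(2,3)])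
    have W: "(W22_norm ?Q u)\<^sup>2 = (L2_norm ?Q y)\<^sup>2 + (L2_norm ?Q (\<lambda>t. v t / of_real (p t)))\<^sup>2 + (L2_norm ?Q w)\<^sup>2"
      by (rule W22_norm_square[OF Q(1,2) L2Q(4) uy prQ L2Q(2,3)])
    have Au: "A u \<in> L2_space ?Q" and GW: "G \<le> C * W22_norm ?Q u"
      using A uW unfolding bounded_operator_W22_L2_def G_def by auto
    have G0: "G \<ge> 0" unfolding G_def by (rule L2_norm_nonneg)
    have N0: "N \<ge> 0" by (simp add: N_def)
    have hint: "integral {r..x} (\<lambda>t. norm (h t)) \<le> \<epsilon> * (sqrt l * G)" for r x
    proof -
      have "integral {r..x} (\<lambda>t. norm (h t)) \<le> integral {min r a..max x b} (\<lambda>t. norm (h t))"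
        by (cases "r \<le> x") (auto intro!: integral_subset_le solves_inhom_integrable(2)[OF y(2)] integral_nonneg)
      also have "\<dots> = integral ?Q (\<lambda>t. norm (h t))"
        by (rule integral_zero_outside) (auto simp: h)
      also have "\<dots> = integral ?Q (\<lambda>t. \<epsilon> * norm (A u t))"
        by (rule integral_cong) (use \<epsilon> in \<open>auto simp: h norm_mult\<close>)
      also have "\<dots> = \<epsilon> * integral ?Q (\<lambda>t. norm (A u t))" by simp
      also have "integral ?Q (\<lambda>t. norm (A u t)) = (LINT t|lebesgue_on ?Q. norm (A u t))"
        by (rule lebesgue_integral_eq_integral[symmetric, OF integral_norm_le_L2_norm(1)[OF Au ab] Q(3)])
      also have "\<dots> \<le> sqrt l * G"
        unfolding l_def G_def by (rule integral_norm_le_L2_norm(2)[OF Au ab])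
      finally show ?thesis using \<epsilon> by simp
    qed
    define S where "S = (N + \<epsilon> * (sqrt l * G)) * E"
    have S0: "S \<ge> 0" unfolding S_def using N0 \<epsilon> G0 l E by simp
    have S: "norm (y x) + norm (v x) \<le> S" if x: "x \<in> ?Q" for x
    proof -
      have "norm (y x) + norm (v x) \<le> (N + \<epsilon> * (sqrt l * G)) * exp (growth Z * \<bar>x - a\<bar>)"
        unfolding N_def by (rule solves_bound[OF y(2) _ _ _ z hint]) auto
      also have "\<dots> \<le> S"
        unfolding S_def E_def using x growth_nonneg[OF Z] N0 \<epsilon> G0 l
        by (intro mult_left_mono) (auto simp: l_def intro!: mult_left_mono)
      finally show ?thesis .
    qed
    have Sv: "norm (v x) \<le> S" and Sy: "norm (y x) \<le> S" if "x \<in> ?Q" for x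
      using S[OF that] norm_ge_zero[of "y x"] norm_ge_zero[of "v x"] by linarith+
    have vp: "norm (v x / of_real (p x)) \<le> (1 / p0) * norm (v x)" for x
      using p_ge[of x] p0_pos frac_le[of "norm (v x)" "norm (v x)" p0 "p x"] by (simp add: norm_divide)
    have const: "integrable (lebesgue_on ?Q) (\<lambda>x. c)" "integral\<^sup>L (lebesgue_on ?Q) (\<lambda>x. c) = l * c" for c :: real
      using ab by (auto simp: l_def measure_restrict_space emeasure_restrict_space intro!: finite_measure.integrable_const finite_measureI)
    have n1: "(L2_norm ?Q y)\<^sup>2 \<le> l * S\<^sup>2"
    proof -
      have "(L2_norm ?Q y)\<^sup>2 \<le> (LINT x|lebesgue_on ?Q. S\<^sup>2)"
      proof (rule L2_norm_le_AE[OF _ const(1) Q(3)])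
        have "(norm (y x))\<^sup>2 \<le> S\<^sup>2" if "x \<in> ?Q" for x
          using Sy[OF that] by (intro power_mono) auto
        then show "AE x in lebesgue. x \<in> ?Q \<longrightarrow> (norm (y x))\<^sup>2 \<le> S\<^sup>2" by simp
      qed (use L2Q in \<open>simp add: L2_space_def\<close>)
      then show ?thesis by (simp only: const)
    qed
    have n2: "(L2_norm ?Q (\<lambda>t. v t / of_real (p t)))\<^sup>2 \<le> l * ((1 / p0)\<^sup>2 * S\<^sup>2)"
    proof -
      have "(L2_norm ?Q (\<lambda>t. v t / of_real (p t)))\<^sup>2 \<le> (LINT x|lebesgue_on ?Q. (1 / p0)\<^sup>2 * S\<^sup>2)"
      proof (rule L2_norm_le_AE[OF _ const(1) Q(3)])
        have "(norm (v x / of_real (p x)))\<^sup>2 \<le> ((1 / p0) * S)\<^sup>2" if "x \<in> ?Q" for x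
        proof (rule power_mono)
          have "(1 / p0) * norm (v x) \<le> (1 / p0) * S"
            using Sv[OF that] p0_pos by (intro mult_left_mono) auto
          with vp[of x] show "norm (v x / of_real (p x)) \<le> (1 / p0) * S" by linarith
        qed simp
        then show "AE x in lebesgue. x \<in> ?Q \<longrightarrow> (norm (v x / of_real (p x)))\<^sup>2 \<le> (1 / p0)\<^sup>2 * S\<^sup>2"
          unfolding power_mult_distrib by simp
      qed (use L2Q in \<open>simp add: L2_space_def\<close>)
      then show ?thesis by (simp only: const)
    qed
    have n3: "(L2_norm ?Q w)\<^sup>2 \<le> l * (2 * c1\<^sup>2 * S\<^sup>2) + (2 / p0\<^sup>2) * (\<epsilon>\<^sup>2 * G\<^sup>2)"
    proof -
      have Ai: "integrable (lebesgue_on ?Q) (\<lambda>x. (norm (A u x))\<^sup>2)"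
        using Au by (simp add: L2_space_def)
      have "(L2_norm ?Q w)\<^sup>2 \<le> (LINT x|lebesgue_on ?Q. 2 * c1\<^sup>2 * S\<^sup>2 + (2 / p0\<^sup>2 * \<epsilon>\<^sup>2) * (norm (A u x))\<^sup>2)"
      proof (rule L2_norm_le_AE[OF _ _ Q(3)])
        show "AE x in lebesgue. x \<in> ?Q \<longrightarrow> (norm (w x))\<^sup>2 \<le> 2 * c1\<^sup>2 * S\<^sup>2 + (2 / p0\<^sup>2 * \<epsilon>\<^sup>2) * (norm (A u x))\<^sup>2"
          using y(8)
        proof eventually_elim
          case (elim x)
          show ?case
          proof
            assume x: "x \<in> ?Q"
            have nz: "norm (of_real (q x) - z) \<le> q_bound + Z"
              using norm_triangle_ineq4[of "complex_of_real (q x)" z] q_bound[of x] z by simp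
            have "of_real (p x) * w x = ((of_real (q x) - z) * y x - of_real (dp x) * (v x / of_real (p x))) + h x"
              using elim by (simp add: algebra_simps)
            then have "norm (of_real (p x) * w x) \<le> norm ((of_real (q x) - z) * y x - of_real (dp x) * (v x / of_real (p x))) + norm (h x)"
              using norm_triangle_ineq by metis
            also have "\<dots> \<le> (norm ((of_real (q x) - z) * y x) + norm (of_real (dp x) * (v x / of_real (p x)))) + norm (h x)"
              by (intro add_right_mono norm_triangle_ineq4)
            also have "norm ((of_real (q x) - z) * y x) \<le> (q_bound + Z) * S"
              unfolding norm_mult using nz Sy[OF x] q_bound_nonneg Z
              by (intro mult_mono) auto
            also have "norm (of_real (dp x) * (v x / of_real (p x))) \<le> P' * ((1 / p0) * S)"
            proof -
              have "(1 / p0) * norm (v x) \<le> (1 / p0) * S"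
                using Sv[OF x] p0_pos by (intro mult_left_mono) auto
              then show ?thesis
                unfolding norm_mult using P'[of x] x vp[of x] P'0 by (intro mult_mono) auto
            qed
            also have "norm (h x) = \<epsilon> * norm (A u x)" using x \<epsilon> by (simp add: h norm_mult)
            finally have "norm (of_real (p x) * w x) \<le> (q_bound + Z + P' / p0) * S + \<epsilon> * norm (A u x)"
              by (simp add: algebra_simps)
            moreover have "p0 * norm (w x) \<le> norm (of_real (p x) * w x)"
              using p_ge[of x] p_pos[of x] by (simp add: norm_mult mult_right_mono)
            ultimately have "p0 * norm (w x) \<le> (q_bound + Z + P' / p0) * S + \<epsilon> * norm (A u x)" by linarith
            then have "norm (w x) \<le> c1 * S + \<epsilon> * norm (A u x) / p0"
              unfolding c1_def using p0_pos by (simp add: field_simps)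
            then have "(norm (w x))\<^sup>2 \<le> (c1 * S + \<epsilon> * norm (A u x) / p0)\<^sup>2"
              by (intro power_mono) auto
            also have "\<dots> \<le> 2 * (c1 * S)\<^sup>2 + 2 * (\<epsilon> * norm (A u x) / p0)\<^sup>2"
              using sum_squares_bound[of "c1 * S" "\<epsilon> * norm (A u x) / p0"] unfolding power2_sum by linarith
            also have "\<dots> = 2 * c1\<^sup>2 * S\<^sup>2 + (2 / p0\<^sup>2 * \<epsilon>\<^sup>2) * (norm (A u x))\<^sup>2"
              by (simp add: power_mult_distrib power_divide)
            finally show "(norm (w x))\<^sup>2 \<le> 2 * c1\<^sup>2 * S\<^sup>2 + (2 / p0\<^sup>2 * \<epsilon>\<^sup>2) * (norm (A u x))\<^sup>2" .
          qed
        qed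
        show "integrable (lebesgue_on ?Q) (\<lambda>x. 2 * c1\<^sup>2 * S\<^sup>2 + (2 / p0\<^sup>2 * \<epsilon>\<^sup>2) * (norm (A u x))\<^sup>2)"
          using Ai const(1) by (intro Bochner_Integration.integrable_add integrable_mult_right) auto
      qed (use L2Q in \<open>simp add: L2_space_def\<close>)
      also have "\<dots> = (LINT x|lebesgue_on ?Q. 2 * c1\<^sup>2 * S\<^sup>2) + (LINT x|lebesgue_on ?Q. (2 / p0\<^sup>2 * \<epsilon>\<^sup>2) * (norm (A u x))\<^sup>2)"
        using Ai const(1) by (intro Bochner_Integration.integral_add integrable_mult_right) auto
      also have "\<dots> = l * (2 * c1\<^sup>2 * S\<^sup>2) + (2 / p0\<^sup>2 * \<epsilon>\<^sup>2) * G\<^sup>2"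
        unfolding const G_def L2_norm_square by simp
      finally show ?thesis by (simp add: algebra_simps)
    qed
    have "(W22_norm ?Q u)\<^sup>2 \<le> (C1 * S + C2 * (\<epsilon> * G))\<^sup>2"
    proof -
      have "C1\<^sup>2 = l * (1 + (1 / p0)\<^sup>2 + 2 * c1\<^sup>2)" "C2\<^sup>2 = 2 / p0\<^sup>2"
        unfolding C1_def C2_def using l by simp_all
      then have "(C1 * S)\<^sup>2 + (C2 * (\<epsilon> * G))\<^sup>2 =
          l * S\<^sup>2 + l * ((1 / p0)\<^sup>2 * S\<^sup>2) + (l * (2 * c1\<^sup>2 * S\<^sup>2) + (2 / p0\<^sup>2) * (\<epsilon>\<^sup>2 * G\<^sup>2))"
        by (simp add: power_mult_distrib algebra_simps)
      then have "(W22_norm ?Q u)\<^sup>2 \<le> (C1 * S)\<^sup>2 + (C2 * (\<epsilon> * G))\<^sup>2"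
        unfolding W using n1 n2 n3 by linarith
      also have "\<dots> \<le> (C1 * S + C2 * (\<epsilon> * G))\<^sup>2"
        using C12 S0 \<epsilon> G0 unfolding power2_sum by simp
      finally show ?thesis .
    qed
    then have "W22_norm ?Q u \<le> C1 * S + C2 * (\<epsilon> * G)"
      by (rule power2_le_imp_le) (use C12 S0 \<epsilon> G0 in auto)
    then have "G \<le> C * (C1 * S + C2 * (\<epsilon> * G))"
      using GW mult_left_mono[OF _ C] order_trans by blast
    also have "\<dots> = C * C1 * E * N + \<epsilon> * k * G"
      unfolding S_def k_def by (simp add: algebra_simps)
    also have "\<epsilon> * k * G \<le> (1 / 2) * G"
    proof (rule mult_right_mono[OF _ G0])
      have "\<epsilon> * k \<le> \<epsilon>0 * (k + 1)" using \<epsilon> k by (intro mult_mono) auto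
      also have "\<dots> = 1 / 2" unfolding \<epsilon>0_def using k by (simp add: field_simps)
      finally show "\<epsilon> * k \<le> 1 / 2" .
    qed
    finally have G: "G \<le> M0 * N" unfolding M0_def by simp
    have GM: "G \<le> M * N" using G mult_right_mono[OF MM(1) N0] by linarith
    have "sqrt l * G \<le> M * N"
    proof -
      have "sqrt l * G \<le> sqrt l * (M0 * N)" using G l by (intro mult_left_mono) auto
      also have "\<dots> \<le> M * N" using mult_right_mono[OF MM(2) N0] by (simp add: mult.assoc)
      finally show ?thesis .
    qed
    then have "\<epsilon> * (sqrt l * G) \<le> \<epsilon> * M * N" using \<epsilon> by (simp add: mult.assoc)
    then have hM: "integral {r..x} (\<lambda>t. norm (h t)) \<le> \<epsilon> * M * N" for r x using hint[of r x] by linarith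
    show "\<exists>y v. (AE x in lebesgue. u x = y x) \<and> solves z h UNIV y v \<and> y \<in> L2_space UNIV \<and> v \<in> L2_space UNIV \<and>
       A u \<in> L2_space ?Q \<and> L2_norm ?Q (A u) \<le> M * (norm (y a) + norm (v a)) \<and>
       (\<forall>r x. integral {r..x} (\<lambda>t. norm (h t)) \<le> \<epsilon> * M * (norm (y a) + norm (v a)))"
      using y(1,2,4,5) Au GM hM unfolding N_def G_def by blast
  qed
qed

end

section \<open>Periodic and antiperiodic solutions\<close>

lemma L2_spaceI_bounded:
  assumes f: "f \<in> borel_measurable (lebesgue_on {a<..<b})" and B: "\<And>x. x \<in> {a<..<b} \<Longrightarrow> norm (f x) \<le> B"
  shows "f \<in> L2_space {a<..<b}"
proof -
  have "integrable (lebesgue_on {a<..<b}) (\<lambda>_. B\<^sup>2)"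
    by (cases "a \<le> b") (auto simp: emeasure_restrict_space intro!: finite_measure.integrable_const finite_measureI)
  then have "integrable (lebesgue_on {a<..<b}) (\<lambda>x. (norm (f x))\<^sup>2)"
    by (rule Bochner_Integration.integrable_bound) (use f B in \<open>auto intro!: AE_I2 power_mono\<close>)
  with f show ?thesis by (simp add: L2_space_def)
qed

context periodic_problem
begin

lemma p_1: "p 1 = 1"
  using p_periodic[of 0] p_0 by simp

text \<open>The boundary conditions of index \<open>n\<close> for the Cauchy data; since \<open>p 0 = p 1 = 1\<close>,
  the quasi-derivative and the derivative agree at both ends.\<close>

definition quasi_periodic :: "nat \<Rightarrow> (real \<Rightarrow> complex) \<Rightarrow> (real \<Rightarrow> complex) \<Rightarrow> bool" where
  "quasi_periodic n y v \<longleftrightarrow> y 1 = (-1) ^ n * y 0 \<and> v 1 = (-1) ^ n * v 0"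

text \<open>Inside the interval a solution of the boundary value problem agrees with its absolutely continuous
  representative; both Cauchy data extend continuously to the end points.\<close>

lemma bvp_solution_solves:
  assumes "\<phi> \<in> bvp_solutions p q n z"
  obtains v where "solves z (\<lambda>_. 0) {0..1} \<phi> v" "quasi_periodic n \<phi> v" "\<forall>x. x \<notin> {0..1} \<longrightarrow> \<phi> x = 0"
proof -
  let ?S = "{0<..<1::real}"
  obtain \<phi>' where supp: "\<forall>x. x \<notin> {0..1} \<longrightarrow> \<phi> x = 0" and W: "\<phi> \<in> W22_space ?S"
    and eq: "AE x in lebesgue_on ?S. sturm_liouville ?S p q \<phi> x = z * \<phi> x"
    and c': "continuous_on {0..1} \<phi>'"
    and d: "\<And>x. x \<in> {0..1} \<Longrightarrow> (\<phi> has_vector_derivative \<phi>' x) (at x within {0..1})"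
    and bc: "\<phi> 0 + (-1) ^ (n + 1) * \<phi> 1 = 0" "\<phi>' 0 + (-1) ^ (n + 1) * \<phi>' 1 = 0"
    using assms unfolding bvp_solutions_def by blast
  have S: "open ?S" "is_interval ?S" by (auto simp: is_interval_oo)
  obtain y y1 w where Y: "AE x in lebesgue. x \<in> ?S \<longrightarrow> \<phi> x = y x"
    "primitive_on ?S y y1" "primitive_on ?S y1 w" "y1 \<in> L2_space ?S" "w \<in> L2_space ?S"
    "primitive_on ?S (\<lambda>t. of_real (p t) * y1 t) (\<lambda>t. of_real (q t) * y t - sturm_liouville ?S p q \<phi> t)"
    "AE x in lebesgue. x \<in> ?S \<longrightarrow>
       of_real (q x) * y x - sturm_liouville ?S p q \<phi> x = of_real (dp x) * y1 x + of_real (p x) * w x"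
    by (rule W22_quasi_derivative[OF S W])
  have c: "continuous_on {0..1} \<phi>"
    by (rule continuous_on_vector_derivative[OF d])
  have "continuous_on ?S \<phi>" by (rule continuous_on_subset[OF c]) auto
  from continuous_AE_eq_imp_eq[OF S(1) this primitive_on_continuous[OF Y(2) S(2)] Y(1)]
  have \<phi>y: "\<phi> x = y x" if "x \<in> ?S" for x using that by blast
  have \<phi>y1: "\<phi>' x = y1 x" if x: "x \<in> ?S" for x
  proof -
    have "isCont y1 x"
      using primitive_on_continuous[OF Y(3) S(2)] x by (simp add: continuous_on_eq_continuous_at)
    then have "(y has_vector_derivative y1 x) (at x)"
      by (rule primitive_on_has_vector_derivative[OF Y(2) S(2,1) x])
    moreover have "(\<phi> has_vector_derivative \<phi>' x) (at x within ?S)"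
      using d[of x] x by (auto intro: has_vector_derivative_within_subset)
    then have "(\<phi> has_vector_derivative \<phi>' x) (at x)"
      using x by (subst (asm) at_within_open) auto
    then have "(y has_vector_derivative \<phi>' x) (at x)"
      using x by (rule has_vector_derivative_transform_within_open[OF _ S(1)]) (use \<phi>y in auto)
    ultimately show ?thesis using vector_derivative_unique_at by blast
  qed
  define v where "v x = of_real (p x) * \<phi>' x" for x
  have v\<phi>': "v x / of_real (p x) = \<phi>' x" for x using p_pos[of x] by (simp add: v_def)
  have vc: "continuous_on {0..1} v" unfolding v_def by (intro continuous_intros c' p_continuous)
  have P1: "primitive_on {0..1} \<phi> (\<lambda>t. v t / of_real (p t))"
    unfolding v\<phi>'
  proof (rule primitive_on_classical[where S = "{}"])
    fix s x :: real assume "s \<in> {0..1}" "x \<in> {0..1}"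
    then show "\<phi>' absolutely_integrable_on {s..x}"
      by (intro absolutely_integrable_continuous_real continuous_on_subset[OF c']) auto
  qed (use d c in \<open>auto simp: is_interval_cc\<close>)
  have "primitive_on ?S v (\<lambda>t. of_real (q t) * y t - sturm_liouville ?S p q \<phi> t)"
    by (rule primitive_on_cong[OF Y(6)]) (auto simp: v_def \<phi>y1)
  moreover have "AE x in lebesgue. x \<in> ?S \<longrightarrow>
      (of_real (q x) - z) * \<phi> x = of_real (q x) * y x - sturm_liouville ?S p q \<phi> x"
    using eq[unfolded AE_lebesgue_on_iff[of ?S, simplified]]
    by eventually_elim (auto simp: \<phi>y algebra_simps)
  ultimately have "primitive_on ?S v (\<lambda>t. (of_real (q t) - z) * \<phi> t)"
    by (rule primitive_on_AE_cong[OF _ S(2)])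
  then have P2: "primitive_on {0..1} v (\<lambda>t. (of_real (q t) - z) * \<phi> t)"
    by (intro primitive_on_closed_interval vc q_minus_z_mult_absolutely_integrable c) auto
  have sol: "solves z (\<lambda>_. 0) {0..1} \<phi> v" unfolding solves_def using P1 P2 by simp
  have sq: "(-1) ^ n * ((-1) ^ n * x) = x" for x :: complex
    by (simp flip: mult.assoc power_add add: mult_2[symmetric])
  have "\<phi> 0 = (-1) ^ n * \<phi> 1" "\<phi>' 0 = (-1) ^ n * \<phi>' 1" using bc by simp_all
  then have "quasi_periodic n \<phi> v"
    unfolding quasi_periodic_def v_def using sq[of "\<phi> 1"] sq[of "\<phi>' 1"] p_0 p_1 by simp
  with sol show ?thesis using supp by (rule that)
qed

lemma solves_bvp_solution:
  assumes sol: "solves z (\<lambda>_. 0) {0..1} y v" and per: "quasi_periodic n y v"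
  shows "(\<lambda>x. if x \<in> {0..1} then y x else 0) \<in> bvp_solutions p q n z"
proof -
  let ?S = "{0<..<1::real}"
  define \<phi> where "\<phi> x = (if x \<in> {0..1} then y x else 0)" for x
  have S: "open ?S" "is_interval ?S" "?S \<in> sets lebesgue" by (auto simp: is_interval_oo)
  have sub: "?S \<subseteq> {0..1}" by auto
  define y1 where "y1 x = v x / of_real (p x)" for x
  define w where "w x = (of_real (q x) - z) * y x * of_real (1 / p x) + v x * of_real (- dp x / (p x)\<^sup>2)" for x
  have yc: "continuous_on {0..1} y" "continuous_on {0..1} v"
    using solves_continuous[OF sol] by (auto simp: is_interval_cc)
  have y1c: "continuous_on {0..1} y1"
    unfolding y1_def using p_pos by (intro continuous_intros yc p_continuous) (metis less_irrefl of_real_eq_0_iff)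
  have Py: "primitive_on {0..1} y y1" and Pv: "primitive_on {0..1} v (\<lambda>t. (of_real (q t) - z) * y t)"
    using sol unfolding solves_def y1_def by auto
  have Pw: "primitive_on {0..1} y1 w"
  proof -
    have "primitive_on {0..1} (\<lambda>x. v x * of_real (1 / p x)) w"
      unfolding w_def
      by (rule primitive_on_mult[OF Pv primitive_on_subset[OF dp(4)]]) (auto simp: is_interval_cc)
    then show ?thesis by (rule primitive_on_cong) (simp add: y1_def)
  qed
  have \<phi>y: "\<phi> x = y x" if "x \<in> ?S" for x using that by (simp add: \<phi>_def)
  have ae: "AE x in lebesgue. x \<in> ?S \<longrightarrow> \<phi> x = y x" using \<phi>y by simp
  have PyS: "primitive_on ?S y y1" and PwS: "primitive_on ?S y1 w" and PvS: "primitive_on ?S v (\<lambda>t. (of_real (q t) - z) * y t)"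
    using Py Pw Pv sub primitive_on_subset by blast+
  have bnd: "\<exists>B. \<forall>x\<in>{0..1}. norm (g x) \<le> B" if "continuous_on {0..1} g" for g :: "real \<Rightarrow> complex"
  proof -
    have "bounded (g ` {0..1})" by (intro compact_imp_bounded compact_continuous_image that) auto
    then show ?thesis unfolding bounded_iff by (metis imageI)
  qed
  obtain By Bv B1 where B: "\<And>x. x \<in> {0..1} \<Longrightarrow> norm (y x) \<le> By" "\<And>x. x \<in> {0..1} \<Longrightarrow> norm (v x) \<le> Bv"
      "\<And>x. x \<in> {0..1} \<Longrightarrow> norm (y1 x) \<le> B1"
    using bnd[OF yc(1)] bnd[OF yc(2)] bnd[OF y1c] by metis
  obtain Bp where Bp: "\<And>x. x \<in> {0..1} \<Longrightarrow> \<bar>dp x\<bar> \<le> Bp"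
    using dp(2)[of 0 1] unfolding bounded_iff by (metis imageI real_norm_def)
  have contS: "g \<in> borel_measurable (lebesgue_on ?S)" if "continuous_on {0..1} g" for g :: "real \<Rightarrow> complex"
    using continuous_on_subset[OF that sub] by (intro continuous_imp_measurable_on_sets_lebesgue) auto
  have y1L: "y1 \<in> L2_space ?S" by (rule L2_spaceI_bounded[OF contS[OF y1c], of B1]) (use B sub in auto)
  have \<phi>L: "\<phi> \<in> L2_space ?S"
  proof (rule L2_spaceI_bounded)
    show "\<phi> \<in> borel_measurable (lebesgue_on ?S)"
      by (rule borel_measurable_lebesgue_on_AE[OF contS[OF yc(1)] _ S(3)]) (use \<phi>y in auto)
    show "norm (\<phi> x) \<le> By" if "x \<in> ?S" for x
      using B(1)[of x] \<phi>y[OF that] that by auto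
  qed
  have wL: "w \<in> L2_space ?S"
  proof (rule L2_spaceI_bounded)
    have "w absolutely_integrable_on {0..1}" using primitive_onD(1)[OF Pw, of 0 1] by simp
    then have "w absolutely_integrable_on ?S" by (rule set_integrable_subset) auto
    then show "w \<in> borel_measurable (lebesgue_on ?S)" by (rule absolutely_integrable_imp_borel_measurable[OF _ S(3)])
    fix x assume x: "x \<in> ?S"
    then have x': "x \<in> {0..1}" by auto
    have "norm (of_real (q x) - z) \<le> q_bound + norm z"
      using norm_triangle_ineq4[of "complex_of_real (q x)" z] q_bound[of x] by simp
    note 1 = this
    have 1: "norm ((of_real (q x) - z) * y x * of_real (1 / p x)) \<le> (q_bound + norm z) * By * (1 / p0)"
    proof -
      have "norm (complex_of_real (1 / p x)) \<le> 1 / p0"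
        unfolding norm_of_real using p_ge[of x] p0_pos p_pos[of x] by (simp add: frac_le)
      then show ?thesis
        unfolding norm_mult
        using 1 B(1)[OF x'] q_bound_nonneg order_trans[OF norm_ge_zero B(1)[OF x']] p0_pos
        by (intro mult_mono) auto
    qed
    have "\<bar>dp x\<bar> / (p x)\<^sup>2 \<le> Bp / p0\<^sup>2"
      using Bp[OF x'] p_ge[of x] p0_pos by (intro frac_le power_mono) auto
    then have "\<bar>- dp x / (p x)\<^sup>2\<bar> \<le> Bp / p0\<^sup>2" by (simp add: abs_divide)
    then have 2: "norm (v x * of_real (- dp x / (p x)\<^sup>2)) \<le> Bv * (Bp / p0\<^sup>2)"
      unfolding norm_mult norm_of_real using B(2)[OF x'] order_trans[OF norm_ge_zero B(2)[OF x']]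
      by (intro mult_mono) auto
    show "norm (w x) \<le> (q_bound + norm z) * By * (1 / p0) + Bv * (Bp / p0\<^sup>2)"
      unfolding w_def using norm_triangle_mono[OF 1 2] .
  qed
  have W: "\<phi> \<in> W22_space ?S" by (rule W22_spaceI[OF S(1,2) \<phi>L ae PyS PwS y1L wL])
  have d1: "AE x in lebesgue. x \<in> ?S \<longrightarrow> wderiv ?S \<phi> x = y1 x"
    by (rule wderiv_primitive_on[OF S(1,2) PyS ae])
  have "AE x in lebesgue. x \<in> ?S \<longrightarrow> wderiv ?S (\<lambda>t. of_real (p t) * wderiv ?S \<phi> t) x = (of_real (q x) - z) * y x"
  proof (rule wderiv_primitive_on[OF S(1,2) PvS])
    show "AE x in lebesgue. x \<in> ?S \<longrightarrow> of_real (p x) * wderiv ?S \<phi> x = v x"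
      using d1
    proof eventually_elim
      case (elim x)
      then show ?case using p_pos[of x] by (simp add: y1_def)
    qed
  qed
  then have "AE x in lebesgue. x \<in> ?S \<longrightarrow> sturm_liouville ?S p q \<phi> x = z * \<phi> x"
    unfolding sturm_liouville_def by eventually_elim (auto simp: \<phi>y algebra_simps)
  then have eq: "AE x in lebesgue_on ?S. sturm_liouville ?S p q \<phi> x = z * \<phi> x"
    by (subst AE_lebesgue_on_iff[OF S(3)])
  have d: "(\<phi> has_vector_derivative y1 x) (at x within {0..1})" if x: "x \<in> {0..1}" for x
  proof -
    have "((\<lambda>u. integral {0..u} y1) has_vector_derivative y1 x) (at x within {0..1})"
      by (rule integral_has_vector_derivative[OF y1c x])
    then have "((\<lambda>u. y 0 + integral {0..u} y1) has_vector_derivative y1 x) (at x within {0..1})"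
      by (auto intro!: derivative_eq_intros)
    then show ?thesis
      by (rule has_vector_derivative_transform[OF x, rotated])
         (use primitive_onD(3)[OF Py, of 0] in \<open>auto simp: \<phi>_def\<close>)
  qed
  have sq: "(-1) ^ n * ((-1) ^ n * x) = x" for x :: complex
    by (simp flip: mult.assoc power_add add: mult_2[symmetric])
  have "\<phi> 0 + (-1) ^ (n + 1) * \<phi> 1 = 0" "y1 0 + (-1) ^ (n + 1) * y1 1 = 0"
    using per sq[of "y 0"] sq[of "v 0"] p_0 p_1 by (auto simp: quasi_periodic_def \<phi>_def y1_def)
  then have "\<phi> \<in> bvp_solutions p q n z"
    unfolding bvp_solutions_def using W eq d y1c by (auto simp: \<phi>_def)
  then show ?thesis unfolding \<phi>_def[abs_def] .
qed

lemma quasi_derivative_eq_0_if_solution_eq_0: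
  assumes sol: "solves z h {0..1} y v" and y0: "\<And>x. x \<in> {0..1} \<Longrightarrow> y x = 0"
  shows "v 0 = 0"
proof -
  have P0: "primitive_on {0<..<1} (\<lambda>_. 0) (\<lambda>t. v t / of_real (p t))"
    by (rule primitive_on_cong[of _ y])
       (use sol y0 in \<open>auto simp: solves_def intro: primitive_on_subset\<close>)
  have vc: "continuous_on {0..1} v" using solves_continuous(2)[OF sol] by (simp add: is_interval_cc)
  have "v x = 0" if x: "x \<in> {0<..<1}" for x
  proof -
    have "continuous_on {0<..<1} (\<lambda>t. v t / of_real (p t))"
      using p_pos by (intro continuous_intros p_continuous continuous_on_subset[OF vc])
        (auto, metis less_irrefl)
    then have "isCont (\<lambda>t. v t / of_real (p t)) x"
      using x by (simp add: continuous_on_eq_continuous_at)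
    then have "((\<lambda>_. 0) has_vector_derivative v x / of_real (p x)) (at x)"
      using x by (intro primitive_on_has_vector_derivative[OF P0]) (auto simp: is_interval_oo)
    moreover have "((\<lambda>_. 0) has_vector_derivative (0::complex)) (at x)" by simp
    ultimately have "v x / of_real (p x) = 0" by (rule vector_derivative_unique_at)
    then show ?thesis using p_pos[of x] by simp
  qed
  then show ?thesis
    using continuous_constant_on_closure[of "{0<..<1}" v 0 0] vc by simp
qed

text \<open>A vanishing Wronskian with one fixed nonzero solution makes every solution a multiple of it.\<close>

lemma dim_bvp_solutions_eq_1:
  assumes sol: "solves z (\<lambda>_. 0) {0..1} y v" and per: "quasi_periodic n y v" and ne: "y 0 \<noteq> 0 \<or> v 0 \<noteq> 0"
    and W: "\<And>\<theta> \<eta>. solves z (\<lambda>_. 0) {0..1} \<theta> \<eta> \<Longrightarrow> quasi_periodic n \<theta> \<eta> \<Longrightarrow> wronskian y v \<theta> \<eta> 0 = 0"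
  shows "cfun.dim (bvp_solutions p q n z) = 1"
proof -
  define \<phi> where "\<phi> x = (if x \<in> {0..1} then y x else 0)" for x
  have \<phi>: "\<phi> \<in> bvp_solutions p q n z"
    unfolding \<phi>_def[abs_def] by (rule solves_bvp_solution[OF sol per])
  have "\<phi> \<noteq> 0"
  proof
    assume "\<phi> = 0"
    then have y0: "y x = 0" if "x \<in> {0..1}" for x using that by (metis \<phi>_def zero_fun_apply)
    then have "v 0 = 0" by (rule quasi_derivative_eq_0_if_solution_eq_0[OF sol])
    then show False using ne y0[of 0] by simp
  qed
  have span: "bvp_solutions p q n z \<subseteq> cfun.span {\<phi>}"
  proof
    fix \<theta> assume "\<theta> \<in> bvp_solutions p q n z"
    then obtain \<eta> where \<theta>: "solves z (\<lambda>_. 0) {0..1} \<theta> \<eta>" "quasi_periodic n \<theta> \<eta>" "\<forall>x. x \<notin> {0..1} \<longrightarrow> \<theta> x = 0"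
      by (rule bvp_solution_solves)
    show "\<theta> \<in> cfun.span {\<phi>}"
    proof (rule wronskian_zero_imp_proportional[OF sol \<theta>(1) is_interval_cc _ ne W[OF \<theta>(1,2)]])
      fix c assume "\<And>x. x \<in> {0..1} \<Longrightarrow> \<theta> x = c * y x"
      then have "\<theta> = (\<lambda>x. c * \<phi> x)" using \<theta>(3) by (auto simp: \<phi>_def)
      then show ?thesis by (auto intro: cfun.span_scale cfun.span_base)
    qed simp
  qed
  have "cfun.independent {\<phi>}" using \<open>\<phi> \<noteq> 0\<close> by simp
  from cfun.dim_unique[OF _ span this] \<phi> show ?thesis by simp
qed

end

text \<open>The edges of either sign are strictly increasing, so a number is listed at most twice for each parity,
  and the two edges of a degenerate lacuna are listed for the same parity. Multiplicity \<open>1\<close> excludes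
  this.\<close>

lemma simple_band_edge_nondegenerate:
  assumes be: "band_edges p q \<mu>m \<mu>p" and dim: "cfun.dim (bvp_solutions p q n z) = 1"
  obtains e where "e \<in> nondegenerate_lacuna_edges \<mu>m \<mu>p" "of_real e = z"
proof -
  define A where "A = {k. even k = even n \<and> complex_of_real (\<mu>p k) = z}"
  define B where "B = {k. k \<ge> 1 \<and> even k = even n \<and> complex_of_real (\<mu>m k) = z}"
  have card: "card A + card B = 1"
    using be dim unfolding band_edges_def A_def B_def by metis
  have lt: "\<mu>p k < \<mu>m (Suc k)" and le: "\<mu>m (Suc k) \<le> \<mu>p (Suc k)" for k
    using be unfolding band_edges_def by auto
  have "strict_mono \<mu>p" using lt le by (intro strict_mono_Suc_iff[THEN iffD2]) (meson order_less_le_trans)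
  moreover have "inj_on \<mu>m {1..}"
  proof -
    have "strict_mono (\<lambda>k. \<mu>m (Suc k))"
      using lt le by (intro strict_mono_Suc_iff[THEN iffD2]) (meson order_le_less_trans)
    then have "inj (\<lambda>k. \<mu>m (Suc k))" by (rule strict_mono_imp_inj_on)
    show ?thesis
    proof (rule inj_onI)
      fix i j assume "i \<in> {1..}" "j \<in> {1..}" "\<mu>m i = \<mu>m j"
      then show "i = j"
        using injD[OF \<open>inj (\<lambda>k. \<mu>m (Suc k))\<close>, of "i - 1" "j - 1"] by auto
    qed
  qed
  ultimately have inj: "inj \<mu>p" "inj_on \<mu>m {1..}" by (auto intro: strict_mono_imp_inj_on)
  have A1: "A \<subseteq> {k}" if "k \<in> A" for k
    using that inj(1) by (auto simp: A_def inj_def)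
  have B1: "B \<subseteq> {k}" if "k \<in> B" for k
    using that inj(2) by (auto simp: B_def inj_on_def)
  have fin: "finite A" "finite B"
    using A1 B1 by (metis finite.emptyI finite.insertI finite_subset ex_in_conv)+
  have no: "\<not> (k \<in> A \<and> k \<in> B)" for k
  proof
    assume "k \<in> A \<and> k \<in> B"
    then have "card A > 0" "card B > 0" using fin by (auto simp: card_gt_0_iff)
    then show False using card by simp
  qed
  have le': "\<mu>m k \<le> \<mu>p k" if "k \<ge> 1" for k using le[of "k - 1"] that by simp
  have "A \<union> B \<noteq> {}" using card by auto
  then obtain k where k: "k \<in> A \<or> k \<in> B" by blast
  show ?thesis
  proof (cases "k = 0")
    case True
    then have "of_real (\<mu>p 0) = z" using k by (auto simp: A_def B_def)
    then show ?thesis by (intro that[of "\<mu>p 0"]) (auto simp: nondegenerate_lacuna_edges_def)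
  next
    case False
    have "\<mu>m k \<noteq> \<mu>p k"
    proof
      assume "\<mu>m k = \<mu>p k"
      then have "k \<in> A \<and> k \<in> B" using k False by (auto simp: A_def B_def)
      then show False using no by blast
    qed
    then have "\<mu>m k < \<mu>p k" "k \<ge> 1" using le'[of k] False by auto
    then have "\<mu>m k \<in> nondegenerate_lacuna_edges \<mu>m \<mu>p" "\<mu>p k \<in> nondegenerate_lacuna_edges \<mu>m \<mu>p"
      unfolding nondegenerate_lacuna_edges_def by auto
    then show ?thesis using that k by (auto simp: A_def B_def)
  qed
qed

section \<open>Limits of eigenfunctions\<close>

text \<open>Dominated convergence: every point lies in only finitely many of the translated intervals.\<close>

lemma translates_of_integrable_tend_to_zero:
  fixes g :: "real \<Rightarrow> real"
  assumes g: "integrable lebesgue g" and \<tau>: "\<tau> \<noteq> 0"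
  shows "(\<lambda>k. integral {c..c + 1} (\<lambda>x. g (x + of_int (\<tau> * int k)))) \<longlonglongrightarrow> 0"
proof -
  have 1: "integral {c..c + 1} (\<lambda>x. g (x + m)) = (LINT x|lebesgue. indicator {c + m..c + 1 + m} x * g x)" for m
  proof -
    have si: "set_integrable lebesgue {c + m..c + 1 + m} g"
      unfolding set_integrable_def using integrable_mult_indicator[OF _ g] by simp
    have "integral {c..c + 1} (\<lambda>x. g (x + m)) = integral {c + m..c + 1 + m} g"
      using integral_shift_Icc_real[of c "c + 1" g m] by (simp add: o_def add.commute)
    also have "\<dots> = set_lebesgue_integral lebesgue {c + m..c + 1 + m} g"
      by (rule set_lebesgue_integral_eq_integral(2)[OF si, symmetric])
    finally show ?thesis by (simp add: set_lebesgue_integral_def)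
  qed
  have "(\<lambda>k. LINT x|lebesgue. indicator {c + of_int (\<tau> * int k)..c + 1 + of_int (\<tau> * int k)} x * g x)
      \<longlonglongrightarrow> (LINT x|(lebesgue :: real measure). 0)"
  proof (rule integral_dominated_convergence[of "\<lambda>_. 0" lebesgue _ "\<lambda>x. \<bar>g x\<bar>"])
    show "AE x in lebesgue. (\<lambda>k. indicator {c + of_int (\<tau> * int k)..c + 1 + of_int (\<tau> * int k)} x * g x) \<longlonglongrightarrow> 0"
    proof (rule AE_I2, rule tendsto_eventually)
      fix x
      obtain n0 :: nat where n0: "\<bar>x\<bar> + \<bar>c\<bar> + 2 \<le> real n0" using real_arch_simple by blast
      have "indicator {c + of_int (\<tau> * int k)..c + 1 + of_int (\<tau> * int k)} x * g x = 0" if "k \<ge> n0" for k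
      proof -
        have "\<bar>\<tau>\<bar> \<ge> 1" using \<tau> by simp
        then have "\<bar>of_int \<tau>\<bar> \<ge> (1::real)" by (metis of_int_1_le_iff of_int_abs)
        then have "\<bar>of_int (\<tau> * int k)\<bar> \<ge> real k"
          using mult_right_mono[of 1 "\<bar>real_of_int \<tau>\<bar>" "real k"] by (simp add: abs_mult)
        moreover have "x \<notin> {c + m..c + 1 + m}" if "\<bar>m\<bar> \<ge> real n0" for m
          using n0 that by (auto simp: abs_if split: if_splits)
        ultimately have "x \<notin> {c + of_int (\<tau> * int k)..c + 1 + of_int (\<tau> * int k)}"
          using that by (meson of_nat_mono order_trans)
        then show ?thesis by simp
      qed
      then show "\<forall>\<^sub>F k in sequentially. indicator {c + of_int (\<tau> * int k)..c + 1 + of_int (\<tau> * int k)} x * g x = 0"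
        unfolding eventually_sequentially by blast
    qed
    show "integrable lebesgue (\<lambda>x. \<bar>g x\<bar>)" using g by simp
    show "AE x in lebesgue. norm (indicator {c + of_int (\<tau> * int k)..c + 1 + of_int (\<tau> * int k)} x * g x) \<le> \<bar>g x\<bar>" for k
      by (auto simp: indicator_def)
  qed (use g in \<open>auto intro!: borel_measurable_times borel_measurable_indicator\<close>)
  then show ?thesis by (simp add: 1)
qed

context periodic_problem
begin

lemma solves_cmult: "solves z h I y v \<Longrightarrow> solves z (\<lambda>t. c * h t) I (\<lambda>t. c * y t) (\<lambda>t. c * v t)"
  using solves_add_cmult[OF solves_zero[of z I], of h y v c] by simp

lemma solves_nonzero_everywhere:
  assumes "solves z (\<lambda>_. 0) I y v" "is_interval I" "s \<in> I" "x \<in> I" "y s \<noteq> 0 \<or> v s \<noteq> 0"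
  shows "y x \<noteq> 0 \<or> v x \<noteq> 0"
  using solves_unique_zero[OF assms(1,2,4,3)] assms(5) by blast

lemma L2_solution_multiplier:
  assumes sol: "solves z (\<lambda>_. 0) I y v" and I: "is_interval I"
    and \<tau>: "\<And>x. x \<in> I \<Longrightarrow> x + of_int \<tau> \<in> I" "\<tau> \<noteq> 0" and c: "{c..c + 1} \<subseteq> I"
    and ne: "y c \<noteq> 0 \<or> v c \<noteq> 0" and L2: "y \<in> L2_space UNIV" "v \<in> L2_space UNIV"
  shows "\<exists>\<rho>. norm \<rho> < 1 \<and> (\<forall>x\<in>I. y (x + of_int \<tau>) = \<rho> * y x \<and> v (x + of_int \<tau>) = \<rho> * v x)"
proof (rule decaying_solution_multiplier[OF sol I \<tau>(1) c ne])
  have "integrable lebesgue (\<lambda>x. (norm (y x))\<^sup>2 + (norm (v x))\<^sup>2)"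
    using L2 by (simp add: L2_space_def lebesgue_on_UNIV_eq)
  from translates_of_integrable_tend_to_zero[OF this \<tau>(2)]
  show "(\<lambda>k. integral {c..c + 1} (\<lambda>x. (norm (y (x + of_int (\<tau> * int k))))\<^sup>2 +
        (norm (v (x + of_int (\<tau> * int k))))\<^sup>2)) \<longlonglongrightarrow> 0" .
next
  fix \<rho>
  assume "norm \<rho> < 1" "\<And>x. x \<in> I \<Longrightarrow> y (x + of_int \<tau>) = \<rho> * y x"
    "\<And>x. x \<in> I \<Longrightarrow> v (x + of_int \<tau>) = \<rho> * v x"
  then show ?thesis by blast
qed

text \<open>For some number \<open>X\<close> the Wronskian of the two solutions is \<open>\<rho>' X\<close> at \<open>0\<close> and \<open>\<rho> X\<close> at \<open>1\<close>, and it is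
  constant. If \<open>\<rho> \<noteq> \<rho>'\<close>, then \<open>X = 0\<close>, the solutions are proportional and \<open>\<rho> \<rho>' = 1\<close>, which contradicts
  the bounds.\<close>

lemma left_right_multipliers_eq:
  assumes W: "solves z (\<lambda>_. 0) {0..1} y1 v1" "y1 1 = \<rho> * y1 0" "v1 1 = \<rho> * v1 0" "y1 0 \<noteq> 0 \<or> v1 0 \<noteq> 0"
    and V: "solves z (\<lambda>_. 0) {0..1} y2 v2" "y2 0 = \<rho>' * y2 1" "v2 0 = \<rho>' * v2 1" "y2 1 \<noteq> 0 \<or> v2 1 \<noteq> 0"
    and \<rho>: "norm \<rho> < 1" "norm \<rho>' < 1"
  shows "\<rho> = \<rho>'"
proof (rule ccontr)
  assume "\<rho> \<noteq> \<rho>'"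
  have "wronskian y1 v1 y2 v2 1 = wronskian y1 v1 y2 v2 0"
    by (rule wronskian_constant[OF W(1) V(1)]) (auto simp: is_interval_cc)
  then have "(\<rho> - \<rho>') * (y1 0 * v2 1 - v1 0 * y2 1) = 0"
    unfolding wronskian_def W(2,3) V(2,3) by (simp add: algebra_simps)
  then have "y1 0 * v2 1 - v1 0 * y2 1 = 0" using \<open>\<rho> \<noteq> \<rho>'\<close> by simp
  moreover have "wronskian y1 v1 y2 v2 0 = \<rho>' * (y1 0 * v2 1 - v1 0 * y2 1)"
    unfolding wronskian_def V(2,3) by (simp add: algebra_simps)
  ultimately have w0: "wronskian y1 v1 y2 v2 0 = 0" by simp
  show False
  proof (rule wronskian_zero_imp_proportional[OF W(1) V(1) is_interval_cc _ W(4) w0])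
    fix c assume c: "\<And>x. x \<in> {0..1} \<Longrightarrow> y2 x = c * y1 x" "\<And>x. x \<in> {0..1} \<Longrightarrow> v2 x = c * v1 x"
    have "y2 1 = \<rho> * y2 0" "v2 1 = \<rho> * v2 0"
      using c(1)[of 0] c(1)[of 1] c(2)[of 0] c(2)[of 1] W(2,3) by simp_all
    then have "y2 1 = (\<rho> * \<rho>') * y2 1" "v2 1 = (\<rho> * \<rho>') * v2 1" using V(2,3) by (metis mult.assoc)+
    then have "\<rho> * \<rho>' = 1" using V(4) by auto
    then have "norm \<rho> * norm \<rho>' = 1" by (metis norm_mult norm_one)
    moreover have "norm \<rho> * norm \<rho>' < 1 * 1" using \<rho> by (intro mult_strict_mono) auto
    ultimately show False by simp
  qed simp
qed

text \<open>By uniqueness the relations at the points \<open>r\<close> and \<open>l\<close> hold everywhere, and moving forth and back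
  by one period gives \<open>\<rho>\<^sup>2 = 1\<close>.\<close>

lemma limit_is_periodic:
  assumes sol: "solves \<zeta> (\<lambda>_. 0) UNIV y v" and ne: "y s \<noteq> 0 \<or> v s \<noteq> 0"
    and r: "y (r + 1) = \<rho> * y r" "v (r + 1) = \<rho> * v r" and l: "y l = \<rho> * y (l + 1)" "v l = \<rho> * v (l + 1)"
  obtains k :: nat where "\<rho> = (-1) ^ k" "\<And>x. y (x + 1) = \<rho> * y x" "\<And>x. v (x + 1) = \<rho> * v x"
proof -
  have sh: "solves \<zeta> (\<lambda>_. 0) UNIV (\<lambda>t. y (t + 1)) (\<lambda>t. v (t + 1))"
    using solves_shift[OF sol, of 1] by simp
  have A: "solves \<zeta> (\<lambda>_. 0) UNIV (\<lambda>t. y (t + 1) + (- \<rho>) * y t) (\<lambda>t. v (t + 1) + (- \<rho>) * v t)"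
    using solves_add_cmult[OF sh sol, of "- \<rho>"] by simp
  have A0: "y (x + 1) = \<rho> * y x" "v (x + 1) = \<rho> * v x" for x
    using solves_unique_zero[OF A is_interval_univ UNIV_I UNIV_I, of r x] r by simp_all
  have B: "solves \<zeta> (\<lambda>_. 0) UNIV (\<lambda>t. y t + (- \<rho>) * y (t + 1)) (\<lambda>t. v t + (- \<rho>) * v (t + 1))"
    using solves_add_cmult[OF sol sh, of "- \<rho>"] by simp
  have B0: "y x = \<rho> * y (x + 1)" "v x = \<rho> * v (x + 1)" for x
    using solves_unique_zero[OF B is_interval_univ UNIV_I UNIV_I, of l x] l by simp_all
  have "y s = \<rho> * \<rho> * y s" "v s = \<rho> * \<rho> * v s" using A0[of s] B0[of s] by (simp_all add: mult.assoc)
  then have "\<rho> * \<rho> = 1" using ne by auto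
  then have "\<rho> = 1 \<or> \<rho> = -1" by (simp add: square_eq_1_iff)
  then obtain k :: nat where "\<rho> = (-1) ^ k"
    using power_0[of "-1 :: complex"] power_one_right[of "-1 :: complex"] by metis
  then show ?thesis using A0 that by blast
qed

lemma integral_mult_tendsto:
  fixes f :: "nat \<Rightarrow> real \<Rightarrow> complex"
  assumes "continuous_on {0..1} \<theta>" "\<And>n. continuous_on {0..1} (f n)"
    and B: "\<And>n x. x \<in> {0..1} \<Longrightarrow> norm (f n x) \<le> B" and lim: "\<And>x. x \<in> {0..1} \<Longrightarrow> (\<lambda>n. f n x) \<longlonglongrightarrow> g x"
  shows "(\<lambda>n. integral {0..1} (\<lambda>x. \<theta> x * f n x)) \<longlonglongrightarrow> integral {0..1} (\<lambda>x. \<theta> x * g x)"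
proof (rule dominated_convergence(2))
  show "(\<lambda>x. \<theta> x * f n x) integrable_on {0..1}" for n
    by (intro integrable_continuous_interval continuous_intros assms)
  show "(\<lambda>x. norm (\<theta> x) * B) integrable_on {0..1}"
    by (intro integrable_continuous_interval continuous_intros assms)
  show "norm (\<theta> x * f n x) \<le> norm (\<theta> x) * B" if "x \<in> {0..1}" for n x
    unfolding norm_mult using B[OF that] by (rule mult_left_mono) simp
  show "(\<lambda>n. \<theta> x * f n x) \<longlonglongrightarrow> \<theta> x * g x" if "x \<in> {0..1}" for x
    by (intro tendsto_intros lim that)
qed

text \<open>Symmetry of the boundary value problem: Green's formula for \<open>\<omega>\<close> and its complex conjugate.\<close>

lemma quasi_periodic_solution_real:
  assumes sol: "solves \<zeta> (\<lambda>_. 0) {0..1} \<omega> \<nu>" and per: "quasi_periodic k \<omega> \<nu>"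
    and pos: "integral {0..1} (\<lambda>x. cnj (\<omega> x) * \<omega> x) \<noteq> 0"
  shows "cnj \<zeta> = \<zeta>"
proof -
  note P = wronskian_primitive[OF solves_cnj[OF sol] sol is_interval_cc]
  have "integral {0..1} (\<lambda>x. (cnj \<zeta> - \<zeta>) * (cnj (\<omega> x) * \<omega> x)) =
      wronskian (\<lambda>t. cnj (\<omega> t)) (\<lambda>t. cnj (\<nu> t)) \<omega> \<nu> 1 - wronskian (\<lambda>t. cnj (\<omega> t)) (\<lambda>t. cnj (\<nu> t)) \<omega> \<nu> 0"
    using primitive_onD(3)[OF P, of 0 1] by simp
  also have "\<dots> = 0"
  proof -
    have sq: "(-1) ^ k * (x * ((-1) ^ k * y)) = x * y" for x y :: complex
      by (simp add: mult.left_commute mult.assoc[symmetric] flip: power_add mult_2)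
    show ?thesis
      using per unfolding quasi_periodic_def wronskian_def by (simp add: mult.assoc sq)
  qed
  finally show ?thesis using pos by simp
qed

text \<open>Here \<open>W\<close> and \<open>V\<close> are the eigenfunctions to the right and to the left of the perturbation, translated
  to \<open>[0,1]\<close>, and \<open>\<omega>\<close> is their common limit. With \<open>s = (-1)\<^sup>k\<close>, Wronskians \<open>A\<^sub>n\<close>, \<open>D\<^sub>n\<close> of \<open>\<theta>\<close>
  with the Cauchy data of \<open>W\<close>, \<open>V\<close> and the integrals \<open>F\<^sub>n\<close>, \<open>G\<^sub>n\<close> of \<open>\<theta> W\<close>, \<open>\<theta> V\<close>, Green's formula reads
  \<open>(s \<rho>\<^sub>n - 1) A\<^sub>n = (\<zeta> - z\<^sub>n) F\<^sub>n\<close> on the right and \<open>(s - \<rho>\<^sub>n) D\<^sub>n = (\<zeta> - z\<^sub>n) G\<^sub>n\<close> on the left. If \<open>\<theta>\<close> and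
  \<open>\<omega>\<close> are independent, the limits of \<open>A\<^sub>n\<close> and of \<open>s D\<^sub>n\<close> are the same nonzero number, and \<open>\<zeta> \<noteq> z\<^sub>n\<close> as
  \<open>\<bar>\<rho>\<^sub>n\<bar> < 1\<close>. Elimination gives \<open>s D\<^sub>n F\<^sub>n + A\<^sub>n G\<^sub>n = 0\<close>, and in the limit the integral of \<open>\<theta> \<omega>\<close>
  vanishes. If one such \<open>\<theta>\<close> existed, the same would hold for its sum with the complex conjugate of
  \<open>\<omega>\<close> or for that conjugate itself, and the integral of \<open>\<bar>\<omega>\<bar>\<^sup>2\<close> would vanish.\<close>

lemma no_transversal_quasi_periodic_solution:
  fixes W Wv V Vv :: "nat \<Rightarrow> real \<Rightarrow> complex" and z \<rho> :: "nat \<Rightarrow> complex"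
  assumes W: "\<And>n. solves (z n) (\<lambda>_. 0) {0..1} (W n) (Wv n)" "\<And>n. W n 1 = \<rho> n * W n 0" "\<And>n. Wv n 1 = \<rho> n * Wv n 0"
    and V: "\<And>n. solves (z n) (\<lambda>_. 0) {0..1} (V n) (Vv n)" "\<And>n. V n 0 = \<rho> n * V n 1" "\<And>n. Vv n 0 = \<rho> n * Vv n 1"
    and \<rho>: "\<And>n. norm (\<rho> n) < 1"
    and bound: "\<And>n x. x \<in> {0..1} \<Longrightarrow> norm (W n x) \<le> B" "\<And>n x. x \<in> {0..1} \<Longrightarrow> norm (V n x) \<le> B"
    and lim: "\<And>x. x \<in> {0..1} \<Longrightarrow> (\<lambda>n. W n x) \<longlonglongrightarrow> \<omega> x" "\<And>x. x \<in> {0..1} \<Longrightarrow> (\<lambda>n. Wv n x) \<longlonglongrightarrow> \<nu> x"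
      "\<And>x. x \<in> {0..1} \<Longrightarrow> (\<lambda>n. V n x) \<longlonglongrightarrow> \<omega> x" "\<And>x. x \<in> {0..1} \<Longrightarrow> (\<lambda>n. Vv n x) \<longlonglongrightarrow> \<nu> x"
    and \<omega>: "solves \<zeta> (\<lambda>_. 0) {0..1} \<omega> \<nu>" "quasi_periodic k \<omega> \<nu>" "integral {0..1} (\<lambda>x. cnj (\<omega> x) * \<omega> x) \<noteq> 0"
    and \<theta>: "solves \<zeta> (\<lambda>_. 0) {0..1} \<theta> \<eta>" "quasi_periodic k \<theta> \<eta>"
  shows "wronskian \<omega> \<nu> \<theta> \<eta> 0 = 0"
proof -
  define s :: complex where "s = (-1) ^ k"
  have s2: "s * s = 1" unfolding s_def by (simp flip: power_add mult_2)
  have s2': "s * (s * x) = x" for x using s2 by (simp flip: mult.assoc)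
  have cont: "continuous_on {0..1} y" if "solves z' (\<lambda>_. 0) {0..1} y v" for z' y v
    using solves_continuous(1)[OF that is_interval_cc] .
  have orth: "integral {0..1} (\<lambda>x. \<theta> x * \<omega> x) = 0"
    if \<theta>: "solves \<zeta> (\<lambda>_. 0) {0..1} \<theta> \<eta>" "quasi_periodic k \<theta> \<eta>" and ne: "wronskian \<theta> \<eta> \<omega> \<nu> 0 \<noteq> 0" for \<theta> \<eta>
  proof -
    define A where "A n = wronskian \<theta> \<eta> (W n) (Wv n) 0" for n
    define D where "D n = \<theta> 0 * Vv n 1 - \<eta> 0 * V n 1" for n
    define F where "F n = integral {0..1} (\<lambda>x. \<theta> x * W n x)" for n
    define G where "G n = integral {0..1} (\<lambda>x. \<theta> x * V n x)" for n
    have \<theta>1: "\<theta> 1 = s * \<theta> 0" "\<eta> 1 = s * \<eta> 0" using \<theta>(2) by (auto simp: quasi_periodic_def s_def)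
    have \<omega>1: "\<omega> 1 = s * \<omega> 0" "\<nu> 1 = s * \<nu> 0" using \<omega>(2) by (auto simp: quasi_periodic_def s_def)
    have e1: "(s * \<rho> n - 1) * A n = (\<zeta> - z n) * F n" for n
    proof -
      have "(\<zeta> - z n) * F n = wronskian \<theta> \<eta> (W n) (Wv n) 1 - wronskian \<theta> \<eta> (W n) (Wv n) 0"
        using primitive_onD(3)[OF wronskian_primitive[OF \<theta>(1) W(1) is_interval_cc], of 0 1 n]
        unfolding F_def by simp
      also have "\<dots> = (s * \<rho> n - 1) * A n"
        unfolding A_def wronskian_def \<theta>1 W(2,3) by (simp add: algebra_simps)
      finally show ?thesis by simp
    qed
    have e2: "(s - \<rho> n) * D n = (\<zeta> - z n) * G n" for n
    proof -
      have "(\<zeta> - z n) * G n = wronskian \<theta> \<eta> (V n) (Vv n) 1 - wronskian \<theta> \<eta> (V n) (Vv n) 0"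
        using primitive_onD(3)[OF wronskian_primitive[OF \<theta>(1) V(1) is_interval_cc], of 0 1 n]
        unfolding G_def by simp
      also have "\<dots> = (s - \<rho> n) * D n"
        unfolding D_def wronskian_def \<theta>1 V(2,3) by (simp add: algebra_simps)
      finally show ?thesis by simp
    qed
    have A: "A \<longlonglongrightarrow> wronskian \<theta> \<eta> \<omega> \<nu> 0"
      unfolding A_def wronskian_def by (intro tendsto_intros lim) auto
    have D: "D \<longlonglongrightarrow> s * wronskian \<theta> \<eta> \<omega> \<nu> 0"
    proof -
      have "D \<longlonglongrightarrow> \<theta> 0 * \<nu> 1 - \<eta> 0 * \<omega> 1"
        unfolding D_def by (intro tendsto_intros lim) auto
      then show ?thesis unfolding \<omega>1 wronskian_def by (simp add: algebra_simps)
    qed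
    have F: "F \<longlonglongrightarrow> integral {0..1} (\<lambda>x. \<theta> x * \<omega> x)"
      unfolding F_def by (rule integral_mult_tendsto[OF cont[OF \<theta>(1)] cont[OF W(1)] bound(1) lim(1)])
    have G: "G \<longlonglongrightarrow> integral {0..1} (\<lambda>x. \<theta> x * \<omega> x)"
      unfolding G_def by (rule integral_mult_tendsto[OF cont[OF \<theta>(1)] cont[OF V(1)] bound(2) lim(3)])
    have "\<forall>\<^sub>F n in sequentially. A n \<noteq> 0"
      using tendsto_imp_eventually_ne[OF A ne] .
    then have "\<forall>\<^sub>F n in sequentially. s * D n * F n + A n * G n = 0"
    proof eventually_elim
      case (elim n)
      have "s * \<rho> n \<noteq> 1"
      proof
        assume "s * \<rho> n = 1"
        then have "norm (s * \<rho> n) = 1" by simp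
        then show False using \<rho>[of n] by (simp add: s_def norm_mult norm_power)
      qed
      then have "\<zeta> \<noteq> z n" using e1[of n] elim by auto
      moreover have "(\<zeta> - z n) * (s * D n * F n + A n * G n) = 0"
      proof -
        have "(\<zeta> - z n) * (s * D n * F n + A n * G n) =
            s * D n * ((\<zeta> - z n) * F n) + A n * ((\<zeta> - z n) * G n)" by (simp add: algebra_simps)
        also have "\<dots> = A n * D n * (s * (s * \<rho> n) - \<rho> n)"
          unfolding e1[symmetric] e2[symmetric] by (simp add: algebra_simps)
        finally show ?thesis by (simp add: s2')
      qed
      ultimately show ?case by simp
    qed
    then have "(\<lambda>n. s * D n * F n + A n * G n) \<longlonglongrightarrow> 0"
      by (rule tendsto_eventually)
    moreover have "(\<lambda>n. s * D n * F n + A n * G n) \<longlonglongrightarrow>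
        s * (s * wronskian \<theta> \<eta> \<omega> \<nu> 0) * integral {0..1} (\<lambda>x. \<theta> x * \<omega> x) +
        wronskian \<theta> \<eta> \<omega> \<nu> 0 * integral {0..1} (\<lambda>x. \<theta> x * \<omega> x)"
      by (intro tendsto_intros A D F G)
    ultimately have "s * (s * wronskian \<theta> \<eta> \<omega> \<nu> 0) * integral {0..1} (\<lambda>x. \<theta> x * \<omega> x) +
        wronskian \<theta> \<eta> \<omega> \<nu> 0 * integral {0..1} (\<lambda>x. \<theta> x * \<omega> x) = 0"
      using LIMSEQ_unique by blast
    then show ?thesis using ne by (simp add: s2')
  qed
  define \<omega>' where "\<omega>' x = cnj (\<omega> x)" for x
  define \<nu>' where "\<nu>' x = cnj (\<nu> x)" for x
  have real: "cnj \<zeta> = \<zeta>" by (rule quasi_periodic_solution_real[OF \<omega>])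
  have \<omega>': "solves \<zeta> (\<lambda>_. 0) {0..1} \<omega>' \<nu>'" "quasi_periodic k \<omega>' \<nu>'"
    using solves_cnj[OF \<omega>(1)] \<omega>(2) unfolding real \<omega>'_def \<nu>'_def quasi_periodic_def by simp_all
  show ?thesis
  proof (rule ccontr)
    assume "wronskian \<omega> \<nu> \<theta> \<eta> 0 \<noteq> 0"
    then have ne: "wronskian \<theta> \<eta> \<omega> \<nu> 0 \<noteq> 0" unfolding wronskian_def by (simp add: algebra_simps)
    have "wronskian \<omega>' \<nu>' \<omega> \<nu> 0 = 0"
      using orth[OF \<omega>'] \<omega>(3) unfolding \<omega>'_def by blast
    then have "wronskian (\<lambda>t. \<omega>' t + 1 * \<theta> t) (\<lambda>t. \<nu>' t + 1 * \<eta> t) \<omega> \<nu> 0 \<noteq> 0"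
      using ne unfolding wronskian_def by (simp add: algebra_simps)
    moreover have "solves \<zeta> (\<lambda>_. 0) {0..1} (\<lambda>t. \<omega>' t + 1 * \<theta> t) (\<lambda>t. \<nu>' t + 1 * \<eta> t)"
      using solves_add_cmult[OF \<omega>'(1) \<theta>(1), of 1] by simp
    moreover have "quasi_periodic k (\<lambda>t. \<omega>' t + 1 * \<theta> t) (\<lambda>t. \<nu>' t + 1 * \<eta> t)"
      using \<omega>'(2) \<theta>(2) unfolding quasi_periodic_def by (simp add: distrib_left)
    ultimately have "integral {0..1} (\<lambda>x. (\<omega>' x + 1 * \<theta> x) * \<omega> x) = 0" using orth by blast
    moreover have "integral {0..1} (\<lambda>x. (\<omega>' x + 1 * \<theta> x) * \<omega> x) =
        integral {0..1} (\<lambda>x. \<omega>' x * \<omega> x) + integral {0..1} (\<lambda>x. \<theta> x * \<omega> x)"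
      unfolding distrib_right mult_1
      by (intro Henstock_Kurzweil_Integration.integral_add integrable_continuous_interval continuous_intros
          cont[OF \<omega>'(1)] cont[OF \<omega>(1)] cont[OF \<theta>(1)])
    ultimately show False using orth[OF \<theta> ne] \<omega>(3) unfolding \<omega>'_def by simp
  qed
qed

lemma solution_norm_square_pos:
  assumes sol: "solves \<zeta> (\<lambda>_. 0) {0..1} \<omega> \<nu>" and ne: "\<omega> 0 \<noteq> 0 \<or> \<nu> 0 \<noteq> 0"
  shows "integral {0..1} (\<lambda>x. (norm (\<omega> x))\<^sup>2) > 0"
proof -
  have c: "continuous_on {0..1} \<omega>" "continuous_on {0..1} \<nu>"
    using solves_continuous[OF sol is_interval_cc] by auto
  have c2: "continuous_on {0..1} (\<lambda>x. (norm (\<omega> x))\<^sup>2)" by (intro continuous_intros c)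
  have "integral {0..1} (\<lambda>x. (norm (\<omega> x))\<^sup>2) \<noteq> 0"
  proof
    assume 0: "integral {0..1} (\<lambda>x. (norm (\<omega> x))\<^sup>2) = 0"
    have "integral {0..1} (\<lambda>x. (norm (\<omega> x))\<^sup>2) = 0 \<longleftrightarrow> (\<forall>x\<in>{0..1}. (norm (\<omega> x))\<^sup>2 = 0)"
      by (rule integral_eq_0_iff[OF c2]) auto
    with 0 have z: "\<omega> x = 0" if "x \<in> {0..1}" for x using that by auto
    then have "\<nu> 0 = 0" by (rule quasi_derivative_eq_0_if_solution_eq_0[OF sol])
    then show False using ne z[of 0] by simp
  qed
  moreover have "integral {0..1} (\<lambda>x. (norm (\<omega> x))\<^sup>2) \<ge> 0"
    by (intro integral_nonneg integrable_continuous_interval c2) auto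
  ultimately show ?thesis by simp
qed

text \<open>The lower bound at the end says that a fixed portion of the \<open>L\<^sub>2\<close> norm of the normalised eigenfunctions
  survives in the limit; it is what puts \<open>\<zeta>\<close> into the spectrum.\<close>

lemma limit_of_eigenfunctions:
  fixes z :: "nat \<Rightarrow> complex" and y v h :: "nat \<Rightarrow> real \<Rightarrow> complex" and H :: "nat \<Rightarrow> real"
  assumes sol: "\<And>n. solves (z n) (h n) UNIV (y n) (v n)"
    and supp: "\<And>n t. t \<notin> {a<..<b} \<Longrightarrow> h n t = 0"
    and L2: "\<And>n. y n \<in> L2_space UNIV" "\<And>n. v n \<in> L2_space UNIV"
    and z: "z \<longlonglongrightarrow> \<zeta>"
    and init: "(\<lambda>n. y n a) \<longlonglongrightarrow> \<alpha>" "(\<lambda>n. v n a) \<longlonglongrightarrow> \<beta>" "\<alpha> \<noteq> 0 \<or> \<beta> \<noteq> 0"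
    and H: "\<And>n r x. integral {r..x} (\<lambda>t. norm (h n t)) \<le> H n" "H \<longlonglongrightarrow> 0"
  obtains k \<omega> \<nu> c m where "solves \<zeta> (\<lambda>_. 0) {0..1} \<omega> \<nu>" "quasi_periodic k \<omega> \<nu>" "\<omega> 0 \<noteq> 0 \<or> \<nu> 0 \<noteq> 0"
    "\<And>\<theta> \<eta>. solves \<zeta> (\<lambda>_. 0) {0..1} \<theta> \<eta> \<Longrightarrow> quasi_periodic k \<theta> \<eta> \<Longrightarrow> wronskian \<omega> \<nu> \<theta> \<eta> 0 = 0"
    "c > 0" "\<forall>\<^sub>F n in sequentially. integral {0..1} (\<lambda>x. (norm (y n (x + of_int m)))\<^sup>2) \<ge> c"
proof -
  obtain y' v' where sol': "solves \<zeta> (\<lambda>_. 0) UNIV y' v'"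
    and lim: "\<And>x. (\<lambda>n. y n x) \<longlonglongrightarrow> y' x" "\<And>x. (\<lambda>n. v n x) \<longlonglongrightarrow> v' x"
    and bound: "\<And>r x. \<exists>B\<ge>0. \<forall>n. \<forall>t\<in>{r..x}. norm (y n t) + norm (v n t) \<le> B"
    using solves_limit[OF sol z init(1,2) H] by blast
  have "y' a = \<alpha>" "v' a = \<beta>" using LIMSEQ_unique lim init by blast+
  then have nz': "y' x \<noteq> 0 \<or> v' x \<noteq> 0" for x
    using solves_nonzero_everywhere[OF sol' is_interval_univ UNIV_I UNIV_I, of a x] init(3) by simp
  have nz: "\<forall>\<^sub>F n in sequentially. y n x \<noteq> 0 \<or> v n x \<noteq> 0" for x
    using nz'[of x]
  proof
    assume "y' x \<noteq> 0"
    from tendsto_imp_eventually_ne[OF lim(1) this] show ?thesis by eventually_elim simp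
  next
    assume "v' x \<noteq> 0"
    from tendsto_imp_eventually_ne[OF lim(2) this] show ?thesis by eventually_elim simp
  qed
  have homR: "solves (z n) (\<lambda>_. 0) {b..} (y n) (v n)" for n
    by (rule solves_cong_inhom[OF solves_subset[OF sol]]) (use supp in \<open>auto simp: is_interval_ci\<close>)
  have homL: "solves (z n) (\<lambda>_. 0) {..a} (y n) (v n)" for n
    by (rule solves_cong_inhom[OF solves_subset[OF sol]]) (use supp in \<open>auto simp: is_interval_ic\<close>)
  \<comment> \<open>Translation by \<open>m\<close> takes \<open>[0,1]\<close> to the right of \<open>Q\<close>, translation by \<open>- m\<close> to the left.\<close>
  obtain m :: int where m: "b \<le> of_int m" "1 - of_int m \<le> a"
  proof -
    obtain j :: int where j: "\<bar>a\<bar> + \<bar>b\<bar> + 1 \<le> of_int j" using ex_le_of_int by blast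
    have "b \<le> of_int j" "1 - of_int j \<le> a" using j by linarith+
    then show ?thesis by (rule that)
  qed
  define M where "M = real_of_int m"
  note m = m[folded M_def]
  define good where "good n \<rho> \<longleftrightarrow> norm \<rho> < 1 \<and> (\<forall>x\<ge>b. y n (x + 1) = \<rho> * y n x \<and> v n (x + 1) = \<rho> * v n x) \<and>
      (\<forall>x\<le>a. y n (x - 1) = \<rho> * y n x \<and> v n (x - 1) = \<rho> * v n x)" for n \<rho>
  have "\<forall>\<^sub>F n in sequentially. \<exists>\<rho>. good n \<rho>"
    using nz[of b] nz[of "a - 1"] nz[of M] nz[of "1 - M"]
  proof eventually_elim
    case (elim n)
    have "\<exists>\<rho>. norm \<rho> < 1 \<and> (\<forall>x\<in>{b..}. y n (x + of_int 1) = \<rho> * y n x \<and> v n (x + of_int 1) = \<rho> * v n x)"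
      by (rule L2_solution_multiplier[OF homR _ _ _ _ elim(1) L2]) (auto simp: is_interval_ci)
    then obtain \<rho> where \<rho>: "norm \<rho> < 1" "\<forall>x\<ge>b. y n (x + 1) = \<rho> * y n x \<and> v n (x + 1) = \<rho> * v n x" by auto
    have "\<exists>\<rho>. norm \<rho> < 1 \<and> (\<forall>x\<in>{..a}. y n (x + of_int (-1)) = \<rho> * y n x \<and> v n (x + of_int (-1)) = \<rho> * v n x)"
      by (rule L2_solution_multiplier[OF homL _ _ _ _ elim(2) L2]) (auto simp: is_interval_ic)
    then obtain \<rho>' where \<rho>': "norm \<rho>' < 1" "\<forall>x\<le>a. y n (x - 1) = \<rho>' * y n x \<and> v n (x - 1) = \<rho>' * v n x" by auto
    have "\<rho> = \<rho>'"
    proof (rule left_right_multipliers_eq)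
      show "solves (z n) (\<lambda>_. 0) {0..1} (\<lambda>x. y n (x + of_int m)) (\<lambda>x. v n (x + of_int m))"
        by (rule solves_subset[OF solves_shift[OF homR]]) (use m in \<open>auto simp: M_def\<close>)
      show "solves (z n) (\<lambda>_. 0) {0..1} (\<lambda>x. y n (x + of_int (- m))) (\<lambda>x. v n (x + of_int (- m)))"
        by (rule solves_subset[OF solves_shift[OF homL]]) (use m in \<open>auto simp: M_def\<close>)
      show "y n (1 + of_int m) = \<rho> * y n (0 + of_int m)" "v n (1 + of_int m) = \<rho> * v n (0 + of_int m)"
        using \<rho>(2)[rule_format, OF m(1)] by (simp_all add: M_def add.commute)
      show "y n (0 + of_int (- m)) = \<rho>' * y n (1 + of_int (- m))" "v n (0 + of_int (- m)) = \<rho>' * v n (1 + of_int (- m))"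
        using \<rho>'(2)[rule_format, of "1 - M"] m by (simp_all add: M_def)
      show "y n (0 + of_int m) \<noteq> 0 \<or> v n (0 + of_int m) \<noteq> 0" "y n (1 + of_int (- m)) \<noteq> 0 \<or> v n (1 + of_int (- m)) \<noteq> 0"
        using elim(3,4) by (simp_all add: M_def)
    qed (use \<rho> \<rho>' in auto)
    with \<rho> \<rho>' show ?case unfolding good_def by blast
  qed
  then obtain n0 where "\<And>n. n \<ge> n0 \<Longrightarrow> \<exists>\<rho>. good n \<rho>" unfolding eventually_sequentially by blast
  then have "\<forall>n. \<exists>\<rho>. good (n + n0) \<rho>" by simp
  then obtain \<rho> where good: "\<And>n. good (n + n0) (\<rho> n)" by metis
  have \<rho>1: "norm (\<rho> n) < 1" for n using good[of n] unfolding good_def by blast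
  have right: "y (n + n0) (x + 1) = \<rho> n * y (n + n0) x" "v (n + n0) (x + 1) = \<rho> n * v (n + n0) x" if "x \<ge> b" for n x
    using good[of n] that unfolding good_def by blast+
  have left: "y (n + n0) (x - 1) = \<rho> n * y (n + n0) x" "v (n + n0) (x - 1) = \<rho> n * v (n + n0) x" if "x \<le> a" for n x
    using good[of n] that unfolding good_def by blast+
  have lim': "(\<lambda>n. y (n + n0) x) \<longlonglongrightarrow> y' x" "(\<lambda>n. v (n + n0) x) \<longlonglongrightarrow> v' x" for x
    using LIMSEQ_ignore_initial_segment[OF lim(1)] LIMSEQ_ignore_initial_segment[OF lim(2)] by blast+
  \<comment> \<open>The multipliers are quotients of values of the solutions, so that they converge.\<close>
  obtain r where r: "\<rho> \<longlonglongrightarrow> r"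
  proof -
    have quot: "\<rho> \<longlonglongrightarrow> f' (M + 1) / f' M" if "\<And>x. (\<lambda>n. f (n + n0) x) \<longlonglongrightarrow> f' x" "f' M \<noteq> 0"
      "\<And>n. f (n + n0) (M + 1) = \<rho> n * f (n + n0) M" for f :: "nat \<Rightarrow> real \<Rightarrow> complex" and f'
    proof (rule Lim_transform_eventually)
      show "(\<lambda>n. f (n + n0) (M + 1) / f (n + n0) M) \<longlonglongrightarrow> f' (M + 1) / f' M"
        by (intro tendsto_divide that)
      show "\<forall>\<^sub>F n in sequentially. f (n + n0) (M + 1) / f (n + n0) M = \<rho> n"
        using tendsto_imp_eventually_ne[OF that(1,2)] by eventually_elim (simp add: that(3))
    qed
    show ?thesis
      using nz'[of M] quot[of y y', OF lim'(1) _ right(1)[OF m(1)]] quot[of v v', OF lim'(2) _ right(2)[OF m(1)]] that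
      by blast
  qed
  have rR: "y' (M + 1) = r * y' M" "v' (M + 1) = r * v' M"
    using LIMSEQ_unique[OF lim'(1)[of "M + 1"]] tendsto_mult[OF r lim'(1)[of M]]
      LIMSEQ_unique[OF lim'(2)[of "M + 1"]] tendsto_mult[OF r lim'(2)[of M]]
    unfolding right[OF m(1)] by blast+
  have rL: "y' (- M) = r * y' (- M + 1)" "v' (- M) = r * v' (- M + 1)"
  proof -
    have e: "y (n + n0) (- M) = \<rho> n * y (n + n0) (- M + 1)" "v (n + n0) (- M) = \<rho> n * v (n + n0) (- M + 1)" for n
      using left[of "1 - M" n] m(2) by simp_all
    show "y' (- M) = r * y' (- M + 1)"
      using LIMSEQ_unique[OF lim'(1)[of "- M"]] tendsto_mult[OF r lim'(1)[of "- M + 1"]] unfolding e by blast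
    show "v' (- M) = r * v' (- M + 1)"
      using LIMSEQ_unique[OF lim'(2)[of "- M"]] tendsto_mult[OF r lim'(2)[of "- M + 1"]] unfolding e by blast
  qed
  obtain k :: nat where k: "r = (-1) ^ k" and per: "\<And>x. y' (x + 1) = r * y' x" "\<And>x. v' (x + 1) = r * v' x"
    using limit_is_periodic[OF sol' nz' rR rL] by blast
  have rr: "r * (r * x) = x" for x :: complex
    unfolding k by (simp flip: mult.assoc power_add mult_2)
  \<comment> \<open>The two translates differ by an even number of periods, over which the sign of \<open>r\<close> cancels.\<close>
  have sym: "f (x - M) = f (x + M)" if f: "\<And>x. f (x + 1) = r * f x" for f :: "real \<Rightarrow> complex" and x
  proof -
    have "f (x - M + 2 * (t + 1)) = f (x - M + 2 * t)" for t
      using f[of "x - M + 2 * t"] f[of "x - M + 2 * t + 1"] rr by (simp add: algebra_simps)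
    from periodic_of_int[of "\<lambda>t. f (x - M + 2 * t)", OF this, of 0 m] show ?thesis
      by (simp add: M_def algebra_simps)
  qed
  define \<omega> where "\<omega> x = y' (x + M)" for x
  define \<nu> where "\<nu> x = v' (x + M)" for x
  have \<omega>: "solves \<zeta> (\<lambda>_. 0) {0..1} \<omega> \<nu>"
    unfolding \<omega>_def \<nu>_def M_def by (rule solves_subset[OF solves_shift[OF sol']]) auto
  have \<omega>p: "quasi_periodic k \<omega> \<nu>"
    using per[of M] unfolding quasi_periodic_def \<omega>_def \<nu>_def k by (simp add: add.commute)
  have \<omega>0: "\<omega> 0 \<noteq> 0 \<or> \<nu> 0 \<noteq> 0" using nz'[of M] by (simp add: \<omega>_def \<nu>_def)
  obtain B1 where B1: "\<And>n t. t \<in> {M..1 + M} \<Longrightarrow> norm (y n t) \<le> B1"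
    using bound[of M "1 + M"] by (metis add_le_cancel_left add_le_same_cancel1 norm_ge_zero order_trans le_add_same_cancel1)
  obtain B2 where B2: "\<And>n t. t \<in> {- M..1 - M} \<Longrightarrow> norm (y n t) \<le> B2"
    using bound[of "- M" "1 - M"] by (metis norm_ge_zero order_trans le_add_same_cancel1)
  define c where "c = integral {0..1} (\<lambda>x. (norm (\<omega> x))\<^sup>2)"
  have c: "c > 0" unfolding c_def by (rule solution_norm_square_pos[OF \<omega> \<omega>0])
  have cont: "continuous_on A (y n)" for n A
    using solves_continuous(1)[OF sol is_interval_univ] continuous_on_subset by blast
  have "(\<lambda>n. integral {0..1} (\<lambda>x. (norm (y n (x + of_int m)))\<^sup>2)) \<longlonglongrightarrow> c"
    unfolding c_def
  proof (rule dominated_convergence(2))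
    show "(\<lambda>x. (norm (y n (x + of_int m)))\<^sup>2) integrable_on {0..1}" for n
      by (intro integrable_continuous_interval continuous_intros continuous_on_compose2[OF cont[of UNIV]]) auto
    show "norm ((norm (y n (x + of_int m)))\<^sup>2) \<le> B1\<^sup>2" if "x \<in> {0..1}" for n x
      using B1[of "x + M" n] that by (auto simp: M_def intro!: power_mono)
    show "(\<lambda>n. (norm (y n (x + of_int m)))\<^sup>2) \<longlonglongrightarrow> (norm (\<omega> x))\<^sup>2" if "x \<in> {0..1}" for x
      unfolding \<omega>_def M_def by (intro tendsto_intros lim)
  qed (rule integrable_const_ivl)
  then have ev: "\<forall>\<^sub>F n in sequentially. integral {0..1} (\<lambda>x. (norm (y n (x + of_int m)))\<^sup>2) \<ge> c / 2"
    using c by (auto intro: eventually_mono[OF order_tendstoD(1)[of _ c _ "c / 2"]])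
  have sq: "integral {0..1} (\<lambda>x. cnj (\<omega> x) * \<omega> x) \<noteq> 0"
  proof -
    have "((\<lambda>x. (norm (\<omega> x))\<^sup>2) has_integral c) {0..1}"
      unfolding c_def using solves_continuous(1)[OF \<omega> is_interval_cc]
      by (intro integrable_integral integrable_continuous_interval continuous_intros)
    from has_integral_of_real[OF this, where 'b = complex]
    have "((\<lambda>x. cnj (\<omega> x) * \<omega> x) has_integral of_real c) {0..1}"
      by (simp add: complex_norm_square mult.commute del: of_real_power)
    then show ?thesis using c by (simp add: integral_unique)
  qed
  show ?thesis
  proof (rule that[OF \<omega> \<omega>p \<omega>0])
    fix \<theta> \<eta> assume \<theta>: "solves \<zeta> (\<lambda>_. 0) {0..1} \<theta> \<eta>" "quasi_periodic k \<theta> \<eta>"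
    show "wronskian \<omega> \<nu> \<theta> \<eta> 0 = 0"
    proof (rule no_transversal_quasi_periodic_solution[of "\<lambda>n. z (n + n0)" "\<lambda>n x. y (n + n0) (x + of_int m)" "\<lambda>n x. v (n + n0) (x + of_int m)" \<rho>
        "\<lambda>n x. y (n + n0) (x + of_int (- m))" "\<lambda>n x. v (n + n0) (x + of_int (- m))" "max B1 B2"])
      show "solves (z (n + n0)) (\<lambda>_. 0) {0..1} (\<lambda>x. y (n + n0) (x + of_int m)) (\<lambda>x. v (n + n0) (x + of_int m))" for n
        by (rule solves_subset[OF solves_shift[OF homR]]) (use m in \<open>auto simp: M_def\<close>)
      show "solves (z (n + n0)) (\<lambda>_. 0) {0..1} (\<lambda>x. y (n + n0) (x + of_int (- m))) (\<lambda>x. v (n + n0) (x + of_int (- m)))" for n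
        by (rule solves_subset[OF solves_shift[OF homL]]) (use m in \<open>auto simp: M_def\<close>)
      show "y (n + n0) (1 + of_int m) = \<rho> n * y (n + n0) (0 + of_int m)"
        "v (n + n0) (1 + of_int m) = \<rho> n * v (n + n0) (0 + of_int m)" for n
        using right[OF m(1), of n] by (simp_all add: M_def add.commute)
      show "y (n + n0) (0 + of_int (- m)) = \<rho> n * y (n + n0) (1 + of_int (- m))"
        "v (n + n0) (0 + of_int (- m)) = \<rho> n * v (n + n0) (1 + of_int (- m))" for n
        using left[OF m(2), of n] by (simp_all add: M_def)
      show "norm (y (n + n0) (x + of_int m)) \<le> max B1 B2" if "x \<in> {0..1}" for n x
        using B1[of "x + M" "n + n0"] that by (auto simp: M_def le_max_iff_disj)
      show "norm (y (n + n0) (x + of_int (- m))) \<le> max B1 B2" if "x \<in> {0..1}" for n x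
        using B2[of "x - M" "n + n0"] that by (auto simp: M_def le_max_iff_disj)
      show "(\<lambda>n. y (n + n0) (x + of_int m)) \<longlonglongrightarrow> \<omega> x" "(\<lambda>n. v (n + n0) (x + of_int m)) \<longlonglongrightarrow> \<nu> x" for x
        unfolding \<omega>_def \<nu>_def M_def by (rule lim')+
      show "(\<lambda>n. y (n + n0) (x + of_int (- m))) \<longlonglongrightarrow> \<omega> x" "(\<lambda>n. v (n + n0) (x + of_int (- m))) \<longlonglongrightarrow> \<nu> x" for x
        using lim'(1)[of "x - M"] lim'(2)[of "x - M"] sym[of y', OF per(1), of x] sym[of v', OF per(2), of x]
        unfolding \<omega>_def \<nu>_def by (simp_all add: M_def)
    qed (use \<rho>1 \<omega> \<omega>p sq \<theta> in auto)
  next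
    show "c / 2 > 0" using c by simp
  qed (rule ev)
qed

end

section \<open>Convergence of the eigenvalues\<close>

lemma bounded_operator_W22_L2_mono:
  assumes "bounded_operator_W22_L2 Q C A" "C \<le> C'"
  shows "bounded_operator_W22_L2 Q C' A"
proof -
  have "C * W22_norm Q u \<le> C' * W22_norm Q u" for u
    using assms(2) by (intro mult_right_mono) (auto simp: W22_norm_def)
  then show ?thesis
    using assms(1) unfolding bounded_operator_W22_L2_def by (blast intro: order_trans)
qed

text \<open>Turns statements about the limit \<open>\<epsilon> \<rightarrow> 0\<close> into statements about sequences, so that compactness
  applies.\<close>

lemma frequently_at_right_sequence:
  fixes P :: "real \<Rightarrow> bool"
  assumes "\<exists>\<^sub>F x in at_right 0. P x"
  obtains X where "X \<longlonglongrightarrow> 0" "\<And>n::nat. 0 < X n" "\<And>n. P (X n)"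
proof -
  have "\<exists>x. 0 < x \<and> x < inverse (real (Suc n)) \<and> P x" for n
  proof (rule ccontr)
    assume "\<not> ?thesis"
    then have "\<forall>\<^sub>F x in at_right 0. \<not> P x"
      unfolding eventually_at_right_field by (intro exI[of _ "inverse (real (Suc n))"]) auto
    with assms show False by (simp add: frequently_def)
  qed
  then obtain X where X: "\<And>n. 0 < X n" "\<And>n. X n < inverse (real (Suc n))" "\<And>n. P (X n)" by metis
  have "X \<longlonglongrightarrow> 0"
    by (rule tendsto_sandwich[OF _ _ tendsto_const LIMSEQ_inverse_real_of_nat])
       (use X in \<open>auto intro!: always_eventually less_imp_le\<close>)
  then show ?thesis using X(1,3) by (rule that)
qed

text \<open>A function that keeps the distance \<open>\<eta>\<close> from the level \<open>c\<close> and has jumps below \<open>\<eta>\<close> stays locally on one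
  side of \<open>c\<close>, hence globally, as the interval is connected.\<close>

lemma local_constancy_on_interval:
  fixes f :: "real \<Rightarrow> real"
  assumes gap: "\<And>x. 0 < x \<Longrightarrow> x < r \<Longrightarrow> \<bar>f x - c\<bar> \<ge> \<eta>"
    and jump: "\<And>x. 0 < x \<Longrightarrow> x < r \<Longrightarrow> \<forall>\<^sub>F y in at x. \<bar>f y - f x\<bar> < \<eta>"
    and x: "0 < x" "x < r" and y: "0 < y" "y < r"
  shows "f x < c \<longleftrightarrow> f y < c"
proof -
  have step: "\<forall>\<^sub>F y in at x. f y < c \<longleftrightarrow> f x < c" if "0 < x" "x < r" for x
  proof -
    have "\<forall>\<^sub>F y in at x. y \<in> {0<..<r}" using that by (intro eventually_at_in_open') auto
    with jump[OF that] show ?thesis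
    proof eventually_elim
      case (elim y)
      then show ?case using gap[OF that] gap[of y] by (auto simp: abs_if split: if_splits)
    qed
  qed
  have op: "open {x \<in> {0<..<r}. f x < c \<longleftrightarrow> b}" for b
    unfolding open_dist
  proof
    fix x assume "x \<in> {x \<in> {0<..<r}. f x < c \<longleftrightarrow> b}"
    then have x: "0 < x" "x < r" "f x < c \<longleftrightarrow> b" by auto
    have "\<forall>\<^sub>F y in at x. y \<in> {0<..<r}" using x by (intro eventually_at_in_open') auto
    with step[OF x(1,2)] have "\<forall>\<^sub>F y in at x. y \<in> {x \<in> {0<..<r}. f x < c \<longleftrightarrow> b}"
      by eventually_elim (use x(3) in auto)
    then obtain d where d: "d > 0" "\<And>y. y \<noteq> x \<Longrightarrow> dist y x < d \<Longrightarrow> y \<in> {x \<in> {0<..<r}. f x < c \<longleftrightarrow> b}"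
      unfolding eventually_at by auto
    have "y \<in> {x \<in> {0<..<r}. f x < c \<longleftrightarrow> b}" if "dist y x < d" for y
      using d(2)[OF _ that] x by (cases "y = x") auto
    then show "\<exists>e>0. \<forall>y. dist y x < e \<longrightarrow> y \<in> {x \<in> {0<..<r}. f x < c \<longleftrightarrow> b}"
      using d(1) by blast
  qed
  have "connected {0<..<r}" by simp
  from connectedD[OF this op[of True] op[of False]]
  have "{x \<in> {0<..<r}. f x < c \<longleftrightarrow> True} \<inter> {0<..<r} = {} \<or> {x \<in> {0<..<r}. f x < c \<longleftrightarrow> False} \<inter> {0<..<r} = {}"
    by blast
  then show ?thesis using x y by (elim disjE) (simp_all add: set_eq_iff, blast+)
qed

context periodic_problem
begin

text \<open>The dimension makes \<open>\<zeta>\<close> an edge of a non-degenerate lacuna. For the spectrum, the eigenfunction \<open>u\<close>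
  satisfies \<open>(\<H>\<^sub>0 - \<zeta>) u = (z\<^sub>n - \<zeta>) u + \<epsilon>\<^sub>n \<L>\<^bsub>\<epsilon>\<^sub>n\<^esub> u\<close>, and both terms on the right are small relative
  to \<open>u\<close>, which a bounded resolvent does not permit.\<close>

lemma eigenvalue_cluster_point:
  fixes \<epsilon> :: "nat \<Rightarrow> real" and z :: "nat \<Rightarrow> complex"
  assumes ab: "a < b" and \<epsilon>: "\<epsilon> \<longlonglongrightarrow> 0" "\<And>n. \<epsilon> n > 0" and z: "z \<longlonglongrightarrow> \<zeta>"
    and L: "\<And>n. bounded_operator_W22_L2 {a<..<b} C (L (\<epsilon> n))"
    and ev: "\<And>n. is_eigenvalue (W22_space UNIV) (H_pert p q {a<..<b} L (\<epsilon> n)) (z n)"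
  shows "\<zeta> \<in> spectrum (W22_space UNIV) (H0 p q)" "\<exists>k. cfun.dim (bvp_solutions p q k \<zeta>) = 1"
proof -
  let ?Q = "{a<..<b}"
  obtain Z where Z: "\<And>n. norm (z n) \<le> Z" 
    using convergent_imp_bounded[OF z] by (auto simp: bounded_iff)
  have Z0: "Z \<ge> 0" using Z[of 0] norm_ge_zero order_trans by blast
  have C0: "max C 0 \<ge> 0" by simp
  define h0 where "h0 n u = (\<lambda>x. - (of_real (\<epsilon> n) * (if x \<in> ?Q then L (\<epsilon> n) u x else 0)))" for n u
  obtain M \<epsilon>0 where M: "M \<ge> 0" "\<epsilon>0 > 0"
    and est: "\<forall>\<epsilon> z A u h. 0 < \<epsilon> \<longrightarrow> \<epsilon> < \<epsilon>0 \<longrightarrow> norm z \<le> Z \<longrightarrow> bounded_operator_W22_L2 ?Q (max C 0) A \<longrightarrow>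
       u \<in> W22_space UNIV \<longrightarrow> h = (\<lambda>x. - (of_real \<epsilon> * (if x \<in> ?Q then A u x else 0))) \<longrightarrow>
       (AE x in lebesgue. H0 p q u x + h x = z * u x) \<longrightarrow>
     (\<exists>y v. (AE x in lebesgue. u x = y x) \<and> solves z h UNIV y v \<and> y \<in> L2_space UNIV \<and> v \<in> L2_space UNIV \<and>
       A u \<in> L2_space ?Q \<and> L2_norm ?Q (A u) \<le> M * (norm (y a) + norm (v a)) \<and>
       (\<forall>r x. integral {r..x} (\<lambda>t. norm (h t)) \<le> \<epsilon> * M * (norm (y a) + norm (v a))))"
    using eigenfunction_estimate[OF ab C0 Z0] by blast
  obtain n0 where n0: "\<And>n. n \<ge> n0 \<Longrightarrow> \<epsilon> n < \<epsilon>0"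
    using order_tendstoD(2)[OF \<epsilon>(1) M(2)] unfolding eventually_sequentially by blast
  define R where "R n u y v \<longleftrightarrow> u \<in> W22_space UNIV \<and> (AE x in lebesgue. H0 p q u x + h0 n u x = z n * u x) \<and>
      \<not> (AE x in lebesgue. u x = 0) \<and>
      (AE x in lebesgue. u x = y x) \<and> solves (z n) (h0 n u) UNIV y v \<and> y \<in> L2_space UNIV \<and> v \<in> L2_space UNIV \<and>
       L (\<epsilon> n) u \<in> L2_space ?Q \<and> L2_norm ?Q (L (\<epsilon> n) u) \<le> M * (norm (y a) + norm (v a)) \<and>
       (\<forall>r x. integral {r..x} (\<lambda>t. norm (h0 n u t)) \<le> \<epsilon> n * M * (norm (y a) + norm (v a)))" for n u y v
  have "\<exists>u y v. R n u y v"
    if n: "n \<ge> n0" for n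
  proof -
    obtain u where u: "u \<in> W22_space UNIV" "\<not> (AE x in lebesgue. u x = 0)"
      "AE x in lebesgue. H_pert p q ?Q L (\<epsilon> n) u x = z n * u x"
      using ev[of n] unfolding is_eigenvalue_def by blast
    have eq: "AE x in lebesgue. H0 p q u x + h0 n u x = z n * u x"
      using u(3) unfolding H_pert_def h0_def by simp
    show ?thesis
      using est[rule_format, OF \<epsilon>(2) n0[OF n] Z bounded_operator_W22_L2_mono[OF L max.cobounded1] u(1) h0_def eq] u eq
      unfolding R_def by blast
  qed
  then obtain u y v where R: "\<And>n. n \<ge> n0 \<Longrightarrow> R n (u n) (y n) (v n)" by metis
  have uyv: "u n \<in> W22_space UNIV" "AE x in lebesgue. H0 p q (u n) x + h0 n (u n) x = z n * u n x"
      "\<not> (AE x in lebesgue. u n x = 0)" "AE x in lebesgue. u n x = y n x"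
      "solves (z n) (h0 n (u n)) UNIV (y n) (v n)" "y n \<in> L2_space UNIV" "v n \<in> L2_space UNIV"
      "L (\<epsilon> n) (u n) \<in> L2_space ?Q" "L2_norm ?Q (L (\<epsilon> n) (u n)) \<le> M * (norm (y n a) + norm (v n a))"
      "\<forall>r x. integral {r..x} (\<lambda>t. norm (h0 n (u n) t)) \<le> \<epsilon> n * M * (norm (y n a) + norm (v n a))"
    if "n \<ge> n0" for n
    using R[OF that] unfolding R_def by blast+
  define N where "N n = norm (y n a) + norm (v n a)" for n
  have N: "N n > 0" if n: "n \<ge> n0" for n
  proof (rule ccontr)
    assume "\<not> N n > 0"
    then have N0: "N n = 0" using norm_ge_zero[of "y n a"] norm_ge_zero[of "v n a"] unfolding N_def by linarith
    have "y n x = 0" for x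
    proof -
      have "norm (y n x) + norm (v n x) \<le> (N n + 0) * exp (growth Z * \<bar>x - a\<bar>)"
        unfolding N_def
        by (rule solves_bound[OF uyv(5)[OF n] is_interval_univ UNIV_I UNIV_I Z])
           (use uyv(10)[OF n] N0 in \<open>simp add: N_def\<close>)
      then have "norm (y n x) + norm (v n x) \<le> 0" unfolding N0 by simp
      then have "norm (y n x) \<le> 0" using norm_ge_zero[of "v n x"] by linarith
      then show ?thesis by (rule norm_le_zero_iff[THEN iffD1])
    qed
    then show False using uyv(3,4)[OF n] by simp
  qed
  \<comment> \<open>Normalised Cauchy data at the left end of \<open>Q\<close>; compactness yields a convergent subsequence.\<close>
  define X where "X n = (y (n + n0) a / of_real (N (n + n0)), v (n + n0) a / of_real (N (n + n0)))" for n
  have X1: "norm (fst (X n)) + norm (snd (X n)) = 1" for n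
    using N[of "n + n0"] unfolding X_def by (simp add: norm_divide add_divide_distrib[symmetric]) (simp add: N_def)
  have "bounded (range X)"
  proof (rule boundedI)
    fix x assume "x \<in> range X"
    then obtain n where "x = X n" by blast
    then show "norm x \<le> 1" using X1[of n] norm_Pair_le[of "fst x" "snd x"] by simp
  qed
  then obtain l r where r: "strict_mono (r :: nat \<Rightarrow> nat)" and l: "(X \<circ> r) \<longlonglongrightarrow> l"
    using bounded_imp_convergent_subsequence by metis
  define s where "s n = r n + n0" for n
  have s: "s n \<ge> n0" for n by (simp add: s_def)
  have s_sub: "(\<lambda>n. g (s n)) \<longlonglongrightarrow> c" if "g \<longlonglongrightarrow> c" for g :: "nat \<Rightarrow> 'a::topological_space" and c
    using LIMSEQ_subseq_LIMSEQ[OF LIMSEQ_ignore_initial_segment[OF that, of n0] r] by (simp add: o_def s_def)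
  define Y where "Y n = (\<lambda>x. inverse (of_real (N (s n))) * y (s n) x)" for n
  define V where "V n = (\<lambda>x. inverse (of_real (N (s n))) * v (s n) x)" for n
  define h where "h n = (\<lambda>x. inverse (of_real (N (s n))) * h0 (s n) (u (s n)) x)" for n
  have L2c: "(\<lambda>x. c * f x) \<in> L2_space UNIV" if "f \<in> L2_space UNIV" for c f
    using that unfolding L2_space_def lebesgue_on_UNIV_eq
    by (auto simp: norm_mult power_mult_distrib intro!: borel_measurable_times)
  have YX: "(\<lambda>n. (Y n a, V n a)) = X \<circ> r"
    by (auto simp: Y_def V_def X_def s_def field_simps)
  have lims: "(\<lambda>n. Y n a) \<longlonglongrightarrow> fst l" "(\<lambda>n. V n a) \<longlonglongrightarrow> snd l"
    using tendsto_fst[OF l] tendsto_snd[OF l] unfolding YX[symmetric] by simp_all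
  have "(\<lambda>n. norm (fst ((X \<circ> r) n)) + norm (snd ((X \<circ> r) n))) \<longlonglongrightarrow> norm (fst l) + norm (snd l)"
    by (intro tendsto_intros l)
  then have "norm (fst l) + norm (snd l) = 1"
    using X1 LIMSEQ_unique[OF _ tendsto_const[of 1]] by simp
  then have l0: "fst l \<noteq> 0 \<or> snd l \<noteq> 0" by auto
  have H: "integral {r..x} (\<lambda>t. norm (h n t)) \<le> \<epsilon> (s n) * M" for n r x
  proof -
    have "integral {r..x} (\<lambda>t. norm (h n t)) = inverse (N (s n)) * integral {r..x} (\<lambda>t. norm (h0 (s n) (u (s n)) t))"
      unfolding h_def using N[OF s, of n] by (simp add: norm_mult norm_inverse)
    also have "\<dots> \<le> inverse (N (s n)) * (\<epsilon> (s n) * M * N (s n))"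
      using uyv(10)[OF s, of n] N[OF s, of n] unfolding N_def[symmetric] by (intro mult_left_mono) auto
    also have "\<dots> = \<epsilon> (s n) * M" using N[OF s, of n] by simp
    finally show ?thesis .
  qed
  have "(\<lambda>n. \<epsilon> (s n) * M) \<longlonglongrightarrow> 0 * M" by (intro tendsto_intros s_sub \<epsilon>(1))
  then have H0: "(\<lambda>n. \<epsilon> (s n) * M) \<longlonglongrightarrow> 0" by simp
  obtain k \<omega> \<nu> c m where lim: "solves \<zeta> (\<lambda>_. 0) {0..1} \<omega> \<nu>" "quasi_periodic k \<omega> \<nu>" "\<omega> 0 \<noteq> 0 \<or> \<nu> 0 \<noteq> 0"
    "\<And>\<theta> \<eta>. solves \<zeta> (\<lambda>_. 0) {0..1} \<theta> \<eta> \<Longrightarrow> quasi_periodic k \<theta> \<eta> \<Longrightarrow> wronskian \<omega> \<nu> \<theta> \<eta> 0 = 0"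
    and c: "c > 0" "\<forall>\<^sub>F n in sequentially. integral {0..1} (\<lambda>x. (norm (Y n (x + of_int m)))\<^sup>2) \<ge> c"
  proof (rule limit_of_eigenfunctions[of "\<lambda>n. z (s n)" h Y V a b \<zeta> "fst l" "snd l" "\<lambda>n. \<epsilon> (s n) * M"])
    show "solves (z (s n)) (h n) UNIV (Y n) (V n)" for n
      unfolding h_def Y_def V_def by (rule solves_cmult[OF uyv(5)[OF s]])
    show "h n t = 0" if "t \<notin> ?Q" for n t using that by (auto simp: h_def h0_def)
    show "Y n \<in> L2_space UNIV" "V n \<in> L2_space UNIV" for n
      unfolding Y_def V_def by (intro L2c uyv(6,7)[OF s])+
    show "(\<lambda>n. z (s n)) \<longlonglongrightarrow> \<zeta>" by (rule s_sub[OF z])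
  qed (use lims l0 H H0 in auto)
  show "\<exists>k. cfun.dim (bvp_solutions p q k \<zeta>) = 1"
    using dim_bvp_solutions_eq_1[OF lim] by blast
  show "\<zeta> \<in> spectrum (W22_space UNIV) (H0 p q)"
  proof (rule ccontr)
    assume "\<zeta> \<notin> spectrum (W22_space UNIV) (H0 p q)"
    then obtain C' where C': "\<And>u. u \<in> W22_space UNIV \<Longrightarrow> L2_norm UNIV u \<le> C' * L2_norm UNIV (\<lambda>x. H0 p q u x - \<zeta> * u x)"
      unfolding spectrum_def resolvent_set_def by blast
    \<comment> \<open>A bounded resolvent would give \<open>\<parallel>u\<parallel>\<^sup>2 \<le> t n \<parallel>u\<parallel>\<^sup>2\<close> although \<open>t n\<close> tends to zero.\<close>
    define t where "t n = C'\<^sup>2 * (2 * (norm (z (s n) - \<zeta>))\<^sup>2 + 2 * (\<epsilon> (s n))\<^sup>2 * M\<^sup>2 / c)" for n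
    have "t \<longlonglongrightarrow> C'\<^sup>2 * (2 * (norm (\<zeta> - \<zeta>))\<^sup>2 + 2 * 0\<^sup>2 * M\<^sup>2 / c)"
      unfolding t_def using c(1) by (intro tendsto_intros s_sub z \<epsilon>(1)) auto
    then have "\<forall>\<^sub>F n in sequentially. t n < 1" by (intro order_tendstoD(2)) auto
    from eventually_conj[OF this c(2)] obtain n where tn: "t n < 1"
      and cn: "integral {0..1} (\<lambda>x. (norm (Y n (x + of_int m)))\<^sup>2) \<ge> c"
      unfolding eventually_sequentially by blast
    define j where "j = s n"
    have j: "j \<ge> n0" by (simp add: j_def s)
    note uj = uyv[OF j]
    have Nj: "N j > 0" by (rule N[OF j])
    have um: "u j \<in> borel_measurable lebesgue" and ui: "integrable lebesgue (\<lambda>x. (norm (u j x))\<^sup>2)"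
      using uj(1) by (simp_all add: W22_space_def L2_space_def lebesgue_on_UNIV_eq)
    have ym: "y j \<in> borel_measurable lebesgue" and yi: "integrable lebesgue (\<lambda>x. (norm (y j x))\<^sup>2)"
      using uj(6) by (simp_all add: L2_space_def lebesgue_on_UNIV_eq)
    define U where "U = (L2_norm UNIV (u j))\<^sup>2"
    have Uy: "U = (LINT x|lebesgue. (norm (y j x))\<^sup>2)"
      unfolding U_def L2_norm_square lebesgue_on_UNIV_eq
      by (rule integral_cong_AE) (use um ym uj(4) in auto)
    have lower: "c * (N j)\<^sup>2 \<le> U"
    proof -
      have "c * (N j)\<^sup>2 \<le> integral {0..1} (\<lambda>x. (norm (Y n (x + of_int m)))\<^sup>2) * (N j)\<^sup>2"
        using cn by (intro mult_right_mono) auto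
      also have "\<dots> = integral {0..1} (\<lambda>x. (norm (y j (x + of_int m)))\<^sup>2)"
      proof -
        have "(inverse (N j))\<^sup>2 * (N j)\<^sup>2 = 1" using Nj by (simp flip: power_mult_distrib)
        then show ?thesis
          unfolding Y_def j_def[symmetric] using Nj by (simp add: norm_mult power_mult_distrib norm_inverse)
      qed
      also have "\<dots> = integral {of_int m..1 + of_int m} (\<lambda>x. (norm (y j x))\<^sup>2)"
        using integral_shift_Icc_real[of 0 1 "\<lambda>x. (norm (y j x))\<^sup>2" "of_int m"] by (simp add: o_def add.commute)
      also have "\<dots> \<le> U"
      proof -
        have si: "set_integrable lebesgue {of_int m..1 + of_int m} (\<lambda>x. (norm (y j x))\<^sup>2)"
          unfolding set_integrable_def using integrable_mult_indicator[OF _ yi] by simp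
        have "integral {of_int m..1 + of_int m} (\<lambda>x. (norm (y j x))\<^sup>2) =
            (LINT x|lebesgue. indicator {of_int m..1 + of_int m} x * (norm (y j x))\<^sup>2)"
          using set_lebesgue_integral_eq_integral(2)[OF si] by (simp add: set_lebesgue_integral_def)
        also have "\<dots> \<le> U"
          unfolding Uy by (rule integral_mono[OF _ yi]) (use si in \<open>auto simp: set_integrable_def indicator_def\<close>)
        finally show ?thesis .
      qed
      finally show ?thesis .
    qed
    have U0: "U > 0" using lower c(1) Nj by (smt (verit) mult_pos_pos zero_less_power)
    define A where "A x = (if x \<in> ?Q then L (\<epsilon> j) (u j) x else 0)" for x
    have Am: "A \<in> borel_measurable lebesgue" "integrable lebesgue (\<lambda>x. (norm (A x))\<^sup>2)"
      "(LINT x|lebesgue. (norm (A x))\<^sup>2) = (L2_norm ?Q (L (\<epsilon> j) (u j)))\<^sup>2"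
    proof -
      have q: "L (\<epsilon> j) (u j) \<in> borel_measurable (lebesgue_on ?Q)" "integrable (lebesgue_on ?Q) (\<lambda>x. (norm (L (\<epsilon> j) (u j) x))\<^sup>2)"
        using uj(8) by (simp_all add: L2_space_def)
      have "?Q \<in> sets lebesgue" by simp
      then show "A \<in> borel_measurable lebesgue" unfolding A_def[abs_def] using q(1) borel_measurable_if by blast
      have e: "(\<lambda>x. (norm (A x))\<^sup>2) = (\<lambda>x. indicat_real ?Q x *\<^sub>R (norm (L (\<epsilon> j) (u j) x))\<^sup>2)"
        by (auto simp: A_def indicator_def)
      show "integrable lebesgue (\<lambda>x. (norm (A x))\<^sup>2)"
        unfolding e using q(2) by (subst (asm) integrable_restrict_space) auto
      show "(LINT x|lebesgue. (norm (A x))\<^sup>2) = (L2_norm ?Q (L (\<epsilon> j) (u j)))\<^sup>2"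
        unfolding e L2_norm_square by (rule integral_restrict_space[symmetric]) auto
    qed
    have ae: "AE x in lebesgue. (z j - \<zeta>) * u j x + of_real (\<epsilon> j) * A x = H0 p q (u j) x - \<zeta> * u j x"
      using uj(2)
    proof eventually_elim
      case (elim x)
      have "H0 p q (u j) x = z j * u j x + of_real (\<epsilon> j) * A x"
        using elim unfolding h0_def A_def by (auto simp: algebra_simps)
      then show ?case by (simp add: algebra_simps)
    qed
    have "(L2_norm UNIV (\<lambda>x. H0 p q (u j) x - \<zeta> * u j x))\<^sup>2 \<le>
        (LINT x|lebesgue_on UNIV. 2 * (norm (z j - \<zeta>))\<^sup>2 * (norm (u j x))\<^sup>2 + 2 * (\<epsilon> j)\<^sup>2 * (norm (A x))\<^sup>2)"
    proof (rule L2_norm_le_AE)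
      show "(\<lambda>x. H0 p q (u j) x - \<zeta> * u j x) \<in> borel_measurable (lebesgue_on UNIV)"
        unfolding lebesgue_on_UNIV_eq by (rule borel_measurable_AE[OF _ ae]) (use um Am(1) in auto)
      show "integrable (lebesgue_on UNIV) (\<lambda>x. 2 * (norm (z j - \<zeta>))\<^sup>2 * (norm (u j x))\<^sup>2 + 2 * (\<epsilon> j)\<^sup>2 * (norm (A x))\<^sup>2)"
        unfolding lebesgue_on_UNIV_eq using ui Am(2) by simp
      show "AE x in lebesgue. x \<in> UNIV \<longrightarrow> (norm (H0 p q (u j) x - \<zeta> * u j x))\<^sup>2 \<le>
          2 * (norm (z j - \<zeta>))\<^sup>2 * (norm (u j x))\<^sup>2 + 2 * (\<epsilon> j)\<^sup>2 * (norm (A x))\<^sup>2"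
        using ae
      proof eventually_elim
        case (elim x)
        have "norm (H0 p q (u j) x - \<zeta> * u j x) \<le> norm (z j - \<zeta>) * norm (u j x) + \<bar>\<epsilon> j\<bar> * norm (A x)"
          unfolding elim[symmetric] using norm_triangle_ineq by (metis norm_mult norm_of_real)
        then have "(norm (H0 p q (u j) x - \<zeta> * u j x))\<^sup>2 \<le> (norm (z j - \<zeta>) * norm (u j x) + \<bar>\<epsilon> j\<bar> * norm (A x))\<^sup>2"
          by (intro power_mono) auto
        also have "\<dots> \<le> 2 * (norm (z j - \<zeta>) * norm (u j x))\<^sup>2 + 2 * (\<bar>\<epsilon> j\<bar> * norm (A x))\<^sup>2"
          using sum_squares_bound[of "norm (z j - \<zeta>) * norm (u j x)" "\<bar>\<epsilon> j\<bar> * norm (A x)"] unfolding power2_sum by linarith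
        finally show ?case by (simp add: power_mult_distrib)
      qed
    qed auto
    also have "\<dots> = 2 * (norm (z j - \<zeta>))\<^sup>2 * U + 2 * (\<epsilon> j)\<^sup>2 * (L2_norm ?Q (L (\<epsilon> j) (u j)))\<^sup>2"
      unfolding lebesgue_on_UNIV_eq U_def L2_norm_square Am(3)[symmetric, unfolded L2_norm_square] using ui Am(2) by simp
    also have "\<dots> \<le> 2 * (norm (z j - \<zeta>))\<^sup>2 * U + 2 * (\<epsilon> j)\<^sup>2 * (M\<^sup>2 * (U / c))"
    proof -
      have "(L2_norm ?Q (L (\<epsilon> j) (u j)))\<^sup>2 \<le> (M * N j)\<^sup>2"
        using uj(9) L2_norm_nonneg unfolding N_def by (intro power_mono) auto
      also have "\<dots> \<le> M\<^sup>2 * (U / c)"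
        unfolding power_mult_distrib using lower c(1) by (intro mult_left_mono) (auto simp: field_simps)
      finally show ?thesis by (intro add_left_mono mult_left_mono) auto
    qed
    finally have B: "(L2_norm UNIV (\<lambda>x. H0 p q (u j) x - \<zeta> * u j x))\<^sup>2 \<le>
        2 * (norm (z j - \<zeta>))\<^sup>2 * U + 2 * (\<epsilon> j)\<^sup>2 * (M\<^sup>2 * (U / c))" .
    have "U \<le> (C' * L2_norm UNIV (\<lambda>x. H0 p q (u j) x - \<zeta> * u j x))\<^sup>2"
      unfolding U_def using C'[OF uj(1)] L2_norm_nonneg by (intro power_mono) auto
    also have "\<dots> \<le> C'\<^sup>2 * (2 * (norm (z j - \<zeta>))\<^sup>2 * U + 2 * (\<epsilon> j)\<^sup>2 * (M\<^sup>2 * (U / c)))"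
      unfolding power_mult_distrib using B by (intro mult_left_mono) auto
    also have "\<dots> = t n * U" unfolding t_def j_def by (simp add: algebra_simps)
    also have "\<dots> < 1 * U" using tn U0 by (intro mult_strict_right_mono) auto
    finally show False by simp
  qed
qed

end

theorem theorem2p6:
  fixes p q :: "real \<Rightarrow> real" and p0 a b :: real
    and L :: "real \<Rightarrow> (real \<Rightarrow> complex) \<Rightarrow> real \<Rightarrow> complex"
    and \<mu>m \<mu>p :: "nat \<Rightarrow> real" and K :: "complex set" and ev :: "real \<Rightarrow> complex"
  assumes coeffs: "periodic_coefficients p q p0"
    and Q: "Q = {a<..<b}" "a < b"
    and L: "\<exists>C. \<forall>\<^sub>F \<epsilon> in at_right 0. bounded_operator_W22_L2 Q C (L \<epsilon>)"
    and edges: "band_edges p q \<mu>m \<mu>p"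
    and K: "compact K" "K \<inter> continuous_spectrum (W22_space UNIV) (H0 p q) \<noteq> {}"
    and eigenvalue: "\<forall>\<^sub>F \<epsilon> in at_right 0. is_eigenvalue (W22_space UNIV) (H_pert p q Q L \<epsilon>) (ev \<epsilon>)"
    and in_K: "\<forall>\<^sub>F \<epsilon> in at_right 0. ev \<epsilon> \<in> K"
  shows "(\<forall>\<delta>>0. \<forall>\<^sub>F \<epsilon> in at_right 0. \<exists>e \<in> nondegenerate_lacuna_edges \<mu>m \<mu>p.
            of_real e \<in> spectrum (W22_space UNIV) (H0 p q) \<inter> K \<and> dist (ev \<epsilon>) (of_real e) < \<delta>)
       \<and> (vanishing_jumps ev \<longrightarrow>
            (\<exists>e \<in> nondegenerate_lacuna_edges \<mu>m \<mu>p.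
               of_real e \<in> spectrum (W22_space UNIV) (H0 p q) \<inter> K \<and>
               (ev \<longlongrightarrow> of_real e) (at_right 0)))"
proof -
  interpret periodic_problem p q p0 by unfold_locales (rule coeffs)
  obtain C where C: "\<forall>\<^sub>F \<epsilon> in at_right 0. bounded_operator_W22_L2 Q C (L \<epsilon>)" using L by blast
  define good where "good \<epsilon> \<longleftrightarrow> bounded_operator_W22_L2 Q C (L \<epsilon>) \<and>
      is_eigenvalue (W22_space UNIV) (H_pert p q Q L \<epsilon>) (ev \<epsilon>) \<and> ev \<epsilon> \<in> K" for \<epsilon>
  define E where "E = {e \<in> nondegenerate_lacuna_edges \<mu>m \<mu>p. of_real e \<in> spectrum (W22_space UNIV) (H0 p q) \<inter> K}"
  have ev_good: "\<forall>\<^sub>F \<epsilon> in at_right 0. good \<epsilon>"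
    using C eigenvalue in_K unfolding good_def by eventually_elim simp
  have cluster_seq: "\<exists>r e. strict_mono r \<and> e \<in> E \<and> (\<lambda>n. ev (X (r n))) \<longlonglongrightarrow> of_real e"
    if X: "X \<longlonglongrightarrow> 0" "\<And>n::nat. 0 < X n" "\<And>n. good (X n)" for X
  proof -
    have "\<forall>n. ev (X n) \<in> K" using X(3) by (auto simp: good_def)
    then obtain l r where l: "l \<in> K" "strict_mono r" "((\<lambda>n. ev (X n)) \<circ> r) \<longlonglongrightarrow> l"
      using K(1) unfolding compact_def by meson
    have l': "(\<lambda>n. ev (X (r n))) \<longlonglongrightarrow> l" using l(3) by (simp add: o_def)
    have Xr: "(\<lambda>n. X (r n)) \<longlonglongrightarrow> 0" using LIMSEQ_subseq_LIMSEQ[OF X(1) l(2)] by (simp add: o_def)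
    have op: "bounded_operator_W22_L2 {a<..<b} C (L (X (r n)))"
      and eig: "is_eigenvalue (W22_space UNIV) (H_pert p q {a<..<b} L (X (r n))) (ev (X (r n)))" for n
      using X(3)[of "r n"] by (auto simp: good_def Q(1))
    note cl = eigenvalue_cluster_point[OF Q(2) Xr X(2) l' op eig]
    obtain k where "cfun.dim (bvp_solutions p q k l) = 1" using cl(2) by blast
    then obtain e where e: "e \<in> nondegenerate_lacuna_edges \<mu>m \<mu>p" "of_real e = l"
      by (rule simple_band_edge_nondegenerate[OF edges])
    then have "e \<in> E" using cl(1) l(1) by (auto simp: E_def)
    then show ?thesis using l(2) l' e(2) by blast
  qed
  have cluster: "\<exists>X e. X \<longlonglongrightarrow> 0 \<and> (\<forall>n::nat. 0 < X n \<and> P (X n)) \<and> e \<in> E \<and> (\<lambda>n. ev (X n)) \<longlonglongrightarrow> of_real e"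
    if P: "\<exists>\<^sub>F \<epsilon> in at_right 0. P \<epsilon>" for P
  proof -
    have "\<exists>\<^sub>F \<epsilon> in at_right 0. P \<epsilon> \<and> good \<epsilon>"
      by (rule frequently_eventually_frequently[OF P ev_good])
    then obtain X where X: "X \<longlonglongrightarrow> 0" "\<And>n::nat. 0 < X n" "\<And>n. P (X n) \<and> good (X n)"
      by (rule frequently_at_right_sequence) auto
    obtain r e where "strict_mono r" "e \<in> E" "(\<lambda>n. ev (X (r n))) \<longlonglongrightarrow> of_real e"
      using cluster_seq[OF X(1,2)] X(3) by blast
    moreover have "(\<lambda>n. X (r n)) \<longlonglongrightarrow> 0"
      using LIMSEQ_subseq_LIMSEQ[OF X(1) \<open>strict_mono r\<close>] by (simp add: o_def)
    ultimately show ?thesis using X(2,3) by (intro exI[of _ "\<lambda>n. X (r n)"] exI[of _ e]) auto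
  qed
  have near: "\<forall>\<^sub>F \<epsilon> in at_right 0. \<exists>e\<in>E. dist (ev \<epsilon>) (of_real e) < \<delta>" if "\<delta> > 0" for \<delta>
  proof (rule ccontr)
    assume "\<not> ?thesis"
    then have "\<exists>\<^sub>F \<epsilon> in at_right 0. \<forall>e\<in>E. \<not> dist (ev \<epsilon>) (of_real e) < \<delta>"
      by (simp add: frequently_def)
    from cluster[OF this] obtain X :: "nat \<Rightarrow> real" and e where
      "\<And>n. \<forall>e\<in>E. \<not> dist (ev (X n)) (of_real e) < \<delta>" "e \<in> E" "(\<lambda>n. ev (X n)) \<longlonglongrightarrow> of_real e"
      by blast
    then show False
      using tendstoD[OF \<open>(\<lambda>n. ev (X n)) \<longlonglongrightarrow> of_real e\<close> that] by auto
  qed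
  have "countable (nondegenerate_lacuna_edges \<mu>m \<mu>p)"
    unfolding nondegenerate_lacuna_edges_def by (intro countable_Un countable_UN) auto
  then have "countable E" unfolding E_def by (rule countable_subset[rotated]) auto
  have conv: "\<exists>e\<in>E. (ev \<longlongrightarrow> of_real e) (at_right 0)" if vj: "vanishing_jumps ev"
  proof -
    have "\<exists>\<^sub>F \<epsilon> in at_right (0::real). True" by simp
    from cluster[OF this] obtain X1 :: "nat \<Rightarrow> real" and e1
      where X1: "X1 \<longlonglongrightarrow> 0" "\<And>n. 0 < X1 n" "e1 \<in> E" "(\<lambda>n. ev (X1 n)) \<longlonglongrightarrow> of_real e1" by blast
    have "(ev \<longlongrightarrow> of_real e1) (at_right 0)"
    proof (rule tendstoI, rule ccontr)
      fix \<delta> :: real assume "\<delta> > 0" and "\<not> (\<forall>\<^sub>F \<epsilon> in at_right 0. dist (ev \<epsilon>) (of_real e1) < \<delta>)"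
      then have "\<exists>\<^sub>F \<epsilon> in at_right 0. \<not> dist (ev \<epsilon>) (of_real e1) < \<delta>" by (simp add: frequently_def)
      from cluster[OF this] obtain X2 :: "nat \<Rightarrow> real" and e2
        where X2: "X2 \<longlonglongrightarrow> 0" "\<And>n. 0 < X2 n" "\<And>n. \<not> dist (ev (X2 n)) (of_real e1) < \<delta>" "e2 \<in> E"
          "(\<lambda>n. ev (X2 n)) \<longlonglongrightarrow> of_real e2" by blast
      have "e1 \<noteq> e2"
        using tendstoD[OF X2(5) \<open>\<delta> > 0\<close>] X2(3) by auto
      \<comment> \<open>The separating level \<open>c\<close> is chosen off the countable set of edges.\<close>
      then have "uncountable {min e1 e2<..<max e1 e2}" by (auto simp: uncountable_open_interval)
      then have "\<not> {min e1 e2<..<max e1 e2} \<subseteq> E" using \<open>countable E\<close> countable_subset by blast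
      then obtain c where "c \<in> {min e1 e2<..<max e1 e2}" "c \<notin> E" by blast
      then have c: "min e1 e2 < c" "c < max e1 e2" "c \<notin> E" by simp_all
      \<comment> \<open>Otherwise some cluster point would have the real part \<open>c\<close> and hence be the edge \<open>c\<close>.\<close>
      have "\<exists>\<eta>>0. \<forall>\<^sub>F \<epsilon> in at_right 0. \<bar>Re (ev \<epsilon>) - c\<bar> \<ge> \<eta>"
      proof (rule ccontr)
        assume no: "\<not> ?thesis"
        have "\<exists>x. 0 < x \<and> x < inverse (real (Suc n)) \<and> \<bar>Re (ev x) - c\<bar> < inverse (real (Suc n)) \<and> good x" for n
        proof -
          have "\<exists>\<^sub>F \<epsilon> in at_right 0. \<bar>Re (ev \<epsilon>) - c\<bar> < inverse (real (Suc n))"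
            using no unfolding frequently_def not_less by (metis inverse_positive_iff_positive of_nat_0_less_iff zero_less_Suc)
          moreover have "\<forall>\<^sub>F \<epsilon> in at_right (0::real). 0 < \<epsilon> \<and> \<epsilon> < inverse (real (Suc n))"
            using eventually_at_right_real[of 0 "inverse (real (Suc n))"] by simp
          ultimately show ?thesis
            using frequently_ex[OF frequently_eventually_frequently[OF frequently_eventually_frequently[OF _ ev_good]]] by blast
        qed
        then obtain x where x: "\<And>n. 0 < x n" "\<And>n. x n < inverse (real (Suc n))"
            "\<And>n. \<bar>Re (ev (x n)) - c\<bar> < inverse (real (Suc n))" "\<And>n. good (x n)" by metis
        have x0: "x \<longlonglongrightarrow> 0"
          by (rule tendsto_sandwich[OF _ _ tendsto_const LIMSEQ_inverse_real_of_nat])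
             (use x in \<open>auto intro!: always_eventually less_imp_le\<close>)
        have "(\<lambda>n. Re (ev (x n)) - c) \<longlonglongrightarrow> 0"
          by (rule Lim_null_comparison[OF _ LIMSEQ_inverse_real_of_nat]) (use x in \<open>auto intro!: always_eventually less_imp_le\<close>)
        then have rc: "(\<lambda>n. Re (ev (x n))) \<longlonglongrightarrow> c" by (simp add: LIM_zero_iff)
        obtain r e where re: "strict_mono r" "e \<in> E" "(\<lambda>n. ev (x (r n))) \<longlonglongrightarrow> of_real e"
          using cluster_seq[OF x0 x(1,4)] by blast
        have "(\<lambda>n. Re (ev (x (r n)))) \<longlonglongrightarrow> e" using tendsto_Re[OF re(3)] by simp
        moreover have "(\<lambda>n. Re (ev (x (r n)))) \<longlonglongrightarrow> c"
          using LIMSEQ_subseq_LIMSEQ[OF rc re(1)] by (simp add: o_def)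
        ultimately have "e = c" by (rule LIMSEQ_unique)
        then show False using re(2) c(3) by simp
      qed
      then obtain \<eta> where \<eta>: "\<eta> > 0" "\<forall>\<^sub>F \<epsilon> in at_right 0. \<bar>Re (ev \<epsilon>) - c\<bar> \<ge> \<eta>" by blast
      have "\<forall>\<^sub>F \<epsilon> in at_right 0. \<forall>\<^sub>F \<epsilon>' in at \<epsilon>. dist (ev \<epsilon>') (ev \<epsilon>) < \<eta>"
        using vj \<eta>(1) unfolding vanishing_jumps_def by blast
      with \<eta>(2) have "\<forall>\<^sub>F \<epsilon> in at_right 0. \<bar>Re (ev \<epsilon>) - c\<bar> \<ge> \<eta> \<and> (\<forall>\<^sub>F \<epsilon>' in at \<epsilon>. dist (ev \<epsilon>') (ev \<epsilon>) < \<eta>)"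
        by eventually_elim simp
      then obtain r where r: "r > 0" "\<And>\<epsilon>. 0 < \<epsilon> \<Longrightarrow> \<epsilon> < r \<Longrightarrow> \<bar>Re (ev \<epsilon>) - c\<bar> \<ge> \<eta>"
        "\<And>\<epsilon>. 0 < \<epsilon> \<Longrightarrow> \<epsilon> < r \<Longrightarrow> \<forall>\<^sub>F \<epsilon>' in at \<epsilon>. dist (ev \<epsilon>') (ev \<epsilon>) < \<eta>"
        unfolding eventually_at_right_field by blast
      have jump: "\<forall>\<^sub>F \<epsilon>' in at \<epsilon>. \<bar>Re (ev \<epsilon>') - Re (ev \<epsilon>)\<bar> < \<eta>" if "0 < \<epsilon>" "\<epsilon> < r" for \<epsilon>
        using r(3)[OF that]
      proof eventually_elim
        case (elim \<epsilon>')
        then show ?case using abs_Re_le_cmod[of "ev \<epsilon>' - ev \<epsilon>"] by (simp add: dist_norm)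
      qed
      have same: "Re (ev x) < c \<longleftrightarrow> Re (ev y) < c" if "0 < x" "x < r" "0 < y" "y < r" for x y
        by (rule local_constancy_on_interval[where f = "\<lambda>x. Re (ev x)", OF r(2) jump that])
      have Re: "(\<lambda>n. Re (ev (X1 n))) \<longlonglongrightarrow> e1" "(\<lambda>n. Re (ev (X2 n))) \<longlonglongrightarrow> e2"
        using tendsto_Re[OF X1(4)] tendsto_Re[OF X2(5)] by simp_all
      have small: "\<forall>\<^sub>F n in sequentially. X1 n < r" "\<forall>\<^sub>F n in sequentially. X2 n < r"
        by (rule order_tendstoD(2)[OF X1(1) r(1)], rule order_tendstoD(2)[OF X2(1) r(1)])
      have "\<forall>\<^sub>F n in sequentially. (Re (ev (X1 n)) < c \<longleftrightarrow> e1 < c) \<and> (Re (ev (X2 n)) < c \<longleftrightarrow> e2 < c)"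
      proof -
        have side: "\<forall>\<^sub>F n in sequentially. f n < c \<longleftrightarrow> e < c" if "f \<longlonglongrightarrow> e" "e \<noteq> c" for f :: "nat \<Rightarrow> real" and e
        proof (cases "e < c")
          case True
          from order_tendstoD(2)[OF that(1) True] show ?thesis by eventually_elim (use True in simp)
        next
          case False
          then have "c < e" using that(2) by simp
          from order_tendstoD(1)[OF that(1) this] show ?thesis by eventually_elim (use \<open>c < e\<close> in simp)
        qed
        have "e1 \<noteq> c" "e2 \<noteq> c" using X1(3) X2(4) c(3) by auto
        from side[OF Re(1) this(1)] side[OF Re(2) this(2)] show ?thesis by eventually_elim simp
      qed
      with small have "\<forall>\<^sub>F n::nat in sequentially. e1 < c \<longleftrightarrow> e2 < c"
      proof eventually_elim
        case (elim n)
        then show ?case using same[OF X1(2)[of n] _ X2(2)[of n]] by metis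
      qed
      then show False using c(1,2) by (auto simp: min_def max_def split: if_splits)
    qed
    then show ?thesis using X1(3) by blast
  qed
  show ?thesis
  proof (intro conjI allI impI)
    fix \<delta> :: real assume "\<delta> > 0"
    from near[OF this] show "\<forall>\<^sub>F \<epsilon> in at_right 0. \<exists>e \<in> nondegenerate_lacuna_edges \<mu>m \<mu>p.
        of_real e \<in> spectrum (W22_space UNIV) (H0 p q) \<inter> K \<and> dist (ev \<epsilon>) (of_real e) < \<delta>"
      by (rule eventually_mono) (auto simp: E_def)
  next
    assume "vanishing_jumps ev"
    from conv[OF this] show "\<exists>e \<in> nondegenerate_lacuna_edges \<mu>m \<mu>p.
        of_real e \<in> spectrum (W22_space UNIV) (H0 p q) \<inter> K \<and> (ev \<longlongrightarrow> of_real e) (at_right 0)"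
      by (auto simp: E_def)
  qed
qed

end
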